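(* Let $p\ge1$ be an integer and $\tau=\omega_x+i\omega_y$ with $\omega_x,\omega_y\in\mathbb{R}$, $\omega_y>0$. Then $\mathcal{H}_{\tau,p}=\mathcal{S}(\mathbb{R})\otimes\mathbb{C}^p$ is a right pre-Hilbert $C^\infty(E_\tau)$-module, isomorphic to $\mathcal{F}_{\tau,p}$ via the map $\varphi_{\tau,p}$, if the module structure is defined on the generators $u_\tau,v_\tau$ by $$\underline{f}\triangleleft u_\tau:=\big\{W(\tfrac{\omega_y}{p},-\tfrac{\omega_x}{\omega_y})\otimes S\big\}\underline{f},\qquad \underline{f}\triangleleft v_\tau:=\big\{W(0,\tfrac{1}{\omega_y})\otimes C^*\big\}\underline{f}.$$ Moreover, the Hermitian structure on $\mathcal{H}_{\tau,p}$ corresponding via $\varphi_{\tau,p}$ to the canonical Hermitian structure $(f,g)\mapsto f^*g$ of $\mathcal{F}_{\tau,p}$ is $$\langle\underline{f},\underline{g}\rangle=\frac{1}{\omega_y}\sum_{m,n\in\mathbb{Z}}u_\tau^mv_\tau^n\int_{-\infty}^\infty(\underline{f}\,|\,\underline{g}\triangleleft u_\tau^{-m}v_\tau^{-n})_t\,\mathrm{d}t,$$ that is, $\langle\varphi_{\tau,p}(f),\varphi_{\tau,p}(g)\rangle=f^*g$ for all $f,g\in\mathcal{F}_{\tau,p}$.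
   Context: Identify $z=x+iy\in\mathbb{C}$ with $(x,y)\in\mathbb{R}^2$. Let $\Lambda=\mathbb{Z}+\tau\mathbb{Z}$ and $E_\tau=\mathbb{C}/\Lambda$. $C^\infty(E_\tau)$ is the algebra of $\Lambda$-periodic smooth functions on $\mathbb{C}$. It is generated by the unitaries $$u_\tau(x,y)=e^{2\pi i(x-\frac{\omega_x}{\omega_y}y)},\qquad v_\tau(x,y)=e^{2\pi i\frac{1}{\omega_y}y},$$ in the sense that every element is a series $\sum_{m,n\in\mathbb{Z}}a_{m,n}u_\tau^mv_\tau^n$ with rapidly decreasing coefficients. $\mathcal{F}_{\tau,p}$ is the set of smooth $f:\mathbb{C}\to\mathbb{C}$ with $f(z+1)=f(z)$ and $f(z+\tau)=e^{-\pi ip(\omega_x+2x)}f(z)$ for all $z=x+iy$. It is a $C^\infty(E_\tau)$-module under pointwise multiplication, and a pre-Hilbert module with Hermitian structure $(f,g)\mapsto f^*g=\overline f g\in C^\infty(E_\tau)$. Every $f\in\mathcal{F}_{\tau,p}$ can be written uniquely as $$f(z)=\sum_{n\in\mathbb{Z}}e^{2\pi inx}e^{\pi in^2\frac{\omega_x}{p}}f_{[n]}(y+n\tfrac{\omega_y}{p}),$$ where $[n]=n\bmod p$ and the $p$ functions $f_{[n]}$ belong to the Schwartz space $\mathcal{S}(\mathbb{R})$. The map $\varphi_{\tau,p}:\mathcal{F}_{\tau,p}\to\mathcal{H}_{\tau,p}:=\mathcal{S}(\mathbb{R})\otimes\mathbb{C}^p$, $f\mapsto\underline f=(f_{[0]},\ldots,f_{[p-1]})^t$,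 is a linear bijection. For $a,b\in\mathbb{R}$, the Weyl operator is $\{W(a,b)\psi\}(t)=e^{-\pi iab}e^{2\pi ibt}\psi(t-a)$. Components of $w\in\mathbb{C}^p$ are indexed by residues $n=0,\ldots,p-1$ mod $p$. The clock and shift matrices $C,S\in M_p(\mathbb{C})$ are $(Cw)_n=e^{2\pi in/p}w_n$ and $(Sw)_n=w_{n-1\bmod p}$ ($C=S=1$ for $p=1$). For $\psi,\varphi\in\mathcal{S}(\mathbb{R})\otimes\mathbb{C}^p$, $(\psi|\varphi)_t:=\sum_r\overline{\psi_r(t)}\varphi_r(t)$, the sum being over the $p$ components. *)

theory Defs
  imports "HOL-Analysis.Analysis" "HOL-Algebra.Module"
begin

section \<open>Smooth functions and the Schwartz space\<close>

text \<open>\<open>C_k k f\<close>: \<open>f\<close> is \<open>k\<close> times continuously (real) differentiable on the whole space.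
  On the domain \<^typ>\<open>complex\<close>, this is smoothness in the two real variables \<open>x, y\<close>.\<close>

primrec C_k :: "nat \<Rightarrow> ('a::real_normed_vector \<Rightarrow> 'b::real_normed_vector) \<Rightarrow> bool" where
  "C_k 0 f \<longleftrightarrow> continuous_on UNIV f"
| "C_k (Suc k) f \<longleftrightarrow> (\<forall>z. f differentiable (at z)) \<and> (\<forall>v. C_k k (\<lambda>z. frechet_derivative f (at z) v))"

definition smooth :: "('a::real_normed_vector \<Rightarrow> 'b::real_normed_vector) \<Rightarrow> bool" where
  "smooth f \<longleftrightarrow> (\<forall>k. C_k k f)"

definition iter_deriv :: "nat \<Rightarrow> (real \<Rightarrow> complex) \<Rightarrow> real \<Rightarrow> complex" where
  "iter_deriv k f = ((\<lambda>g t. vector_derivative g (at t)) ^^ k) f"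

definition schwartz :: "(real \<Rightarrow> complex) set" where
  "schwartz = {f. smooth f \<and> (\<forall>j k. bounded (range (\<lambda>t. t ^ j *\<^sub>R iter_deriv k f t)))}"

section \<open>The algebra of smooth functions on the torus\<close>

text \<open>Throughout, \<open>\<omega>\<^sub>x = Re \<tau>\<close>, \<open>\<omega>\<^sub>y = Im \<tau>\<close>, and a point is \<open>z = x + iy\<close> with \<open>x = Re z\<close>, \<open>y = Im z\<close>.\<close>

definition torus_lattice :: "complex \<Rightarrow> complex set" where
  "torus_lattice \<tau> = {of_int m + of_int n * \<tau> | m n. True}"

definition Cinf_torus :: "complex \<Rightarrow> (complex \<Rightarrow> complex) set" where
  "Cinf_torus \<tau> = {a. smooth a \<and> (\<forall>l\<in>torus_lattice \<tau>. \<forall>z. a (z + l) = a z)}"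

definition torus_ring :: "complex \<Rightarrow> (complex \<Rightarrow> complex) ring" where
  "torus_ring \<tau> = \<lparr>carrier = Cinf_torus \<tau>, mult = (\<lambda>a b z. a z * b z), one = (\<lambda>_. 1),
     zero = (\<lambda>_. 0), add = (\<lambda>a b z. a z + b z)\<rparr>"

definition star_fun :: "(complex \<Rightarrow> complex) \<Rightarrow> complex \<Rightarrow> complex" where
  "star_fun a = (\<lambda>z. cnj (a z))"

definition pos_fun :: "(complex \<Rightarrow> complex) \<Rightarrow> bool" where
  "pos_fun a \<longleftrightarrow> (\<forall>z. a z \<in> \<real> \<and> 0 \<le> Re (a z))"

definition torus_u :: "complex \<Rightarrow> complex \<Rightarrow> complex" where
  "torus_u \<tau> z = cis (2 * pi * (Re z - Re \<tau> / Im \<tau> * Im z))"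

definition torus_v :: "complex \<Rightarrow> complex \<Rightarrow> complex" where
  "torus_v \<tau> z = cis (2 * pi * (1 / Im \<tau> * Im z))"

definition torus_uv :: "complex \<Rightarrow> int \<Rightarrow> int \<Rightarrow> complex \<Rightarrow> complex" where
  "torus_uv \<tau> m n = (\<lambda>z. torus_u \<tau> z powi m * torus_v \<tau> z powi n)"

definition rapidly_decreasing :: "(int \<times> int \<Rightarrow> complex) \<Rightarrow> bool" where
  "rapidly_decreasing c \<longleftrightarrow>
     (\<forall>k::nat. bounded (range (\<lambda>(m, n). (1 + \<bar>of_int m\<bar> + \<bar>of_int n\<bar>) ^ k *\<^sub>R c (m, n))))"

text \<open>The coefficients \<open>a\<^sub>m\<^sub>,\<^sub>n\<close> in the expansion of \<open>a\<close> as a series in \<open>u\<^sup>m v\<^sup>n\<close>.\<close>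

definition torus_coeff :: "complex \<Rightarrow> (complex \<Rightarrow> complex) \<Rightarrow> int \<times> int \<Rightarrow> complex" where
  "torus_coeff \<tau> a = (THE c. rapidly_decreasing c \<and>
     (\<forall>z. ((\<lambda>(m, n). c (m, n) * torus_uv \<tau> m n z) has_sum a z) UNIV))"

section \<open>Right pre-Hilbert modules\<close>

text \<open>The base ring is commutative, so its right modules are the modules of \<^theory>\<open>HOL-Algebra.Module\<close>;
  \<open>a \<odot> x\<close> is to be read as the right action of \<open>a\<close> on \<open>x\<close>.  The ring carries an involution \<open>st\<close>
  and a notion of positive element \<open>pos\<close>.  When the constants lie in the ring, complex linearity
  of \<open>ip\<close> in the second argument is part of \<open>ip_act\<close>.\<close>

locale right_pre_hilbert_module = module R M for R (structure) and M (structure) +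
  fixes st :: "'a \<Rightarrow> 'a" and pos :: "'a \<Rightarrow> bool" and ip :: "'c \<Rightarrow> 'c \<Rightarrow> 'a"
  assumes st_closed: "a \<in> carrier R \<Longrightarrow> st a \<in> carrier R"
    and st_st: "a \<in> carrier R \<Longrightarrow> st (st a) = a"
    and st_add: "\<lbrakk>a \<in> carrier R; b \<in> carrier R\<rbrakk> \<Longrightarrow> st (a \<oplus>\<^bsub>R\<^esub> b) = st a \<oplus>\<^bsub>R\<^esub> st b"
    and st_mult: "\<lbrakk>a \<in> carrier R; b \<in> carrier R\<rbrakk> \<Longrightarrow> st (a \<otimes>\<^bsub>R\<^esub> b) = st b \<otimes>\<^bsub>R\<^esub> st a"
    and ip_closed: "\<lbrakk>x \<in> carrier M; y \<in> carrier M\<rbrakk> \<Longrightarrow> ip x y \<in> carrier R"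
    and ip_add: "\<lbrakk>x \<in> carrier M; y \<in> carrier M; z \<in> carrier M\<rbrakk> \<Longrightarrow>
      ip x (y \<oplus>\<^bsub>M\<^esub> z) = ip x y \<oplus>\<^bsub>R\<^esub> ip x z"
    and ip_act: "\<lbrakk>a \<in> carrier R; x \<in> carrier M; y \<in> carrier M\<rbrakk> \<Longrightarrow>
      ip x (a \<odot>\<^bsub>M\<^esub> y) = ip x y \<otimes>\<^bsub>R\<^esub> a"
    and ip_st: "\<lbrakk>x \<in> carrier M; y \<in> carrier M\<rbrakk> \<Longrightarrow> ip y x = st (ip x y)"
    and ip_pos: "x \<in> carrier M \<Longrightarrow> pos (ip x x)"
    and ip_definite: "\<lbrakk>x \<in> carrier M; ip x x = \<zero>\<^bsub>R\<^esub>\<rbrakk> \<Longrightarrow> x = \<zero>\<^bsub>M\<^esub>"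

definition module_iso :: "('a, 'r) ring_scheme \<Rightarrow> ('a, 'b, 'm) module_scheme \<Rightarrow>
    ('a, 'c, 'n) module_scheme \<Rightarrow> ('b \<Rightarrow> 'c) set" where
  "module_iso R M N = {h. bij_betw h (carrier M) (carrier N) \<and>
     (\<forall>x\<in>carrier M. \<forall>y\<in>carrier M. h (x \<oplus>\<^bsub>M\<^esub> y) = h x \<oplus>\<^bsub>N\<^esub> h y) \<and>
     (\<forall>a\<in>carrier R. \<forall>x\<in>carrier M. h (a \<odot>\<^bsub>M\<^esub> x) = a \<odot>\<^bsub>N\<^esub> h x)}"

section \<open>The modules of quasi-periodic functions\<close>

definition F_set :: "complex \<Rightarrow> nat \<Rightarrow> (complex \<Rightarrow> complex) set" where
  "F_set \<tau> p = {f. smooth f \<and> (\<forall>z. f (z + 1) = f z) \<and>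
     (\<forall>z. f (z + \<tau>) = cis (- (pi * real p * (Re \<tau> + 2 * Re z))) * f z)}"

text \<open>The fields \<open>mult\<close> and \<open>one\<close> of a module record play no role.\<close>

definition F_module :: "complex \<Rightarrow> nat \<Rightarrow> (complex \<Rightarrow> complex, complex \<Rightarrow> complex) module" where
  "F_module \<tau> p = \<lparr>carrier = F_set \<tau> p, mult = undefined, one = undefined,
     zero = (\<lambda>_. 0), add = (\<lambda>f g z. f z + g z), smult = (\<lambda>a f z. f z * a z)\<rparr>"

section \<open>Vector-valued Schwartz functions and their operators\<close>

text \<open>An element of the tensor product of the Schwartz space with \<open>\<complex>\<^sup>p\<close> is its family of components
  \<open>\<psi> 0, \<dots>, \<psi> (p - 1)\<close>, extended by zero to all natural indices.\<close>

definition H_set :: "nat \<Rightarrow> (nat \<Rightarrow> real \<Rightarrow> complex) set" where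
  "H_set p = {\<psi>. (\<forall>r<p. \<psi> r \<in> schwartz) \<and> (\<forall>r\<ge>p. \<psi> r = (\<lambda>_. 0))}"

definition weyl :: "real \<Rightarrow> real \<Rightarrow> (real \<Rightarrow> complex) \<Rightarrow> real \<Rightarrow> complex" where
  "weyl a b \<psi> = (\<lambda>t. cis (- (pi * a * b)) * cis (2 * pi * b * t) * \<psi> (t - a))"

text \<open>\<open>p \<times> p\<close> matrices are functions of two indices below \<open>p\<close>.\<close>

definition clock :: "nat \<Rightarrow> nat \<Rightarrow> nat \<Rightarrow> complex" where
  "clock p j k = (if j = k then cis (2 * pi * real j / real p) else 0)"

definition shift :: "nat \<Rightarrow> nat \<Rightarrow> nat \<Rightarrow> complex" where
  "shift p j k = (if int k = (int j - 1) mod int p then 1 else 0)"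

definition adjoint_mat :: "(nat \<Rightarrow> nat \<Rightarrow> complex) \<Rightarrow> nat \<Rightarrow> nat \<Rightarrow> complex" where
  "adjoint_mat A j k = cnj (A k j)"

lemma clock_apply: "n < p \<Longrightarrow> (\<Sum>k<p. clock p n k * w k) = cis (2 * pi * real n / real p) * w n"
  by (simp add: clock_def if_distrib[of "\<lambda>c. c * _"] cong: if_cong)

lemma shift_apply:
  assumes "n < p"
  shows "(\<Sum>k<p. shift p n k * w k) = w (nat ((int n - 1) mod int p))"
proof -
  let ?j = "nat ((int n - 1) mod int p)"
  from assms have j: "?j < p" and eq: "int k = (int n - 1) mod int p \<longleftrightarrow> k = ?j" for k
    by (auto simp: nat_less_iff)
  show ?thesis
    unfolding shift_def eq using j by (simp add: if_distrib[of "\<lambda>c. c * _"] cong: if_cong)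
qed

definition tensor_op :: "nat \<Rightarrow> ((real \<Rightarrow> complex) \<Rightarrow> real \<Rightarrow> complex) \<Rightarrow> (nat \<Rightarrow> nat \<Rightarrow> complex) \<Rightarrow>
    (nat \<Rightarrow> real \<Rightarrow> complex) \<Rightarrow> nat \<Rightarrow> real \<Rightarrow> complex" where
  "tensor_op p T A \<psi> = (\<lambda>n t. if n < p then \<Sum>k<p. A n k * T (\<psi> k) t else 0)"

definition op_u :: "complex \<Rightarrow> nat \<Rightarrow> (nat \<Rightarrow> real \<Rightarrow> complex) \<Rightarrow> nat \<Rightarrow> real \<Rightarrow> complex" where
  "op_u \<tau> p = tensor_op p (weyl (Im \<tau> / real p) (- (Re \<tau> / Im \<tau>))) (shift p)"

definition op_v :: "complex \<Rightarrow> nat \<Rightarrow> (nat \<Rightarrow> real \<Rightarrow> complex) \<Rightarrow> nat \<Rightarrow> real \<Rightarrow> complex" where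
  "op_v \<tau> p = tensor_op p (weyl 0 (1 / Im \<tau>)) (adjoint_mat (clock p))"

text \<open>Integer powers of a bijection \<open>T\<close> of the set \<open>X\<close>.\<close>

definition op_powi :: "'a set \<Rightarrow> ('a \<Rightarrow> 'a) \<Rightarrow> int \<Rightarrow> 'a \<Rightarrow> 'a" where
  "op_powi X T m = (if 0 \<le> m then T ^^ nat m else inv_into X T ^^ nat (- m))"

text \<open>The right action of \<open>u\<^sup>m v\<^sup>n\<close>, first \<open>m\<close> times \<open>u\<close> and then \<open>n\<close> times \<open>v\<close>, and its extension
  to all series in these monomials.\<close>

definition act_uv :: "complex \<Rightarrow> nat \<Rightarrow> (nat \<Rightarrow> real \<Rightarrow> complex) \<Rightarrow> int \<Rightarrow> int \<Rightarrow> nat \<Rightarrow> real \<Rightarrow> complex" where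
  "act_uv \<tau> p \<psi> m n = op_powi (H_set p) (op_v \<tau> p) n (op_powi (H_set p) (op_u \<tau> p) m \<psi>)"

definition act :: "complex \<Rightarrow> nat \<Rightarrow> (nat \<Rightarrow> real \<Rightarrow> complex) \<Rightarrow> (complex \<Rightarrow> complex) \<Rightarrow>
    nat \<Rightarrow> real \<Rightarrow> complex" where
  "act \<tau> p \<psi> a = (\<lambda>r t. \<Sum>\<^sub>\<infinity>(m, n)\<in>UNIV. torus_coeff \<tau> a (m, n) * act_uv \<tau> p \<psi> m n r t)"

definition H_module :: "complex \<Rightarrow> nat \<Rightarrow> (complex \<Rightarrow> complex, nat \<Rightarrow> real \<Rightarrow> complex) module" where
  "H_module \<tau> p = \<lparr>carrier = H_set p, mult = undefined, one = undefined,
     zero = (\<lambda>_ _. 0), add = (\<lambda>\<psi> \<eta> r t. \<psi> r t + \<eta> r t), smult = (\<lambda>a \<psi>. act \<tau> p \<psi> a)\<rparr>"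

definition inner_at :: "nat \<Rightarrow> (nat \<Rightarrow> real \<Rightarrow> complex) \<Rightarrow> (nat \<Rightarrow> real \<Rightarrow> complex) \<Rightarrow> real \<Rightarrow> complex" where
  "inner_at p \<psi> \<eta> t = (\<Sum>r<p. cnj (\<psi> r t) * \<eta> r t)"

definition herm_coeff :: "complex \<Rightarrow> nat \<Rightarrow> (nat \<Rightarrow> real \<Rightarrow> complex) \<Rightarrow> (nat \<Rightarrow> real \<Rightarrow> complex) \<Rightarrow>
    int \<Rightarrow> int \<Rightarrow> complex" where
  "herm_coeff \<tau> p \<psi> \<eta> m n = (\<integral>t. inner_at p \<psi> (act \<tau> p \<eta> (torus_uv \<tau> (- m) (- n))) t \<partial>lborel)"

definition herm :: "complex \<Rightarrow> nat \<Rightarrow> (nat \<Rightarrow> real \<Rightarrow> complex) \<Rightarrow> (nat \<Rightarrow> real \<Rightarrow> complex) \<Rightarrow>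
    complex \<Rightarrow> complex" where
  "herm \<tau> p \<psi> \<eta> = (\<lambda>z. complex_of_real (1 / Im \<tau>) *
     (\<Sum>\<^sub>\<infinity>(m, n)\<in>UNIV. torus_uv \<tau> m n z * herm_coeff \<tau> p \<psi> \<eta> m n))"

section \<open>The map from quasi-periodic to Schwartz functions\<close>

definition expansion :: "complex \<Rightarrow> nat \<Rightarrow> (complex \<Rightarrow> complex) \<Rightarrow> (nat \<Rightarrow> real \<Rightarrow> complex) \<Rightarrow> bool" where
  "expansion \<tau> p f \<psi> \<longleftrightarrow> (\<forall>z. ((\<lambda>n::int. cis (2 * pi * of_int n * Re z) *
     cis (pi * (of_int n)\<^sup>2 * (Re \<tau> / real p)) *
     \<psi> (nat (n mod int p)) (Im z + of_int n * (Im \<tau> / real p))) has_sum f z) UNIV)"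

definition phi :: "complex \<Rightarrow> nat \<Rightarrow> (complex \<Rightarrow> complex) \<Rightarrow> nat \<Rightarrow> real \<Rightarrow> complex" where
  "phi \<tau> p f = (THE \<psi>. \<psi> \<in> H_set p \<and> expansion \<tau> p f \<psi>)"

end

theory Submission
  imports Defs "HOL-Probability.Sinc_Integral"
begin

text \<open>
  A quasi-periodic \<open>f\<close> is expanded in a Fourier series along the direction \<open>1\<close>.  Quasi-periodicity in \<open>\<tau>\<close>
  identifies the \<open>n\<close>-th coefficient, up to a phase and a translation of its argument, with the
  \<open>(n + p)\<close>-th one, so only \<open>p\<close> functions of \<open>Im z\<close> remain, and the rapid decay of the Fourier
  coefficients makes them Schwartz functions.  Conversely, summing translates of Schwartz functions
  gives a smooth quasi-periodic function, so \<open>phi\<close> is a bijection.  Multiplication by \<open>u\<close> and \<open>v\<close> becomes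
  the stated Weyl and matrix operators on the components, and integrating the torus series of \<open>a\<close>
  termwise turns multiplication by \<open>a\<close> into the action of \<open>a\<close>; hence all module laws are transported
  along \<open>phi\<close>.  For the Hermitian structure, the Fourier coefficients of \<open>cnj f * g\<close> on the torus are computed
  by Parseval's identity and by unfolding the integral over a period to an integral over the real line.
\<close>

section \<open>Smooth functions\<close>

text \<open>The notions \<open>phi\<close>, \<open>torus_coeff\<close>, \<open>op_powi\<close> and
  \<open>act\<close> are given by unique choice, set-theoretic inverses and infinite sums, so none
  can be computed directly. Each is identified with an explicit object: \<open>components\<close>,
  \<open>tcoef\<close> at 0, multiplication by \<open>torus_uv\<close> or by \<open>a\<close>. All
  Fourier inversion rests on one-variable inversion at a single point; torus coefficients are
  iterated one-variable coefficients along 1 and then along \<tau>. The multiplier of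
  \<open>F_set\<close> depends on z only through Re z, where it is a constant times the character of
  index -p. Hence differentiation along i stays inside \<open>F_set\<close>, which yields the
  Schwartz property of all derivatives of a component at once. The phase n^2 Re \<tau> / p is the
  quadratic whose increment from n to n + p, namely Re \<tau> (2n + p), absorbs the constants
  produced by translating by \<tau>. The factor 1 / Im \<tau> of the Hermitian structure is a
  Jacobian: torus coefficients integrate over the parameter s of s \<tau>, the components over the
  height y = s Im \<tau>.\<close>

lemma C_k_SucI:
  assumes "\<And>z. (f has_derivative (\<lambda>v. f' v z)) (at z)" and "\<And>v. C_k k (f' v)"
  shows "C_k (Suc k) f"
proof -
  have "frechet_derivative f (at z) = (\<lambda>v. f' v z)" for z
    using frechet_derivative_at[OF assms(1)] by simp
  then show ?thesis
    using assms by (auto simp: differentiable_def)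
qed

lemma C_k_SucD:
  assumes "C_k (Suc k) f"
  shows "(f has_derivative frechet_derivative f (at z)) (at z)" "C_k k (\<lambda>z. frechet_derivative f (at z) v)"
  using assms by (auto simp: frechet_derivative_works[symmetric])

lemma C_k_Suc_imp: "C_k (Suc k) f \<Longrightarrow> C_k k f"
proof (induction k arbitrary: f)
  case 0
  then show ?case
    by (auto simp: continuous_on_eq_continuous_at differentiable_imp_continuous_within)
next
  case (Suc k)
  then show ?case by (auto simp del: C_k.simps(1))
qed

lemma C_k_const: "C_k k (\<lambda>_. c)"
proof (induction k arbitrary: c)
  case (Suc k)
  show ?case by (rule C_k_SucI[where f' = "\<lambda>_ _. 0"]) (auto intro: Suc)
qed simp

lemma C_k_bounded_linear: "bounded_linear L \<Longrightarrow> C_k k L"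
proof (cases k)
  case 0
  then show "bounded_linear L \<Longrightarrow> C_k k L"
    by (simp add: linear_continuous_on)
next
  case (Suc j)
  assume L: "bounded_linear L"
  show ?thesis unfolding Suc
    by (rule C_k_SucI[where f' = "\<lambda>v _. L v"])
      (auto intro: C_k_const bounded_linear_imp_has_derivative L)
qed

lemma C_k_compose_linear:
  assumes L: "bounded_linear L" shows "C_k k f \<Longrightarrow> C_k k (\<lambda>z. L (f z))"
proof (induction k arbitrary: f)
  case 0
  then show ?case by (auto intro: bounded_linear.continuous_on[OF L])
next
  case (Suc k)
  show ?case
    by (rule C_k_SucI[OF bounded_linear.has_derivative[OF L C_k_SucD(1)[OF Suc.prems]]])
      (rule Suc.IH[OF C_k_SucD(2)[OF Suc.prems]])
qed

lemma C_k_add: "C_k k f \<Longrightarrow> C_k k g \<Longrightarrow> C_k k (\<lambda>z. f z + g z)"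
proof (induction k arbitrary: f g)
  case 0
  then show ?case by (auto intro: continuous_intros)
next
  case (Suc k)
  show ?case
    by (rule C_k_SucI[OF has_derivative_add[OF C_k_SucD(1)[OF Suc.prems(1)] C_k_SucD(1)[OF Suc.prems(2)]]])
      (intro Suc.IH C_k_SucD(2) Suc.prems)
qed

lemma C_k_mult:
  fixes f g :: "'a::real_normed_vector \<Rightarrow> 'b::real_normed_algebra"
  shows "C_k k f \<Longrightarrow> C_k k g \<Longrightarrow> C_k k (\<lambda>z. f z * g z)"
proof (induction k arbitrary: f g)
  case 0
  then show ?case by (auto intro: continuous_intros)
next
  case (Suc k)
  show ?case
    by (rule C_k_SucI[OF has_derivative_mult[OF C_k_SucD(1)[OF Suc.prems(1)] C_k_SucD(1)[OF Suc.prems(2)]]])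
      (intro C_k_add Suc.IH C_k_SucD(2) C_k_Suc_imp[of k] Suc.prems)
qed

text \<open>The derivative is a constant multiple of the same function for each direction, so the
  induction on k closes without generalising.\<close>

lemma C_k_cis:
  assumes L: "bounded_linear L" shows "C_k k (\<lambda>z. cis (L z))"
proof (induction k)
  case 0
  then show ?case
    using continuous_on_cis[OF linear_continuous_on[OF L]] by simp
next
  case (Suc k)
  have "((\<lambda>z. cis (L z)) has_derivative (\<lambda>v. (\<i> * of_real (L v)) * cis (L z))) (at z)" for z
  proof -
    have "((\<lambda>z. cis (L z)) has_derivative (\<lambda>v. L v *\<^sub>R (\<i> * cis (L z)))) (at z)"
      by (rule has_derivative_cis[OF bounded_linear_imp_has_derivative[OF L]])
    then show ?thesis by (simp add: scaleR_conv_of_real mult_ac)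
  qed
  then show ?case
    by (rule C_k_SucI) (intro C_k_mult C_k_const Suc)
qed

lemma smooth_const: "smooth (\<lambda>_. c)"
  by (simp add: smooth_def C_k_const)

lemma smooth_add: "smooth f \<Longrightarrow> smooth g \<Longrightarrow> smooth (\<lambda>z. f z + g z)"
  by (simp add: smooth_def C_k_add)

lemma smooth_mult:
  fixes f g :: "'a::real_normed_vector \<Rightarrow> 'b::real_normed_algebra"
  shows "smooth f \<Longrightarrow> smooth g \<Longrightarrow> smooth (\<lambda>z. f z * g z)"
  by (simp add: smooth_def C_k_mult)

lemma smooth_compose_linear: "bounded_linear L \<Longrightarrow> smooth f \<Longrightarrow> smooth (\<lambda>z. L (f z))"
  by (simp add: smooth_def C_k_compose_linear)

lemma smooth_cis: "bounded_linear L \<Longrightarrow> smooth (\<lambda>z. cis (L z))"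
  by (simp add: smooth_def C_k_cis)

section \<open>Directional derivatives as operators that can be iterated\<close>

definition dir_deriv :: "complex \<Rightarrow> (complex \<Rightarrow> complex) \<Rightarrow> complex \<Rightarrow> complex" where
  "dir_deriv v f z = frechet_derivative f (at z) v"

lemma smooth_continuous: "smooth f \<Longrightarrow> continuous_on UNIV f"
  using C_k.simps(1) smooth_def by blast

lemma smooth_continuous_compose:
  "smooth f \<Longrightarrow> continuous_on S g \<Longrightarrow> continuous_on S (\<lambda>x. f (g x))"
  using continuous_on_compose2[OF smooth_continuous] by auto

lemma smooth_dir_deriv: "smooth f \<Longrightarrow> smooth (dir_deriv v f)"
  unfolding smooth_def dir_deriv_def[abs_def] using C_k_SucD(2) by blast

lemma smooth_dir_deriv_funpow: "smooth f \<Longrightarrow> smooth ((dir_deriv v ^^ j) f)"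
  by (induction j) (auto intro: smooth_dir_deriv)

lemma has_vector_derivative_line:
  assumes "smooth f"
  shows "((\<lambda>t. f (z + of_real t * v)) has_vector_derivative dir_deriv v f (z + of_real t * v)) (at t within S)"
proof -
  let ?w = "z + of_real t * v"
  have f: "(f has_derivative frechet_derivative f (at ?w)) (at ?w)"
    using assms C_k_SucD(1) smooth_def by blast
  have "((\<lambda>t. z + of_real t * v) has_derivative (\<lambda>h. h *\<^sub>R v)) (at t within S)"
    by (auto intro!: derivative_eq_intros simp: scaleR_conv_of_real)
  from has_derivative_compose[OF this f]
  show ?thesis
    unfolding has_vector_derivative_def dir_deriv_def
    using linear_cmul[OF has_derivative_linear[OF f]] by simp
qed

text \<open>The relation is required only on the line through \<open>z\<close> in direction
  \<open>v\<close>, with one constant \<open>c\<close>. It therefore applies to a multiplier that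
  varies with the point, as long as it is constant along \<open>v\<close>.\<close>

lemma dir_deriv_quasiperiodic:
  assumes f: "smooth f" and eq: "\<And>t. f (z + l + of_real t * v) = c * f (z + of_real t * v)"
  shows "dir_deriv v f (z + l) = c * dir_deriv v f z"
proof -
  have 1: "((\<lambda>t. f (z + l + of_real t * v)) has_vector_derivative dir_deriv v f (z + l)) (at 0)"
    using has_vector_derivative_line[OF f, of "z + l" v 0] by simp
  have 2: "((\<lambda>t. c * f (z + of_real t * v)) has_vector_derivative c * dir_deriv v f z) (at 0)"
    using has_vector_derivative_mult_right[OF has_vector_derivative_line[OF f, of z v 0]] by simp
  show ?thesis using vector_derivative_unique_at[OF 1] 2 by (simp add: eq)
qed

lemma dir_deriv_periodic:
  assumes "smooth f" "\<And>z. f (z + l) = f z"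
  shows "dir_deriv v f (z + l) = dir_deriv v f z"
proof -
  have "f (z + l + w) = f (z + w)" for w
    using assms(2)[of "z + w"] by (simp add: add_ac)
  then show ?thesis
    using dir_deriv_quasiperiodic[of f z l v 1] assms(1) by simp
qed

lemma dir_deriv_funpow_periodic:
  assumes "smooth f" "\<And>z. f (z + l) = f z"
  shows "(dir_deriv v ^^ j) f (z + l) = (dir_deriv v ^^ j) f z"
  by (induction j arbitrary: z)
    (use assms in \<open>auto intro: dir_deriv_periodic smooth_dir_deriv_funpow\<close>)

section \<open>Schwartz functions\<close>

text \<open>Membership in the Schwartz space is shown by exhibiting a set of functions of rapid decay that is
  closed under differentiation.\<close>

lemma schwartz_coinduct:
  assumes "f \<in> X"
    and D: "\<And>f. f \<in> X \<Longrightarrow> \<exists>f'\<in>X. \<forall>t. (f has_vector_derivative f' t) (at t)"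
    and B: "\<And>f j. f \<in> X \<Longrightarrow> bounded (range (\<lambda>t. t ^ j *\<^sub>R f t))"
  shows "f \<in> schwartz"
proof -
  have "C_k k f" if "f \<in> X" for k f
    using that
  proof (induction k arbitrary: f)
    case 0
    then show ?case using D[OF 0]
      by (auto intro!: continuous_at_imp_continuous_on intro: has_vector_derivative_continuous)
  next
    case (Suc k)
    then obtain f' where f': "f' \<in> X" "\<And>t. (f has_vector_derivative f' t) (at t)"
      using D by blast
    show ?case
      by (rule C_k_SucI[where f' = "\<lambda>v t. v *\<^sub>R f' t"])
        (use f' in \<open>auto simp: has_vector_derivative_def
          intro: C_k_compose_linear[OF bounded_linear_scaleR_right] Suc.IH\<close>)
  qed
  moreover have "iter_deriv k f \<in> X" for k
  proof (induction k)
    case 0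
    then show ?case using \<open>f \<in> X\<close> by (simp add: iter_deriv_def)
  next
    case (Suc k)
    then obtain f' where f': "f' \<in> X" "\<And>t. (iter_deriv k f has_vector_derivative f' t) (at t)"
      using D by blast
    then have "iter_deriv (Suc k) f = f'"
      by (auto simp: iter_deriv_def vector_derivative_at)
    then show ?case using f' by simp
  qed
  ultimately show ?thesis
    using B \<open>f \<in> X\<close> by (auto simp: schwartz_def smooth_def)
qed

lemma schwartz_zero: "(\<lambda>_. 0) \<in> schwartz"
  by (rule schwartz_coinduct[where X = "{\<lambda>_. 0}"]) auto

lemma schwartz_bounded: "f \<in> schwartz \<Longrightarrow> bounded (range (\<lambda>t. t ^ j *\<^sub>R f t))"
proof -
  assume "f \<in> schwartz"
  then have "bounded (range (\<lambda>t. t ^ j *\<^sub>R iter_deriv 0 f t))"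
    unfolding schwartz_def by blast
  then show ?thesis by (simp add: iter_deriv_def)
qed

lemma schwartz_deriv:
  assumes "f \<in> schwartz"
  obtains f' where "f' \<in> schwartz" "\<And>t. (f has_vector_derivative f' t) (at t)"
proof
  let ?f' = "\<lambda>t. vector_derivative f (at t)"
  have C: "C_k (Suc k) f" for k
    using assms unfolding schwartz_def smooth_def by blast
  show d: "(f has_vector_derivative ?f' t) (at t)" for t
    using C[of 0] by (simp add: vector_derivative_works[symmetric])
  have "?f' t = frechet_derivative f (at t) 1" for t
    using frechet_derivative_at[OF d[of t, unfolded has_vector_derivative_def]]
    by (simp add: fun_eq_iff) (metis scaleR_one)
  then have "?f' = (\<lambda>t. frechet_derivative f (at t) 1)" by blast
  then have "C_k k ?f'" for k
    using C_k_SucD(2)[OF C[of k], of 1] by metis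
  moreover have "iter_deriv k ?f' = iter_deriv (Suc k) f" for k
    unfolding iter_deriv_def by (subst funpow_Suc_right) simp
  ultimately show "?f' \<in> schwartz"
    using assms unfolding schwartz_def smooth_def by auto
qed

lemma schwartz_isCont: "f \<in> schwartz \<Longrightarrow> isCont f t"
  using schwartz_deriv has_vector_derivative_continuous by metis

lemma schwartz_continuous_on: "f \<in> schwartz \<Longrightarrow> continuous_on S f"
  by (simp add: continuous_at_imp_continuous_on schwartz_isCont)

lemma bounded_range_add:
  fixes f g :: "'a \<Rightarrow> 'b::real_normed_vector"
  assumes "bounded (range f)" "bounded (range g)"
  shows "bounded (range (\<lambda>t. f t + g t))"
proof -
  obtain A B where "\<And>t. norm (f t) \<le> A" "\<And>t. norm (g t) \<le> B"
    using assms unfolding bounded_iff by auto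
  then have "norm (f t + g t) \<le> A + B" for t
    by (rule order.trans[OF norm_triangle_ineq add_mono])
  then show ?thesis unfolding bounded_iff by blast
qed

lemma schwartz_add:
  assumes "f \<in> schwartz" "g \<in> schwartz"
  shows "(\<lambda>t. f t + g t) \<in> schwartz"
proof (rule schwartz_coinduct[where X = "{\<lambda>t. f t + g t | f g. f \<in> schwartz \<and> g \<in> schwartz}"], goal_cases)
  case 1
  then show ?case using assms by blast
next
  case (2 h)
  then obtain f g where h: "h = (\<lambda>t. f t + g t)" "f \<in> schwartz" "g \<in> schwartz" by blast
  obtain f' where "f' \<in> schwartz" "\<And>t. (f has_vector_derivative f' t) (at t)"
    using schwartz_deriv[OF h(2)] by blast
  moreover obtain g' where "g' \<in> schwartz" "\<And>t. (g has_vector_derivative g' t) (at t)"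
    using schwartz_deriv[OF h(3)] by blast
  ultimately show ?case
    unfolding h(1) by (intro bexI[of _ "\<lambda>t. f' t + g' t"]) (auto intro: has_vector_derivative_add)
next
  case (3 h j)
  then obtain f g where h: "h = (\<lambda>t. f t + g t)" "f \<in> schwartz" "g \<in> schwartz" by blast
  then show ?case
    unfolding h(1) scaleR_add_right by (intro bounded_range_add schwartz_bounded)
qed

text \<open>Since (t f)' = t f' + f, the products t f alone are not closed under differentiation;
  the sums t f + g with both f and g Schwartz are.\<close>

lemma schwartz_mult_arg:
  assumes "f \<in> schwartz"
  shows "(\<lambda>t. of_real t * f t) \<in> schwartz"
proof (rule schwartz_coinduct[where X = "{\<lambda>t. of_real t * f t + g t | f g. f \<in> schwartz \<and> g \<in> schwartz}"], goal_cases)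
  case 1
  show ?case using assms schwartz_zero by (force intro: exI[of _ f])
next
  case (2 h)
  then obtain f g where h: "h = (\<lambda>t. of_real t * f t + g t)" "f \<in> schwartz" "g \<in> schwartz" by blast
  obtain f' where f': "f' \<in> schwartz" "\<And>t. (f has_vector_derivative f' t) (at t)"
    using schwartz_deriv[OF h(2)] by blast
  obtain g' where g': "g' \<in> schwartz" "\<And>t. (g has_vector_derivative g' t) (at t)"
    using schwartz_deriv[OF h(3)] by blast
  have "((\<lambda>t. of_real t * f t + g t) has_vector_derivative (of_real t * f' t + (f t + g' t))) (at t)" for t
    using has_vector_derivative_add[OF has_vector_derivative_scaleR[OF DERIV_ident f'(2)] g'(2), of t]
    by (simp add: scaleR_conv_of_real add_ac)
  moreover have "(\<lambda>t. f t + g' t) \<in> schwartz"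
    by (rule schwartz_add[OF h(2) g'(1)])
  ultimately show ?case
    unfolding h(1) using f'(1) by (intro bexI[of _ "\<lambda>t. of_real t * f' t + (f t + g' t)"]) auto
next
  case (3 h j)
  then obtain f g where h: "h = (\<lambda>t. of_real t * f t + g t)" "f \<in> schwartz" "g \<in> schwartz" by blast
  have eq: "t ^ j *\<^sub>R h t = t ^ Suc j *\<^sub>R f t + t ^ j *\<^sub>R g t" for t
    by (simp add: h(1) scaleR_conv_of_real algebra_simps)
  then show ?case
    unfolding eq by (intro bounded_range_add schwartz_bounded h)
qed

text \<open>Separates the weight 1 + x into the two bounds that are available in practice, one on a
  quantity itself and one on its product with the pure power x^j.\<close>

lemma power_one_plus_le: "x \<ge> 0 \<Longrightarrow> (1 + x :: real) ^ j \<le> 2 ^ j * (1 + x ^ j)"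
proof -
  assume "x \<ge> 0"
  then have "(1 + x) ^ j \<le> (2 * max 1 x) ^ j" by (intro power_mono) auto
  also have "\<dots> \<le> 2 ^ j * (1 + x ^ j)" using \<open>x \<ge> 0\<close> by (auto simp: power_mult_distrib max_def)
  finally show ?thesis .
qed

lemma schwartz_decay:
  assumes "f \<in> schwartz"
  obtains B where "B \<ge> 0" "\<And>t. norm (f t) * (1 + \<bar>t\<bar>) ^ j \<le> B"
proof -
  obtain A where A: "\<And>t. norm (f t) \<le> A"
    using schwartz_bounded[OF assms, of 0] unfolding bounded_iff by auto
  obtain B where B: "\<And>t. norm (t ^ j *\<^sub>R f t) \<le> B"
    using schwartz_bounded[OF assms, of j] unfolding bounded_iff by auto
  have "norm (f t) * (1 + \<bar>t\<bar>) ^ j \<le> 2 ^ j * (A + B)" for t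
  proof -
    have "(1 + \<bar>t\<bar>) ^ j \<le> 2 ^ j * (1 + \<bar>t\<bar> ^ j)"
      by (rule power_one_plus_le) simp
    then have "norm (f t) * (1 + \<bar>t\<bar>) ^ j \<le> norm (f t) * (2 ^ j * (1 + \<bar>t\<bar> ^ j))"
      by (rule mult_left_mono) simp
    also have "\<dots> = 2 ^ j * (norm (f t) + norm (t ^ j *\<^sub>R f t))"
      by (simp add: algebra_simps power_abs)
    also have "\<dots> \<le> 2 ^ j * (A + B)"
      by (intro mult_left_mono add_mono A B) auto
    finally show ?thesis .
  qed
  moreover from this[of 0] have "2 ^ j * (A + B) \<ge> 0"
    by (smt (verit) norm_ge_zero mult_nonneg_nonneg zero_le_power abs_ge_zero)
  ultimately show ?thesis using that by blast
qed

section \<open>Fourier coefficients\<close>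

definition fchar :: "int \<Rightarrow> real \<Rightarrow> complex" where
  "fchar n s = cis (2 * pi * of_int n * s)"

lemma fchar_add: "fchar (m + n) s = fchar m s * fchar n s"
  by (simp add: fchar_def cis_mult algebra_simps)

lemma fchar_add_arg: "fchar n (s + t) = fchar n s * fchar n t"
  by (simp add: fchar_def cis_mult algebra_simps)

lemma fchar_0 [simp]: "fchar 0 s = 1" "fchar n 0 = 1"
  by (simp_all add: fchar_def)

lemma fchar_1 [simp]: "fchar n 1 = 1"
  using cis_multiple_2pi[of "of_int n"] by (simp add: fchar_def mult_ac)

lemma norm_fchar [simp]: "norm (fchar n s) = 1"
  by (simp add: fchar_def)

lemma cnj_fchar: "cnj (fchar n s) = fchar (- n) s"
  by (simp add: fchar_def cis_cnj)

lemma fchar_minus_mult [simp]: "fchar (- n) s * fchar n s = 1" "fchar n s * fchar (- n) s = 1"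
  by (simp_all flip: fchar_add)

lemma continuous_fchar [continuous_intros]:
  "continuous_on S f \<Longrightarrow> continuous_on S (\<lambda>x. fchar n (f x))"
  unfolding fchar_def by (intro continuous_intros)

lemma has_vector_derivative_fchar:
  "(fchar n has_vector_derivative 2 * pi * \<i> * of_int n * fchar n s) (at s within S)"
proof -
  have "((\<lambda>s. cis (2 * pi * of_int n * s)) has_derivative
      (\<lambda>h. (2 * pi * of_int n * h) *\<^sub>R (\<i> * cis (2 * pi * of_int n * s)))) (at s within S)"
    by (rule has_derivative_cis) (auto intro!: derivative_eq_intros)
  then show ?thesis
    by (simp add: has_vector_derivative_def fchar_def[abs_def] scaleR_conv_of_real mult_ac)
qed

definition fcoef :: "(real \<Rightarrow> complex) \<Rightarrow> int \<Rightarrow> complex" where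
  "fcoef g n = integral {0..1} (\<lambda>s. g s * fchar (- n) s)"

lemma fcoef_integrable:
  "continuous_on {0..1} g \<Longrightarrow> (\<lambda>s. g s * fchar n s) integrable_on {0..1}"
  by (intro integrable_continuous_interval continuous_intros) auto

lemma fcoef_add:
  "continuous_on {0..1} g \<Longrightarrow> continuous_on {0..1} h \<Longrightarrow>
    fcoef (\<lambda>s. g s + h s) n = fcoef g n + fcoef h n"
  by (simp add: fcoef_def ring_distribs integral_add fcoef_integrable)

lemma fcoef_diff:
  "continuous_on {0..1} g \<Longrightarrow> continuous_on {0..1} h \<Longrightarrow>
    fcoef (\<lambda>s. g s - h s) n = fcoef g n - fcoef h n"
  by (simp add: fcoef_def ring_distribs integral_diff fcoef_integrable)

lemma fcoef_cmult: "fcoef (\<lambda>s. c * g s) n = c * fcoef g n"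
  by (simp add: fcoef_def mult.assoc)

lemma fcoef_mult_fchar: "fcoef (\<lambda>s. g s * fchar m s) n = fcoef g (n - m)"
  unfolding fcoef_def using fchar_add[of m "- n"] by (simp add: mult.assoc)

lemma fcoef_bound:
  assumes "continuous_on {0..1} g" "\<And>s. s \<in> {0..1} \<Longrightarrow> norm (g s) \<le> B"
  shows "norm (fcoef g n) \<le> B"
  unfolding fcoef_def
  using integral_bound[of 0 1 "\<lambda>s. g s * fchar (- n) s" B] assms
  by (simp add: norm_mult continuous_on_mult continuous_fchar continuous_on_id)

text \<open>Integration by parts; the character equals 1 at both ends of the interval. The boundary
  term is kept because polynomials, to which this is applied below, are not periodic.\<close>

lemma fcoef_deriv:
  assumes der: "\<And>s. s \<in> {0..1} \<Longrightarrow> (g has_vector_derivative g' s) (at s within {0..1})"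
    and cont: "continuous_on {0..1} g'"
  shows "fcoef g' n = g 1 - g 0 + 2 * pi * \<i> * of_int n * fcoef g n"
proof -
  have g: "continuous_on {0..1} g"
    using der has_vector_derivative_continuous continuous_on_eq_continuous_within by blast
  have "((\<lambda>s. g s * (2 * pi * \<i> * of_int (- n) * fchar (- n) s) + g' s * fchar (- n) s) has_integral
      g 1 * fchar (- n) 1 - g 0 * fchar (- n) 0) {0..1}"
    by (rule fundamental_theorem_of_calculus, simp,
        rule has_vector_derivative_mult[OF der has_vector_derivative_fchar])
  then have "integral {0..1} (\<lambda>s. (2 * pi * \<i> * of_int (- n)) * (g s * fchar (- n) s) + g' s * fchar (- n) s)
      = g 1 - g 0"
    by (simp add: has_integral_iff mult_ac)
  also have "integral {0..1} (\<lambda>s. (2 * pi * \<i> * of_int (- n)) * (g s * fchar (- n) s) + g' s * fchar (- n) s)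
      = 2 * pi * \<i> * of_int (- n) * fcoef g n + fcoef g' n"
    unfolding fcoef_def
    by (subst integral_add) (auto intro!: integrable_continuous_interval continuous_intros g cont)
  finally show ?thesis by (simp add: algebra_simps)
qed

text \<open>Orthogonality of the characters without evaluating an integral: integration by parts of
  the constant 1 gives 0 = 2 pi i n times its coefficient.\<close>

lemma fcoef_const: "fcoef (\<lambda>_. c) n = (if n = 0 then c else 0)"
proof -
  have "fcoef (\<lambda>_. c) n = c * fcoef (\<lambda>_. 1) n"
    using fcoef_cmult[of c "\<lambda>_. 1"] by simp
  moreover have "fcoef (\<lambda>_. 1) 0 = 1"
    by (simp add: fcoef_def)
  moreover have "fcoef (\<lambda>_. 0) n = 2 * pi * \<i> * of_int n * fcoef (\<lambda>_. 1) n"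
    using fcoef_deriv[of "\<lambda>_. 1" "\<lambda>_. 0" n] by simp
  then have "n \<noteq> 0 \<Longrightarrow> fcoef (\<lambda>_. 1) n = 0"
    by (simp add: fcoef_def)
  ultimately show ?thesis by simp
qed

lemma fcoef_fchar: "fcoef (fchar m) n = (if n = m then 1 else 0)"
  using fcoef_mult_fchar[of "\<lambda>_. 1" m n] by (simp add: fcoef_const)

text \<open>The integrand including its character has period 1, so its integral over any unit
  interval is the same; only the phase of the moved character remains.\<close>

lemma fcoef_shift:
  assumes cont: "continuous_on UNIV g" and per: "\<And>s. g (s + 1) = g s"
  shows "fcoef (\<lambda>s. g (s + t)) n = fchar n t * fcoef g n"
proof -
  define F where "F s = g s * fchar (- n) s" for s
  have F: "continuous_on S F" for S
    unfolding F_def by (intro continuous_intros continuous_on_subset[OF cont]) auto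
  have Fper: "F (s + 1) = F s" for s
    by (simp add: F_def per fchar_add_arg)
  have Fper_nat: "F (s + of_nat k) = F s" for s k
    by (induction k arbitrary: s) (use Fper in \<open>auto simp: add.assoc[symmetric] add.commute[of 1]\<close>)
  have Fper_int: "F (s + of_int k) = F s" for s k
  proof (cases k rule: int_cases2)
    case (nonpos j)
    then show ?thesis using Fper_nat[of "s + of_int k" j] by simp
  qed (use Fper_nat in simp)
  \<comment> \<open>A shift by the integer part is invisible, so a shift within one period is
    enough: cut [u, 1 + u] at 1 and move the right piece back to [0, u].\<close>
  define u where "u = frac t"
  have u: "0 \<le> u" "u \<le> 1" unfolding u_def using frac_lt_1[of t] by auto
  have int: "F integrable_on {a..b}" for a b
    by (intro integrable_continuous_interval F)
  have shift: "integral {a..b} (\<lambda>s. F (s + c)) = integral {a + c..b + c} F" for a b c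
    using integral_shift_Icc_real[of a b F c] by (simp add: o_def add.commute)
  have "integral {0..1} (\<lambda>s. F (s + t)) = integral {0..1} (\<lambda>s. F (s + u))"
  proof (rule integral_cong)
    fix s show "F (s + t) = F (s + u)"
      using Fper_int[of "s + u" "\<lfloor>t\<rfloor>"] by (simp add: u_def frac_def)
  qed
  also have "\<dots> = integral {u..1 + u} F"
    using shift[of 0 1 u] by simp
  also have "\<dots> = integral {u..1} F + integral {1..1 + u} F"
    using u by (intro Henstock_Kurzweil_Integration.integral_combine[symmetric] int) auto
  also have "integral {1..1 + u} F = integral {0..u} F"
    using shift[of 0 u 1] Fper by (simp add: add.commute)
  also have "integral {u..1} F + integral {0..u} F = integral {0..1} F"
    using u Henstock_Kurzweil_Integration.integral_combine[of 0 u 1 F] int by (simp add: add.commute)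
  finally have "integral {0..1} (\<lambda>s. F (s + t)) = integral {0..1} F" .
  moreover have "g (s + t) * fchar (- n) s = fchar n t * F (s + t)" for s
  proof -
    have "fchar n t * F (s + t) = (fchar n t * fchar (- n) t) * (g (s + t) * fchar (- n) s)"
      by (simp only: F_def fchar_add_arg mult_ac)
    then show ?thesis by simp
  qed
  then have "fcoef (\<lambda>s. g (s + t)) n = integral {0..1} (\<lambda>s. fchar n t * F (s + t))"
    by (simp only: fcoef_def)
  ultimately show ?thesis by (simp add: fcoef_def F_def[abs_def])
qed

text \<open>A polynomial within e/2 of \<open>h\<close> has coefficients of order 1/n by integration
  by parts, and the approximation error costs at most e/2 in every coefficient.\<close>

lemma riemann_lebesgue:
  assumes h: "continuous_on {0..1} h" and "e > 0"
  shows "\<exists>N. \<forall>n. real_of_int \<bar>n\<bar> \<ge> N \<longrightarrow> norm (fcoef h n) < e"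
proof -
  obtain q where q: "polynomial_function q" "\<And>x. x \<in> {0..1} \<Longrightarrow> norm (h x - q x) < e / 2"
    using Stone_Weierstrass_polynomial_function[OF compact_Icc h, of "e / 2"] \<open>e > 0\<close> by auto
  obtain q' where q': "polynomial_function q'" "\<And>x. (q has_vector_derivative q' x) (at x)"
    using has_vector_derivative_polynomial_function[OF q(1)] by blast
  have cq: "continuous_on {0..1} q" "continuous_on {0..1} q'"
    using q q' continuous_on_polymonial_function by blast+
  obtain B where B: "\<And>s. s \<in> {0..1} \<Longrightarrow> norm (q' s) \<le> B"
    using compact_imp_bounded[OF compact_continuous_image[OF cq(2) compact_Icc]]
    unfolding bounded_iff by blast
  define K where "K = B + norm (q 1 - q 0)"
  have bound: "2 * pi * \<bar>real_of_int n\<bar> * norm (fcoef q n) \<le> K" for n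
  proof -
    have "2 * pi * \<i> * of_int n * fcoef q n = fcoef q' n - (q 1 - q 0)"
      using fcoef_deriv[of q q' n] q'(2) cq(2) has_vector_derivative_at_within by fastforce
    then have "norm (2 * pi * \<i> * of_int n * fcoef q n) \<le> K"
      unfolding K_def
      by (metis add_right_mono fcoef_bound[OF cq(2) B] norm_triangle_ineq4 order.trans)
    then show ?thesis by (simp add: norm_mult)
  qed
  \<comment> \<open>The threshold is chosen so that a coefficient of \<open>q\<close> of size e/2
    would force pi (|K| + e) <= K, which is impossible.\<close>
  have "norm (fcoef h n) < e" if n: "real_of_int \<bar>n\<bar> \<ge> \<bar>K\<bar> / e + 1" for n
  proof -
    have "norm (fcoef h n - fcoef q n) \<le> e / 2"
      using fcoef_bound[of "\<lambda>s. h s - q s" "e / 2" n] q(2) h cq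
      by (simp add: fcoef_diff continuous_on_diff less_imp_le)
    moreover have "norm (fcoef q n) < e / 2"
    proof (rule ccontr)
      assume "\<not> norm (fcoef q n) < e / 2"
      then have "2 * pi * \<bar>real_of_int n\<bar> * norm (fcoef q n) \<ge> 2 * pi * (\<bar>K\<bar> / e + 1) * (e / 2)"
        using n \<open>e > 0\<close> by (intro mult_mono) auto
      also have "2 * pi * (\<bar>K\<bar> / e + 1) * (e / 2) = pi * (\<bar>K\<bar> + e)"
        using \<open>e > 0\<close> by (simp add: field_simps)
      also have "pi * (\<bar>K\<bar> + e) \<ge> 1 * (\<bar>K\<bar> + e)"
        using pi_gt3 \<open>e > 0\<close> by (intro mult_right_mono) auto
      finally have "1 * (\<bar>K\<bar> + e) \<le> K" by (rule order.trans[OF _ bound])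
      then show False using \<open>e > 0\<close> abs_ge_self[of K] by simp
    qed
    ultimately show ?thesis
      using norm_triangle_sub[of "fcoef h n" "fcoef q n"] by linarith
  qed
  then show ?thesis by blast
qed

text \<open>Lets an unconditional sum over the integers be identified from its symmetric partial
  sums, which telescope or tile in the applications.\<close>

lemma symmetric_intervals_at_top:
  "filterlim (\<lambda>N. {- int N..int N}) (finite_subsets_at_top UNIV) sequentially"
  unfolding filterlim_finite_subsets_at_top
proof (intro allI impI)
  fix X :: "int set" assume "finite X \<and> X \<subseteq> UNIV"
  define k where "k = Max (insert 0 (abs ` X))"
  have k: "x \<in> X \<Longrightarrow> \<bar>x\<bar> \<le> k" for x
    unfolding k_def using \<open>finite X \<and> X \<subseteq> UNIV\<close> by (intro Max_ge) auto
  show "\<forall>\<^sub>F N in sequentially. finite {- int N..int N} \<and> X \<subseteq> {- int N..int N} \<and> {- int N..int N} \<subseteq> UNIV"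
    using eventually_ge_at_top[of "nat k"] by eventually_elim (use k in force)
qed

lemma has_sum_int_LIMSEQ:
  fixes f :: "int \<Rightarrow> 'a::{comm_monoid_add, topological_space}"
  shows "(f has_sum S) UNIV \<Longrightarrow> (\<lambda>N. \<Sum>n = - int N..int N. f n) \<longlonglongrightarrow> S"
  unfolding has_sum_def by (rule filterlim_compose[OF _ symmetric_intervals_at_top])

text \<open>Where \<open>g\<close> vanishes to first order at \<open>0\<close>, it is \<open>e\<^sub>1 - 1\<close> times a continuous function \<open>h\<close>,
  so that the sum of its Fourier coefficients telescopes.\<close>

lemma fourier_inversion_at_0:
  assumes cont: "continuous_on {0..1} g" and per: "\<And>s. g (s + 1) = g s"
    and der: "(g has_vector_derivative d) (at 0)"
    and sum: "fcoef g summable_on UNIV"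
  shows "(fcoef g has_sum g 0) UNIV"
proof -
  define q where "q s = (g s - g 0) / (fchar 1 s - 1)" for s
  \<comment> \<open>The limit of \<open>q\<close> at 0: the derivative of g there divided by the
    derivative 2 pi i of the character of index 1. Periodicity gives the same limit at 1, and these
    are the only zeros of the denominator on [0, 1].\<close>
  define c where "c = d / (2 * pi * \<i>)"
  define h where "h s = (if s = 0 \<or> s = 1 then c else q s)" for s
  have lim: "((\<lambda>s. (f s - f 0) / of_real s) \<longlongrightarrow> f') (at 0)"
    if "(f has_vector_derivative f') (at 0)" for f :: "real \<Rightarrow> complex" and f'
  proof -
    have 1: "((\<lambda>h. norm (f h - f 0 - h *\<^sub>R f') / norm h) \<longlongrightarrow> 0) (at 0)"
      using that by (simp add: has_vector_derivative_def has_derivative_at)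
    have 2: "norm (f h - f 0 - h *\<^sub>R f') / norm h = norm ((f h - f 0) / of_real h - f')" if "h \<noteq> 0" for h
    proof -
      have "(f h - f 0) / of_real h - f' = (f h - f 0 - h *\<^sub>R f') / of_real h"
        using that by (simp add: scaleR_conv_of_real diff_divide_distrib)
      then show ?thesis by (simp only: norm_divide norm_of_real real_norm_def)
    qed
    have "((\<lambda>h. norm ((f h - f 0) / of_real h - f')) \<longlongrightarrow> 0) (at 0)"
      by (rule Lim_transform_within[OF 1 zero_less_one]) (simp add: 2 del: real_norm_def)
    then show ?thesis
      by (simp add: tendsto_norm_zero_iff LIM_zero_iff)
  qed
  have q0: "(q \<longlongrightarrow> c) (at 0)"
  proof -
    have "((\<lambda>s. ((g s - g 0) / of_real s) / ((fchar 1 s - fchar 1 0) / of_real s)) \<longlongrightarrow> d / (2 * pi * \<i>)) (at 0)"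
      using has_vector_derivative_fchar[of 1 0 UNIV] by (intro tendsto_divide lim der) auto
    then show ?thesis
      unfolding c_def by (rule Lim_transform_within[of _ _ _ _ 1]) (auto simp: q_def)
  qed
  have "q (s - 1) = q s" for s
    using per[of "s - 1"] fchar_add_arg[of 1 "s - 1" 1] by (simp add: q_def)
  then have q1: "(q \<longlongrightarrow> c) (at 1)"
    using LIM_offset[OF q0, of "- 1"] by simp
  have fchar_neq: "fchar 1 s \<noteq> 1" if "s \<in> {0<..<1}" for s
  proof
    assume "fchar 1 s = 1"
    then have "cos (2 * pi * s) = 1" by (simp add: fchar_def complex_eq_iff)
    then obtain k :: int where "2 * pi * s = of_int k * (2 * pi)" using cos_one_2pi_int by auto
    then have "s = of_int k" by simp
    with that show False by auto
  qed
  have h: "continuous_on {0..1} h"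
    unfolding continuous_on_def
  proof
    fix x :: real assume x: "x \<in> {0..1}"
    consider "x = 0" | "x = 1" | "x \<in> {0<..<1}" using x by fastforce
    then show "(h \<longlongrightarrow> h x) (at x within {0..1})"
    proof cases
      case 1
      have "(h \<longlongrightarrow> c) (at 0)"
        by (rule Lim_transform_within[OF q0, of 1]) (auto simp: h_def)
      then show ?thesis unfolding 1 by (auto simp: h_def intro: tendsto_within_subset)
    next
      case 2
      have "(h \<longlongrightarrow> c) (at 1)"
        by (rule Lim_transform_within[OF q1, of 1]) (auto simp: h_def dist_real_def)
      then show ?thesis unfolding 2 by (auto simp: h_def intro: tendsto_within_subset)
    next
      case 3
      have "continuous_on {0<..<1} q"
        unfolding q_def
        by (intro continuous_intros continuous_on_subset[OF cont]) (use fchar_neq in auto)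
      then have "(q \<longlongrightarrow> q x) (at x)"
        using 3 by (simp add: continuous_on_eq_continuous_at isCont_def)
      then have "(h \<longlongrightarrow> q x) (at x)"
        by (rule Lim_transform_within_open[of _ _ _ _ "{0<..<1}"]) (use 3 in \<open>auto simp: h_def\<close>)
      then show ?thesis using 3 by (auto simp: h_def intro: tendsto_within_subset)
    qed
  qed
  have "h s * fchar 1 s - h s = g s - g 0" if "s \<in> {0..1}" for s
  proof (cases "s \<in> {0<..<1}")
    case True
    then have "h s * (fchar 1 s - 1) = g s - g 0"
      using fchar_neq[OF True] by (simp add: h_def q_def)
    then show ?thesis by (simp add: right_diff_distrib)
  next
    case False
    then have "s = 0 \<or> s = 1" using that by auto
    then show ?thesis using per[of 0] by auto
  qed
  then have "fcoef (\<lambda>s. h s * fchar 1 s - h s) n = fcoef (\<lambda>s. g s - g 0) n" for n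
    unfolding fcoef_def by (intro integral_cong) auto
  moreover have "fcoef (\<lambda>s. h s * fchar 1 s - h s) n = fcoef h (n - 1) - fcoef h n" for n
    by (simp add: fcoef_diff fcoef_mult_fchar h continuous_intros)
  \<comment> \<open>Multiplication by the character of index 1 lowers the index by one, hence the
    difference of neighbours; the subtracted constant g 0 is seen only by the coefficient 0.\<close>
  ultimately have coef: "fcoef g n = (fcoef h (n - 1) - fcoef h n) + (if n = 0 then g 0 else 0)" for n
    by (simp add: fcoef_diff cont fcoef_const split: if_splits)
  have tele: "(\<Sum>n = - int N..int N. fcoef h (n - 1) - fcoef h n) = fcoef h (- int N - 1) - fcoef h (int N)" for N
  proof (induction N)
    case (Suc N)
    let ?t = "\<lambda>n. fcoef h (n - 1) - fcoef h n"
    have eq: "{- int (Suc N)..int (Suc N)} = insert (- int (Suc N)) (insert (int (Suc N)) {- int N..int N})"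
      by auto
    have "sum ?t {- int (Suc N)..int (Suc N)} = ?t (- int (Suc N)) + (?t (int (Suc N)) + sum ?t {- int N..int N})"
      by (subst eq, subst sum.insert) (auto simp: sum.insert)
    moreover have "- int N - 1 = - int (Suc N)" "int (Suc N) - 1 = int N" by auto
    ultimately show ?case unfolding Suc.IH by (simp only:) (simp add: algebra_simps)
  qed simp
  obtain S where S: "(fcoef g has_sum S) UNIV"
    using sum summable_on_def by blast
  have "(\<lambda>N. fcoef h (- int N - 1) - fcoef h (int N) + g 0) \<longlonglongrightarrow> S"
  proof -
    have "(\<Sum>n = - int N..int N. fcoef g n) = fcoef h (- int N - 1) - fcoef h (int N) + g 0" for N
      unfolding coef sum.distrib tele by simp
    then show ?thesis using has_sum_int_LIMSEQ[OF S] by simp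
  qed
  \<comment> \<open>Riemann-Lebesgue removes the two end terms left by telescoping, one index going
    to minus infinity and the other to plus infinity.\<close>
  moreover have "(\<lambda>N. fcoef h (k N)) \<longlonglongrightarrow> 0" if "\<And>N. \<bar>k N\<bar> \<ge> int N" for k
    unfolding LIMSEQ_iff
  proof (intro allI impI)
    fix e :: real assume "e > 0"
    then obtain M where M: "\<And>n. real_of_int \<bar>n\<bar> \<ge> M \<Longrightarrow> norm (fcoef h n) < e"
      using riemann_lebesgue[OF h] by blast
    have "norm (fcoef h (k N) - 0) < e" if "N \<ge> nat \<lceil>M\<rceil>" for N
    proof -
      have "M \<le> real N" using that by linarith
      also have "real N \<le> real_of_int \<bar>k N\<bar>"
        using \<open>\<And>N. \<bar>k N\<bar> \<ge> int N\<close>[of N] by linarith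
      finally show ?thesis using M by simp
    qed
    then show "\<exists>N0. \<forall>N\<ge>N0. norm (fcoef h (k N) - 0) < e" by blast
  qed
  from this[of "\<lambda>N. - int N - 1"] this[of int]
  have "(\<lambda>N. fcoef h (- int N - 1) - fcoef h (int N) + g 0) \<longlonglongrightarrow> 0 - 0 + g 0"
    by (intro tendsto_add tendsto_diff tendsto_const) auto
  ultimately have "S = g 0" using LIMSEQ_unique by fastforce
  then show ?thesis using S by simp
qed

section \<open>Absolutely convergent series\<close>

text \<open>The majorant \<open>M\<close> makes the finite partial sums converge uniformly along the
  filter of finite subsets, and uniform limits commute with the integral over a compact
  interval.\<close>

lemma has_sum_integral:
  fixes g :: "'i \<Rightarrow> real \<Rightarrow> complex"
  assumes cont: "\<And>i. continuous_on {a..b} (g i)"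
    and bound: "\<And>i s. s \<in> {a..b} \<Longrightarrow> norm (g i s) \<le> M i" and "M summable_on UNIV"
    and sum: "\<And>s. s \<in> {a..b} \<Longrightarrow> ((\<lambda>i. g i s) has_sum G s) UNIV"
  shows "((\<lambda>i. integral {a..b} (g i)) has_sum integral {a..b} G) UNIV"
proof -
  have "uniform_limit {a..b} (\<lambda>X s. \<Sum>i\<in>X. g i s) G (finite_subsets_at_top UNIV)"
    using assms by (intro Weierstrass_m_test_general'[of UNIV "{a..b}" g M]) auto
  then obtain I J where IJ: "\<And>X. ((\<lambda>s. \<Sum>i\<in>X. g i s) has_integral I X) {a..b}"
      "(G has_integral J) {a..b}" "(I \<longlongrightarrow> J) (finite_subsets_at_top UNIV)"
    by (rule uniform_limit_integral) (auto intro!: continuous_intros cont)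
  have "((\<lambda>s. \<Sum>i\<in>X. g i s) has_integral (\<Sum>i\<in>X. integral {a..b} (g i))) {a..b}" if "finite X" for X
    using that by (intro has_integral_sum integrable_integral integrable_continuous_interval cont)
  then have "finite X \<Longrightarrow> I X = (\<Sum>i\<in>X. integral {a..b} (g i))" for X
    using IJ(1) has_integral_unique by blast
  then have "((\<lambda>X. \<Sum>i\<in>X. integral {a..b} (g i)) \<longlongrightarrow> J) (finite_subsets_at_top UNIV)"
    using IJ(3) by (rule_tac Lim_transform_eventually[OF IJ(3)]) (auto intro: eventually_finite_subsets_at_top_weakI)
  moreover have "J = integral {a..b} G" using IJ(2) by (simp add: integral_unique)
  ultimately show ?thesis by (simp add: has_sum_def)
qed

lemma summable_int_inverse_square: "(\<lambda>n::int. 1 / (1 + \<bar>real_of_int n\<bar>) ^ 2) summable_on UNIV"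
proof -
  let ?f = "\<lambda>n::int. 1 / (1 + \<bar>real_of_int n\<bar>) ^ 2"
  have "summable (\<lambda>n. 1 / real (Suc n) ^ 2)"
    using inverse_power_summable[of 2, where 'a = real]
    by (subst summable_Suc_iff) (simp add: field_simps)
  then have "(\<lambda>n. 1 / real (Suc n) ^ 2) summable_on UNIV"
    by (intro summable_nonneg_imp_summable_on) auto
  then have nat: "(\<lambda>n. 1 / (1 + real n) ^ 2) summable_on UNIV" by simp
  have "?f summable_on range int"
    by (subst summable_on_reindex) (use nat in \<open>auto simp: o_def inj_on_def\<close>)
  moreover have "?f summable_on range (\<lambda>n. - int n)"
    by (subst summable_on_reindex) (use nat in \<open>auto simp: o_def inj_on_def\<close>)
  ultimately have "?f summable_on (range int \<union> range (\<lambda>n. - int n))"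
    by (rule summable_on_union)
  moreover have "range int \<union> range (\<lambda>n. - int n) = UNIV"
  proof -
    have "x \<in> range int \<union> range (\<lambda>n. - int n)" for x
      by (cases x rule: int_cases2) auto
    then show ?thesis by blast
  qed
  ultimately show ?thesis by simp
qed

lemma summable_int_pair_inverse_square:
  "(\<lambda>(m::int, n::int). 1 / (1 + \<bar>real_of_int m\<bar>) ^ 2 * (1 / (1 + \<bar>real_of_int n\<bar>) ^ 2)) summable_on UNIV"
proof -
  let ?f = "\<lambda>n::int. 1 / (1 + \<bar>real_of_int n\<bar>) ^ 2"
  obtain S where S: "(?f has_sum S) UNIV"
    using summable_int_inverse_square summable_on_def by blast
  have "(\<lambda>(m, n). ?f m * ?f n) summable_on (UNIV \<times> UNIV)"
    by (rule summable_on_SigmaI[where g = "\<lambda>m. ?f m * S"])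
      (use S summable_int_inverse_square in \<open>auto intro: has_sum_cmult_right summable_on_cmult_left simp del: times_divide_eq_left times_divide_eq_right\<close>)
  then show ?thesis by simp
qed

lemma summable_int_decay:
  assumes "\<And>n::int. (f n :: real) * (1 + \<bar>real_of_int n\<bar>) ^ 2 \<le> B" "\<And>n. f n \<ge> 0"
  shows "f summable_on UNIV"
proof (rule summable_on_comparison_test[OF summable_on_cmult_right[OF summable_int_inverse_square, of B]])
  show "f n \<le> B * (1 / (1 + \<bar>real_of_int n\<bar>) ^ 2)" for n
    using assms(1)[of n] by (simp add: pos_le_divide_eq)
qed (use assms in auto)

lemma summable_rapidly_decreasing:
  assumes "rapidly_decreasing c"
  shows "(\<lambda>x. norm (c x)) summable_on UNIV"
proof -
  \<comment> \<open>Exponent 4 suffices because (1 + |m|)^2 (1 + |n|)^2 is at most (1 + |m| +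
    |n|)^4, and the inverse squares are summable in each variable.\<close>
  obtain B where B: "\<And>m n. norm ((1 + \<bar>of_int m\<bar> + \<bar>of_int n\<bar>) ^ 4 *\<^sub>R c (m, n)) \<le> B"
    using assms unfolding rapidly_decreasing_def bounded_iff by fast
  show ?thesis
  proof (rule summable_on_comparison_test[OF summable_on_cmult_right[OF summable_int_pair_inverse_square, of B]])
    fix x :: "int \<times> int"
    obtain m n where x: "x = (m, n)" by force
    let ?a = "1 + \<bar>real_of_int m\<bar>" and ?b = "1 + \<bar>real_of_int n\<bar>"
    have "?a ^ 2 * ?b ^ 2 \<le> (?a + \<bar>of_int n\<bar>) ^ 2 * (?a + \<bar>of_int n\<bar>) ^ 2"
      by (intro mult_mono power_mono) auto
    then have "norm (c x) * (?a ^ 2 * ?b ^ 2) \<le> norm (c x) * ((?a + \<bar>of_int n\<bar>) ^ 2 * (?a + \<bar>of_int n\<bar>) ^ 2)"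
      by (rule mult_left_mono) auto
    also have "\<dots> = norm ((?a + \<bar>of_int n\<bar>) ^ 4 *\<^sub>R c (m, n))"
      by (simp add: x flip: power_add)
    also note B
    finally show "norm (c x) \<le> B * (case x of (m, n) \<Rightarrow> 1 / (1 + \<bar>real_of_int m\<bar>) ^ 2 * (1 / (1 + \<bar>real_of_int n\<bar>) ^ 2))"
      by (simp add: x pos_le_divide_eq)
  qed auto
qed

section \<open>Fourier coefficients along a line\<close>

text \<open>The base point stays an argument, so that a coefficient is itself a function of
  \<open>z\<close> that can be differentiated, translated and expanded again in another
  direction.\<close>

definition lcoef :: "complex \<Rightarrow> (complex \<Rightarrow> complex) \<Rightarrow> int \<Rightarrow> complex \<Rightarrow> complex" where
  "lcoef w f n z = fcoef (\<lambda>s. f (z + of_real s * w)) n"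

lemma smooth_continuous_line:
  fixes f :: "complex \<Rightarrow> complex"
  shows "smooth f \<Longrightarrow> continuous_on S (\<lambda>s. f (z + of_real s * w))"
  by (rule smooth_continuous_compose[where f = f and g = "\<lambda>s. z + of_real s * w"])
    (assumption, intro continuous_on_add continuous_on_mult continuous_on_of_real continuous_on_id continuous_on_const)

text \<open>Differentiation under the integral sign. The direction \<open>v\<close> is independent
  of the direction \<open>w\<close> of integration; the uses take \<open>w\<close> = 1 and
  \<open>v\<close> = i or \<tau>.\<close>

lemma lcoef_deriv:
  assumes "smooth f"
  shows "((\<lambda>t. lcoef w f n (z + of_real t * v)) has_vector_derivative
    lcoef w (dir_deriv v f) n (z + of_real t * v)) (at t)"
proof -
  have "((\<lambda>t. integral (cbox 0 1) (\<lambda>s. f (z + of_real t * v + of_real s * w) * fchar (- n) s))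
    has_vector_derivative
    integral (cbox 0 1) (\<lambda>s. dir_deriv v f (z + of_real t * v + of_real s * w) * fchar (- n) s)) (at t within UNIV)"
  proof (rule leibniz_rule_vector_derivative)
    fix t s :: real
    have "((\<lambda>t. f (z + of_real s * w + of_real t * v)) has_vector_derivative
        dir_deriv v f (z + of_real s * w + of_real t * v)) (at t)"
      by (rule has_vector_derivative_line[OF assms])
    then show "((\<lambda>t. f (z + of_real t * v + of_real s * w) * fchar (- n) s) has_vector_derivative
        dir_deriv v f (z + of_real t * v + of_real s * w) * fchar (- n) s) (at t within UNIV)"
      by (intro has_vector_derivative_mult_left) (simp add: add_ac)
  next
    fix t :: real
    show "(\<lambda>s. f (z + of_real t * v + of_real s * w) * fchar (- n) s) integrable_on cbox 0 1"
      by (intro integrable_continuous continuous_intros smooth_continuous_compose[OF assms])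
  next
    show "continuous_on (UNIV \<times> cbox 0 1)
        (\<lambda>(t, s). dir_deriv v f (z + of_real t * v + of_real s * w) * fchar (- n) s)"
      unfolding case_prod_unfold
      by (intro continuous_intros smooth_continuous_compose[OF smooth_dir_deriv[OF assms]])
  qed auto
  then show ?thesis by (simp add: lcoef_def fcoef_def)
qed

lemma lcoef_continuous:
  "smooth f \<Longrightarrow> continuous_on S (\<lambda>t. lcoef w f n (z + of_real t * v))"
  by (intro continuous_at_imp_continuous_on ballI has_vector_derivative_continuous[OF lcoef_deriv])

lemma lcoef_dir_deriv_self:
  assumes "smooth f" "\<And>z. f (z + w) = f z"
  shows "lcoef w (dir_deriv w f) n z = 2 * pi * \<i> * of_int n * lcoef w f n z"
proof -
  have "fcoef (\<lambda>s. dir_deriv w f (z + of_real s * w)) n =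
      f (z + of_real 1 * w) - f (z + of_real 0 * w) +
      2 * pi * \<i> * of_int n * fcoef (\<lambda>s. f (z + of_real s * w)) n"
    by (intro fcoef_deriv has_vector_derivative_line smooth_continuous_line smooth_dir_deriv assms(1))
  then show ?thesis by (simp add: lcoef_def assms(2))
qed

lemma lcoef_dir_deriv_funpow:
  assumes "smooth f" "\<And>z. f (z + w) = f z"
  shows "lcoef w ((dir_deriv w ^^ j) f) n z = (2 * pi * \<i> * of_int n) ^ j * lcoef w f n z"
proof (induction j)
  case (Suc j)
  show ?case
    using lcoef_dir_deriv_self[of "(dir_deriv w ^^ j) f" w n z] Suc
    by (simp add: smooth_dir_deriv_funpow dir_deriv_funpow_periodic assms mult_ac)
qed simp

lemma lcoef_translate:
  assumes "smooth f" "\<And>z. f (z + w) = f z"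
  shows "lcoef w f n (z + of_real t * w) = fchar n t * lcoef w f n z"
proof -
  have "f (z + of_real (s + 1) * w) = f (z + of_real s * w)" for s
    using assms(2)[of "z + of_real s * w"] by (simp add: ring_distribs add_ac)
  then have "fcoef (\<lambda>s. f (z + of_real (s + t) * w)) n = fchar n t * fcoef (\<lambda>s. f (z + of_real s * w)) n"
    using fcoef_shift[of "\<lambda>s. f (z + of_real s * w)"] smooth_continuous_line[OF assms(1)] by blast
  then show ?thesis by (simp add: lcoef_def ring_distribs add_ac)
qed

lemma lcoef_bound:
  assumes "smooth f" "\<And>s. s \<in> {0..1} \<Longrightarrow> norm (f (z + of_real s * w)) \<le> B"
  shows "norm (lcoef w f n z) \<le> B"
  unfolding lcoef_def by (rule fcoef_bound) (use assms smooth_continuous_line in auto)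

text \<open>Turns smoothness into decay: j derivatives multiply a Fourier coefficient by (2 pi i
  n)^j, and the factor 2 pi > 1 may be discarded.\<close>

lemma decay_from_bounds:
  fixes c :: complex
  assumes "norm c \<le> A" and "norm ((2 * pi * \<i> * of_int n) ^ j * c) \<le> B"
  shows "norm c * (1 + \<bar>real_of_int n\<bar>) ^ j \<le> 2 ^ j * (A + B)"
proof -
  have "\<bar>real_of_int n\<bar> ^ j \<le> (2 * pi * \<bar>real_of_int n\<bar>) ^ j"
    using pi_gt3 by (intro power_mono) (auto simp: mult_le_cancel_right1)
  then have "\<bar>real_of_int n\<bar> ^ j * norm c \<le> norm ((2 * pi * \<i> * of_int n) ^ j * c)"
    by (simp add: norm_mult norm_power mult_right_mono)
  then have B: "norm c * \<bar>real_of_int n\<bar> ^ j \<le> B"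
    using assms(2) by (simp add: mult.commute)
  have "norm c * (1 + \<bar>real_of_int n\<bar>) ^ j \<le> norm c * (2 ^ j * (1 + \<bar>real_of_int n\<bar> ^ j))"
    by (intro mult_left_mono power_one_plus_le) auto
  also have "\<dots> = 2 ^ j * (norm c + norm c * \<bar>real_of_int n\<bar> ^ j)"
    by (simp add: algebra_simps)
  also have "\<dots> \<le> 2 ^ j * (A + B)"
    by (intro mult_left_mono add_mono assms B) auto
  finally show ?thesis .
qed

text \<open>The function and its j-th derivative along \<open>w\<close> are bounded on the compact
  set swept out by segments starting in \<open>K\<close>. One constant therefore serves all base
  points and all indices.\<close>

lemma lcoef_decay:
  assumes f: "smooth f" "\<And>z. f (z + w) = f z" and "compact K"
  obtains B where "\<And>z n. z \<in> K \<Longrightarrow> norm (lcoef w f n z) * (1 + \<bar>real_of_int n\<bar>) ^ j \<le> B"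
proof -
  have bd: "\<exists>B. \<forall>z\<in>K. \<forall>s\<in>{0..1}. norm (g (z + of_real s * w)) \<le> B" if g: "smooth g" for g :: "complex \<Rightarrow> complex"
  proof -
    have "compact ((\<lambda>(z, s). g (z + of_real s * w)) ` (K \<times> {0..1}))"
      unfolding case_prod_unfold
      by (intro compact_continuous_image smooth_continuous_compose[OF g] continuous_intros compact_Times \<open>compact K\<close> compact_Icc)
    then obtain B where "\<forall>x\<in>(\<lambda>(z, s). g (z + of_real s * w)) ` (K \<times> {0..1}). norm x \<le> B"
      using compact_imp_bounded bounded_iff by blast
    then show ?thesis by force
  qed
  obtain A where A: "\<And>z s. z \<in> K \<Longrightarrow> s \<in> {0..1} \<Longrightarrow> norm (f (z + of_real s * w)) \<le> A"
    using bd[OF f(1)] by blast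
  obtain B where B: "\<And>z s. z \<in> K \<Longrightarrow> s \<in> {0..1} \<Longrightarrow> norm ((dir_deriv w ^^ j) f (z + of_real s * w)) \<le> B"
    using bd[OF smooth_dir_deriv_funpow[OF f(1)]] by blast
  have "norm (lcoef w f n z) * (1 + \<bar>real_of_int n\<bar>) ^ j \<le> 2 ^ j * (A + B)" if "z \<in> K" for z n
  proof (rule decay_from_bounds)
    show "norm (lcoef w f n z) \<le> A" by (rule lcoef_bound[OF f(1) A[OF that]])
    have "norm (lcoef w ((dir_deriv w ^^ j) f) n z) \<le> B"
      by (rule lcoef_bound[OF smooth_dir_deriv_funpow[OF f(1)] B[OF that]])
    then show "norm ((2 * pi * \<i> * of_int n) ^ j * lcoef w f n z) \<le> B"
      by (simp add: lcoef_dir_deriv_funpow f)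
  qed
  then show ?thesis using that by blast
qed

lemma lcoef_abs_summable:
  assumes "smooth f" "\<And>z. f (z + w) = f z"
  shows "(\<lambda>n. norm (lcoef w f n z)) summable_on UNIV"
proof -
  obtain B where "\<And>z' n. z' \<in> {z} \<Longrightarrow> norm (lcoef w f n z') * (1 + \<bar>real_of_int n\<bar>) ^ 2 \<le> B"
    using lcoef_decay[of f w "{z}" 2] assms by auto
  then show ?thesis
    by (intro summable_int_decay) auto
qed

lemma lcoef_inversion:
  assumes "smooth f" "\<And>z. f (z + w) = f z"
  shows "((\<lambda>n. lcoef w f n z) has_sum f z) UNIV"
proof -
  have "(fcoef (\<lambda>s. f (z + of_real s * w)) has_sum f (z + of_real 0 * w)) UNIV"
  proof (rule fourier_inversion_at_0)
    show "f (z + of_real (s + 1) * w) = f (z + of_real s * w)" for s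
      using assms(2)[of "z + of_real s * w"] by (simp add: ring_distribs add_ac)
    show "fcoef (\<lambda>s. f (z + of_real s * w)) summable_on UNIV"
      using abs_summable_summable[OF lcoef_abs_summable[OF assms]] by (simp add: lcoef_def)
    show "((\<lambda>s. f (z + of_real s * w)) has_vector_derivative dir_deriv w f (z + of_real 0 * w)) (at 0)"
      by (rule has_vector_derivative_line[OF assms(1)])
  qed (rule smooth_continuous_line[OF assms(1)])
  then show ?thesis by (simp add: lcoef_def)
qed

lemma has_sum_lcoef:
  fixes G :: "'i \<Rightarrow> complex \<Rightarrow> complex"
  assumes "\<And>i. smooth (G i)" and "\<And>i s. s \<in> {0..1} \<Longrightarrow> norm (G i (z + of_real s * w)) \<le> M i"
    and "M summable_on UNIV"
    and "\<And>z. ((\<lambda>i. G i z) has_sum f z) UNIV"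
  shows "((\<lambda>i. lcoef w (G i) n z) has_sum lcoef w f n z) UNIV"
  unfolding lcoef_def fcoef_def
proof (rule has_sum_integral[where M = M])
  show "continuous_on {0..1} (\<lambda>s. G i (z + of_real s * w) * fchar (- n) s)" for i
    by (intro continuous_on_mult smooth_continuous_line assms(1) continuous_fchar continuous_on_id)
qed (use assms in \<open>auto simp: norm_mult intro: has_sum_cmult_left\<close>)

section \<open>Fourier series on the torus\<close>

lemma Cinf_torus_iff:
  "a \<in> Cinf_torus \<tau> \<longleftrightarrow> smooth a \<and> (\<forall>z. a (z + 1) = a z) \<and> (\<forall>z. a (z + \<tau>) = a z)"
proof (intro iffI conjI allI)
  assume a: "a \<in> Cinf_torus \<tau>"
  then have per: "a (z + (of_int m + of_int n * \<tau>)) = a z" for z m n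
    by (auto simp: Cinf_torus_def torus_lattice_def)
  show "smooth a" using a by (simp add: Cinf_torus_def)
  show "a (z + 1) = a z" for z using per[of z 1 0] by simp
  show "a (z + \<tau>) = a z" for z using per[of z 0 1] by simp
next
  assume a: "smooth a \<and> (\<forall>z. a (z + 1) = a z) \<and> (\<forall>z. a (z + \<tau>) = a z)"
  have nat: "a (z + of_nat k * l) = a z" if "\<And>z. a (z + l) = a z" for z l k
  proof (induction k)
    case (Suc k)
    then show ?case using that[of "z + of_nat k * l"] by (simp add: ring_distribs add_ac)
  qed simp
  have int: "a (z + of_int k * l) = a z" if "\<And>z. a (z + l) = a z" for z l k
  proof (cases k rule: int_cases2)
    case (nonpos j)
    then show ?thesis using nat[OF that, of "z + of_int k * l" j] by simp
  qed (use nat[OF that] in simp)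
  have "a (z + (of_int m + of_int n * \<tau>)) = a z" for z m n
    using int[of 1 z m] int[of \<tau> "z + of_int m" n] a by (simp add: add_ac)
  then show "a \<in> Cinf_torus \<tau>" using a by (auto simp: Cinf_torus_def torus_lattice_def)
qed

lemma Cinf_torusD:
  assumes "a \<in> Cinf_torus \<tau>"
  shows "smooth a" "a (z + 1) = a z" "a (z + \<tau>) = a z"
  using assms by (auto simp: Cinf_torus_iff)

lemma Cinf_torus_dir_deriv_funpow:
  "a \<in> Cinf_torus \<tau> \<Longrightarrow> (dir_deriv v ^^ j) a \<in> Cinf_torus \<tau>"
  by (auto simp: Cinf_torus_iff smooth_dir_deriv_funpow dir_deriv_funpow_periodic)

text \<open>The real coordinates of z in the basis 1, \<tau>. The functions u and v are the basic
  characters of these two coordinates.\<close>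

lemma torus_coordinates:
  assumes "Im \<tau> \<noteq> 0"
  shows "of_real (Re z - Re \<tau> / Im \<tau> * Im z) + of_real (Im z / Im \<tau>) * \<tau> = z"
  using assms by (simp add: complex_eq_iff)

lemma Cinf_torus_bounded:
  assumes a: "a \<in> Cinf_torus \<tau>" and "Im \<tau> \<noteq> 0"
  obtains B where "\<And>z. norm (a z) \<le> B"
proof -
  let ?h = "\<lambda>x. of_real (fst x) + of_real (snd x) * \<tau>"
  have "compact ((\<lambda>x. a (?h x)) ` ({0..1} \<times> {0..1}))"
    by (intro compact_continuous_image smooth_continuous_compose[OF Cinf_torusD(1)[OF a]] continuous_intros compact_Times compact_Icc)
  from compact_imp_bounded[OF this] obtain B where "\<forall>y\<in>(\<lambda>x. a (?h x)) ` ({0..1} \<times> {0..1}). norm y \<le> B"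
    unfolding bounded_iff ..
  then have B: "norm (a (?h x)) \<le> B" if "x \<in> {0..1} \<times> {0..1}" for x
    using that by auto
  have "norm (a z) \<le> B" for z
  proof -
    define s t where "s = Re z - Re \<tau> / Im \<tau> * Im z" and "t = Im z / Im \<tau>"
    have z: "of_real s + of_real t * \<tau> = z"
      using torus_coordinates[OF assms(2), of z] by (simp only: s_def t_def)
    have "z = of_real (frac s) + of_real (frac t) * \<tau> + (of_int \<lfloor>s\<rfloor> + of_int \<lfloor>t\<rfloor> * \<tau>)"
    proof -
      have "(of_real r :: complex) = of_real (frac r) + of_int \<lfloor>r\<rfloor>" for r
        by (simp add: frac_def)
      from this[of s] this[of t] show ?thesis
        unfolding z[symmetric] by (simp only: ring_distribs add_ac)
    qed
    moreover have "of_int \<lfloor>s\<rfloor> + of_int \<lfloor>t\<rfloor> * \<tau> \<in> torus_lattice \<tau>"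
      by (auto simp: torus_lattice_def)
    ultimately have "a z = a (?h (frac s, frac t))"
      using a by (simp add: Cinf_torus_def)
    then show ?thesis using B[of "(frac s, frac t)"] frac_lt_1[of s] frac_lt_1[of t] by simp
  qed
  then show ?thesis using that by blast
qed

text \<open>A double Fourier coefficient, taken along 1 inside and along \<tau> outside. At
  \<open>z\<close> = 0 it is the coefficient of u^m v^n; at other points it is the whole term of the
  series.\<close>

definition tcoef :: "complex \<Rightarrow> (complex \<Rightarrow> complex) \<Rightarrow> int \<Rightarrow> int \<Rightarrow> complex \<Rightarrow> complex" where
  "tcoef \<tau> a m n z = fcoef (\<lambda>t. lcoef 1 a m (z + of_real t * \<tau>)) n"

lemma lcoef_periodic: "(\<And>z. f (z + l) = f z) \<Longrightarrow> lcoef w f n (z + l) = lcoef w f n z"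
proof -
  assume "\<And>z. f (z + l) = f z"
  then have "f (z + l + of_real s * w) = f (z + of_real s * w)" for s
    by (metis add.assoc add.commute)
  then show ?thesis by (simp add: lcoef_def)
qed

text \<open>For the direction \<tau> the parts integration happens in the outer integral; its
  boundary terms cancel because the inner coefficient inherits the period \<tau>.\<close>

lemma tcoef_dir_deriv:
  assumes a: "a \<in> Cinf_torus \<tau>"
  shows "tcoef \<tau> ((dir_deriv 1 ^^ j) a) m n z = (2 * pi * \<i> * of_int m) ^ j * tcoef \<tau> a m n z"
    and "tcoef \<tau> ((dir_deriv \<tau> ^^ j) a) m n z = (2 * pi * \<i> * of_int n) ^ j * tcoef \<tau> a m n z"
proof -
  note a' = Cinf_torusD[OF a]
  show "tcoef \<tau> ((dir_deriv 1 ^^ j) a) m n z = (2 * pi * \<i> * of_int m) ^ j * tcoef \<tau> a m n z"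
    unfolding tcoef_def by (simp add: lcoef_dir_deriv_funpow a' fcoef_cmult)
  show "tcoef \<tau> ((dir_deriv \<tau> ^^ j) a) m n z = (2 * pi * \<i> * of_int n) ^ j * tcoef \<tau> a m n z"
  proof (induction j)
    case (Suc j)
    define b where "b = (dir_deriv \<tau> ^^ j) a"
    have b: "smooth b" "\<And>z. b (z + \<tau>) = b z"
      using Cinf_torusD[OF Cinf_torus_dir_deriv_funpow[OF a, of j \<tau>]] by (auto simp: b_def)
    have "fcoef (\<lambda>t. lcoef 1 (dir_deriv \<tau> b) m (z + of_real t * \<tau>)) n =
        lcoef 1 b m (z + of_real 1 * \<tau>) - lcoef 1 b m (z + of_real 0 * \<tau>) +
        2 * pi * \<i> * of_int n * fcoef (\<lambda>t. lcoef 1 b m (z + of_real t * \<tau>)) n"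
      by (intro fcoef_deriv has_vector_derivative_at_within[OF lcoef_deriv] lcoef_continuous smooth_dir_deriv b)
    then have "tcoef \<tau> (dir_deriv \<tau> b) m n z = 2 * pi * \<i> * of_int n * tcoef \<tau> b m n z"
      using lcoef_periodic[of b \<tau> 1 m z] b(2) by (simp add: tcoef_def)
    then show ?case using Suc by (simp add: b_def mult_ac)
  qed simp
qed

lemma tcoef_bound:
  assumes "smooth a" "\<And>z. norm (a z) \<le> B"
  shows "norm (tcoef \<tau> a m n z) \<le> B"
  unfolding tcoef_def
  by (intro fcoef_bound lcoef_continuous lcoef_bound assms)

text \<open>Derivatives along 1 control m and derivatives along \<tau> control n. This covers the
  joint weight, since 1 + |m| + |n| is at most twice the larger of 1 + |m| and 1 + |n|.\<close>

lemma tcoef_rapidly_decreasing: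
  assumes a: "a \<in> Cinf_torus \<tau>" and "Im \<tau> \<noteq> 0"
  shows "rapidly_decreasing (\<lambda>(m, n). tcoef \<tau> a m n z)"
  unfolding rapidly_decreasing_def
proof
  fix k
  obtain A where A: "\<And>z. norm (a z) \<le> A"
    using Cinf_torus_bounded[OF a assms(2)] by blast
  obtain B where B: "\<And>z. norm ((dir_deriv 1 ^^ k) a z) \<le> B"
    using Cinf_torus_bounded[OF Cinf_torus_dir_deriv_funpow[OF a] assms(2)] by blast
  obtain C where C: "\<And>z. norm ((dir_deriv \<tau> ^^ k) a z) \<le> C"
    using Cinf_torus_bounded[OF Cinf_torus_dir_deriv_funpow[OF a] assms(2)] by blast
  note sm = Cinf_torusD(1)[OF Cinf_torus_dir_deriv_funpow[OF a]]
  have "norm ((1 + \<bar>of_int m\<bar> + \<bar>of_int n\<bar>) ^ k *\<^sub>R tcoef \<tau> a m n z) \<le> 2 ^ k * (2 ^ k * (A + B) + 2 ^ k * (A + C))" for m n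
  proof -
    let ?c = "norm (tcoef \<tau> a m n z)" and ?m = "\<bar>real_of_int m\<bar>" and ?n = "\<bar>real_of_int n\<bar>"
    have 0: "?c \<le> A" by (rule tcoef_bound[OF Cinf_torusD(1)[OF a] A])
    have 1: "?c * (1 + ?m) ^ k \<le> 2 ^ k * (A + B)"
      by (rule decay_from_bounds[OF 0])
        (use tcoef_bound[OF sm B, of \<tau> m n z] in \<open>simp add: tcoef_dir_deriv[OF a]\<close>)
    have 2: "?c * (1 + ?n) ^ k \<le> 2 ^ k * (A + C)"
      by (rule decay_from_bounds[OF 0])
        (use tcoef_bound[OF sm C, of \<tau> m n z] in \<open>simp add: tcoef_dir_deriv[OF a]\<close>)
    have "(1 + ?m + ?n) ^ k \<le> (2 * max (1 + ?m) (1 + ?n)) ^ k"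
      by (intro power_mono) (auto simp: max_def)
    also have "\<dots> \<le> 2 ^ k * ((1 + ?m) ^ k + (1 + ?n) ^ k)"
      by (auto simp: power_mult_distrib max_def)
    finally have "?c * (1 + ?m + ?n) ^ k \<le> ?c * (2 ^ k * ((1 + ?m) ^ k + (1 + ?n) ^ k))"
      by (rule mult_left_mono) simp
    also have "\<dots> = 2 ^ k * (?c * (1 + ?m) ^ k + ?c * (1 + ?n) ^ k)"
      by (simp add: algebra_simps)
    also have "\<dots> \<le> 2 ^ k * (2 ^ k * (A + B) + 2 ^ k * (A + C))"
      by (intro mult_left_mono add_mono 1 2) auto
    finally show ?thesis by (simp add: mult.commute)
  qed
  then show "bounded (range (\<lambda>(m, n). (1 + \<bar>of_int m\<bar> + \<bar>of_int n\<bar>) ^ k *\<^sub>R (case (m, n) of (m, n) \<Rightarrow> tcoef \<tau> a m n z)))"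
    unfolding bounded_iff by auto
qed

lemma tcoef_translate:
  assumes a: "a \<in> Cinf_torus \<tau>"
  shows "tcoef \<tau> a m n (of_real s + of_real t * \<tau>) = tcoef \<tau> a m n 0 * (fchar m s * fchar n t)"
proof -
  note a' = Cinf_torusD[OF a]
  have "lcoef 1 a m (of_real s + of_real t * \<tau> + of_real t' * \<tau>) =
      fchar m s * lcoef 1 a m (0 + of_real (t' + t) * \<tau>)" for t'
    using lcoef_translate[of a 1 m "of_real (t' + t) * \<tau>" s] a' by (simp add: algebra_simps)
  moreover have "lcoef 1 a m (0 + of_real (t + 1) * \<tau>) = lcoef 1 a m (0 + of_real t * \<tau>)" for t
    using lcoef_periodic[of a \<tau> 1 m "of_real t * \<tau>"] a' by (simp add: algebra_simps)
  ultimately show ?thesis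
    using fcoef_shift[of "\<lambda>t. lcoef 1 a m (0 + of_real t * \<tau>)" t n] lcoef_continuous[OF a'(1), of UNIV 1 m 0 \<tau>]
    by (simp add: tcoef_def fcoef_cmult mult_ac)
qed

lemma torus_uv_fchar:
  "torus_uv \<tau> m n z = fchar m (Re z - Re \<tau> / Im \<tau> * Im z) * fchar n (Im z / Im \<tau>)"
  by (simp add: torus_uv_def torus_u_def torus_v_def fchar_def cis_power_int mult_ac)

lemma torus_uv_line:
  assumes "Im \<tau> \<noteq> 0"
  shows "torus_uv \<tau> m n (of_real s + of_real t * \<tau>) = fchar m s * fchar n t"
  using assms by (simp add: torus_uv_fchar)

lemma norm_torus_uv [simp]: "norm (torus_uv \<tau> m n z) = 1"
  by (simp add: torus_uv_fchar norm_mult)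

lemma smooth_torus_uv: "smooth (torus_uv \<tau> m n)"
proof -
  have "bounded_linear (\<lambda>z. 2 * pi * of_int m * (Re z - Re \<tau> / Im \<tau> * Im z))"
    "bounded_linear (\<lambda>z. 2 * pi * of_int n * (Im z / Im \<tau>))"
    by (intro bounded_linear_const_mult bounded_linear_sub bounded_linear_Re bounded_linear_Im
        bounded_linear_divide[THEN bounded_linear_compose])+
  then show ?thesis
    unfolding torus_uv_fchar[abs_def] fchar_def by (intro smooth_mult smooth_cis)
qed

lemma torus_uv_add: "torus_uv \<tau> m n z * torus_uv \<tau> m' n' z = torus_uv \<tau> (m + m') (n + n') z"
  by (simp add: torus_uv_fchar fchar_add mult_ac)

lemma torus_uv_Cinf: "Im \<tau> \<noteq> 0 \<Longrightarrow> torus_uv \<tau> m n \<in> Cinf_torus \<tau>"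
  by (auto simp: Cinf_torus_iff smooth_torus_uv torus_uv_fchar add_divide_distrib distrib_left
      diff_add_eq[symmetric] fchar_add_arg)

lemma torus_uv_0 [simp]: "torus_uv \<tau> 0 0 z = 1"
  by (simp add: torus_uv_fchar)

text \<open>Along direction 1 the factor v is constant and u^m is a character of index m, so the
  product only shifts the Fourier index.\<close>

lemma lcoef_mult_torus_uv: "lcoef 1 (\<lambda>z. f z * torus_uv \<tau> m k z) n z = torus_uv \<tau> m k z * lcoef 1 f (n - m) z"
proof -
  have "torus_uv \<tau> m k (z + of_real s * 1) = torus_uv \<tau> m k z * fchar m s" for s
    by (simp add: torus_uv_fchar diff_add_eq[symmetric] fchar_add_arg mult_ac)
  then have "lcoef 1 (\<lambda>z. f z * torus_uv \<tau> m k z) n z =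
      fcoef (\<lambda>s. torus_uv \<tau> m k z * (f (z + of_real s * 1) * fchar m s)) n"
    unfolding lcoef_def by (simp add: mult_ac)
  then show ?thesis
    by (simp only: fcoef_cmult fcoef_mult_fchar lcoef_def)
qed

text \<open>One-variable inversion is applied twice: along \<tau> to each inner coefficient, then
  along 1 to \<open>a\<close>. Absolute summability merges the iterated sum into a double
  one.\<close>

lemma torus_expansion:
  assumes a: "a \<in> Cinf_torus \<tau>" and "Im \<tau> \<noteq> 0"
  shows "((\<lambda>(m, n). tcoef \<tau> a m n 0 * torus_uv \<tau> m n z) has_sum a z) UNIV"
proof -
  note a' = Cinf_torusD[OF a]
  have summ: "(\<lambda>x. norm (case x of (m, n) \<Rightarrow> tcoef \<tau> a m n z)) summable_on UNIV"
    by (rule summable_rapidly_decreasing[OF tcoef_rapidly_decreasing[OF assms]])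
  have inner: "((\<lambda>n. tcoef \<tau> a m n z) has_sum lcoef 1 a m z) UNIV" for m
  proof -
    have "(fcoef (\<lambda>t. lcoef 1 a m (z + of_real t * \<tau>)) has_sum lcoef 1 a m (z + of_real 0 * \<tau>)) UNIV"
    proof (rule fourier_inversion_at_0)
      show "lcoef 1 a m (z + of_real (t + 1) * \<tau>) = lcoef 1 a m (z + of_real t * \<tau>)" for t
        using lcoef_periodic[of a \<tau> 1 m "z + of_real t * \<tau>"] a' by (simp add: algebra_simps)
      \<comment> \<open>Inversion at a point requires summable coefficients; for fixed m they are a
        slice of the summable double family.\<close>
      have "(\<lambda>(m, n). tcoef \<tau> a m n z) summable_on (UNIV \<times> UNIV)"
        using abs_summable_summable[OF summ] by simp
      from summable_on_SigmaD1[OF this, of m]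
      show "fcoef (\<lambda>t. lcoef 1 a m (z + of_real t * \<tau>)) summable_on UNIV"
        by (simp add: tcoef_def[abs_def])
      show "((\<lambda>t. lcoef 1 a m (z + of_real t * \<tau>)) has_vector_derivative
          lcoef 1 (dir_deriv \<tau> a) m (z + of_real 0 * \<tau>)) (at 0)"
        by (rule lcoef_deriv[OF a'(1)])
    qed (rule lcoef_continuous[OF a'(1)])
    then show ?thesis by (simp add: tcoef_def[abs_def])
  qed
  have "((\<lambda>(m, n). tcoef \<tau> a m n z) has_sum a z) (UNIV \<times> UNIV)"
    by (rule has_sum_SigmaI[where g = "\<lambda>m. lcoef 1 a m z"])
      (use inner abs_summable_summable[OF summ] lcoef_inversion[of a 1 z] a' in auto)
  moreover have "tcoef \<tau> a m n z = tcoef \<tau> a m n 0 * torus_uv \<tau> m n z" for m n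
    by (subst torus_coordinates[OF assms(2), symmetric], subst tcoef_translate[OF a]) (simp add: torus_uv_fchar)
  ultimately show ?thesis by simp
qed

text \<open>Termwise integration against characters in both directions: orthogonality leaves the
  single index (m, n). This is what resolves the definite description in
  \<open>torus_coeff\<close>.\<close>

lemma torus_expansion_unique:
  assumes c: "rapidly_decreasing c" and "Im \<tau> \<noteq> 0"
    and sum: "\<And>z. ((\<lambda>(m, n). c (m, n) * torus_uv \<tau> m n z) has_sum a z) UNIV"
  shows "c (m, n) = tcoef \<tau> a m n 0"
proof -
  note M = summable_rapidly_decreasing[OF c]
  let ?G = "\<lambda>x z. c x * torus_uv \<tau> (fst x) (snd x) z"
  have sum': "((\<lambda>x. ?G x z) has_sum a z) UNIV" for z
    using sum by (simp add: case_prod_unfold)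
  have coef: "lcoef 1 (?G x) m (0 + of_real t * \<tau>) = c x * (if fst x = m then fchar (snd x) t else 0)" for x t
  proof -
    have "lcoef 1 (?G x) m (0 + of_real t * \<tau>) = fcoef (\<lambda>s. (c x * fchar (snd x) t) * fchar (fst x) s) m"
      unfolding lcoef_def using torus_uv_line[OF assms(2), of "fst x" "snd x" _ t] by (simp add: algebra_simps)
    then show ?thesis by (auto simp: fcoef_cmult fcoef_fchar)
  qed
  have 1: "((\<lambda>x. lcoef 1 (?G x) m (0 + of_real t * \<tau>)) has_sum lcoef 1 a m (0 + of_real t * \<tau>)) UNIV" for t
    by (rule has_sum_lcoef[where M = "\<lambda>x. norm (c x)"])
      (use M sum' in \<open>auto simp: norm_mult intro!: smooth_mult smooth_const smooth_torus_uv\<close>)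
  have "((\<lambda>x. fcoef (\<lambda>t. c x * (if fst x = m then fchar (snd x) t else 0)) n) has_sum tcoef \<tau> a m n 0) UNIV"
    unfolding tcoef_def fcoef_def
  proof (rule has_sum_integral[where M = "\<lambda>x. norm (c x)"])
    show "continuous_on {0..1} (\<lambda>t. c x * (if fst x = m then fchar (snd x) t else 0) * fchar (- n) t)" for x
      by (cases "fst x = m") (auto intro!: continuous_intros)
    show "((\<lambda>x. c x * (if fst x = m then fchar (snd x) t else 0) * fchar (- n) t) has_sum
        lcoef 1 a m (0 + of_real t * \<tau>) * fchar (- n) t) UNIV" for t
      using has_sum_cmult_left[OF 1[of t]] unfolding coef .
  qed (use M in \<open>auto simp: norm_mult\<close>)
  moreover have "fcoef (\<lambda>t. c x * (if fst x = m then fchar (snd x) t else 0)) n = (if x = (m, n) then c x else 0)" for x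
    by (cases x; cases "fst x = m") (auto simp: fcoef_cmult fcoef_fchar fcoef_const)
  ultimately have "((\<lambda>x. if x = (m, n) then c x else 0) has_sum tcoef \<tau> a m n 0) UNIV"
    by simp
  moreover have "((\<lambda>x. if x = (m, n) then c x else 0) has_sum c (m, n)) UNIV"
    by (rule has_sum_finite_neutralI[of "{(m, n)}"]) auto
  ultimately show ?thesis using has_sum_unique by blast
qed

lemma torus_coeff_eq:
  assumes a: "a \<in> Cinf_torus \<tau>" and "Im \<tau> \<noteq> 0"
  shows "torus_coeff \<tau> a = (\<lambda>(m, n). tcoef \<tau> a m n 0)"
  unfolding torus_coeff_def
proof (rule the_equality)
  show "rapidly_decreasing (\<lambda>(m, n). tcoef \<tau> a m n 0) \<and>
      (\<forall>z. ((\<lambda>(m, n). (case (m, n) of (m, n) \<Rightarrow> tcoef \<tau> a m n 0) * torus_uv \<tau> m n z) has_sum a z) UNIV)"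
    using tcoef_rapidly_decreasing[OF assms] torus_expansion[OF assms] by simp
next
  fix c assume "rapidly_decreasing c \<and> (\<forall>z. ((\<lambda>(m, n). c (m, n) * torus_uv \<tau> m n z) has_sum a z) UNIV)"
  then show "c = (\<lambda>(m, n). tcoef \<tau> a m n 0)"
    using torus_expansion_unique[of c \<tau> a] assms by (auto simp: fun_eq_iff)
qed

section \<open>The components of a quasi-periodic function\<close>

locale quasi_periodic_module =
  fixes p :: nat and \<tau> :: complex
  assumes p_pos: "p \<ge> 1" and Im_pos: "Im \<tau> > 0"
begin

lemma Im_neq: "Im \<tau> \<noteq> 0"
  using Im_pos by simp

definition \<rho> :: real where "\<rho> = Im \<tau> / real p"

lemma \<rho>_pos: "\<rho> > 0"
  using p_pos Im_pos by (simp add: \<rho>_def)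

lemma p_\<rho>: "real p * \<rho> = Im \<tau>"
  using p_pos by (simp add: \<rho>_def)

lemma F_setD:
  assumes "f \<in> F_set \<tau> p"
  shows "smooth f" "f (z + 1) = f z"
    "f (z + \<tau>) = cis (- (pi * real p * (Re \<tau> + 2 * Re z))) * f z"
  using assms by (auto simp: F_set_def)

text \<open>The multiplier depends on Re z alone, so it is constant along i and passes through this
  derivative.\<close>

lemma F_set_dir_deriv: "f \<in> F_set \<tau> p \<Longrightarrow> dir_deriv \<i> f \<in> F_set \<tau> p"
proof -
  assume f: "f \<in> F_set \<tau> p"
  have "dir_deriv \<i> f (z + \<tau>) = cis (- (pi * real p * (Re \<tau> + 2 * Re z))) * dir_deriv \<i> f z" for z
  proof (rule dir_deriv_quasiperiodic[OF F_setD(1)[OF f]])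
    show "f (z + \<tau> + of_real t * \<i>) = cis (- (pi * real p * (Re \<tau> + 2 * Re z))) * f (z + of_real t * \<i>)" for t
      using F_setD(3)[OF f, of "z + of_real t * \<i>"] by (simp add: add_ac)
  qed
  then show ?thesis
    using f by (auto simp: F_set_def intro: smooth_dir_deriv dir_deriv_periodic)
qed

text \<open>As a function of the parameter s along direction 1, the multiplier is a constant times
  the character of index -p, which raises the index of the coefficient by p.\<close>

lemma lcoef_quasiperiodic:
  assumes f: "f \<in> F_set \<tau> p"
  shows "lcoef 1 f n (z + \<tau>) = cis (- (pi * real p * (Re \<tau> + 2 * Re z))) * lcoef 1 f (n + int p) z"
proof -
  have "f (z + \<tau> + of_real s * 1) =
      cis (- (pi * real p * (Re \<tau> + 2 * Re z))) * (f (z + of_real s * 1) * fchar (- int p) s)" for s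
  proof -
    have "cis (- (pi * real p * (Re \<tau> + 2 * Re (z + of_real s)))) =
        cis (- (pi * real p * (Re \<tau> + 2 * Re z))) * fchar (- int p) s"
      by (simp add: fchar_def cis_mult algebra_simps)
    then show ?thesis
      using F_setD(3)[OF f, of "z + of_real s"] by (simp add: add_ac)
  qed
  then show ?thesis
    by (simp add: lcoef_def fcoef_cmult fcoef_mult_fchar)
qed

text \<open>The expansion solved for its n-th summand on the imaginary axis: phase and translation
  undo those of the series. The index runs over all integers, so that dependence on n mod p becomes
  a statement to prove.\<close>

definition component :: "(complex \<Rightarrow> complex) \<Rightarrow> int \<Rightarrow> real \<Rightarrow> complex" where
  "component f n t = cis (- (pi * (of_int n)\<^sup>2 * (Re \<tau> / real p))) * lcoef 1 f n (of_real (t - of_int n * \<rho>) * \<i>)"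

lemma component_add_p:
  assumes f: "f \<in> F_set \<tau> p"
  shows "component f (n + int p) t = component f n t"
proof -
  define z where "z = of_real (t - of_int (n + int p) * \<rho>) * \<i>"
  \<comment> \<open>Heights for n and n + p differ by p \<rho> = Im \<tau>. Reaching one base point
    from the other by \<tau> also moves it horizontally, and the correction by -Re \<tau> costs a
    character.\<close>
  have z: "of_real (t - of_int n * \<rho>) * \<i> = (z + of_real (- Re \<tau>) * 1) + \<tau>"
    using p_\<rho> by (simp add: z_def complex_eq_iff algebra_simps)
  have "lcoef 1 f n (of_real (t - of_int n * \<rho>) * \<i>) =
      cis (- (pi * real p * (Re \<tau> + 2 * (- Re \<tau>)))) * (fchar (n + int p) (- Re \<tau>) * lcoef 1 f (n + int p) z)"
    unfolding z lcoef_quasiperiodic[OF f]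
    by (subst lcoef_translate) (use F_setD[OF f] in \<open>auto simp: z_def\<close>)
  \<comment> \<open>With a = Re \<tau>: the phases -n^2 a/p, +p a and -2 (n + p) a add up to -(n +
    p)^2 a/p, all times pi.\<close>
  moreover have "cis (- (pi * (of_int n)\<^sup>2 * (Re \<tau> / real p))) *
      (cis (- (pi * real p * (Re \<tau> + 2 * (- Re \<tau>)))) * fchar (n + int p) (- Re \<tau>)) =
      cis (- (pi * (of_int (n + int p))\<^sup>2 * (Re \<tau> / real p)))"
    unfolding fchar_def cis_mult
    by (rule arg_cong[where f = cis]) (use p_pos in \<open>simp add: field_simps power2_eq_square\<close>)
  ultimately show ?thesis
    by (simp only: component_def z_def flip: mult.assoc)
qed

lemma component_add_int_mult:
  assumes f: "f \<in> F_set \<tau> p"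
  shows "component f (n + k * int p) = component f n"
proof -
  have nat: "component f (n + int j * int p) = component f n" for n j
  proof (induction j)
    case (Suc j)
    then show ?case
      using component_add_p[OF f, of "n + int j * int p"] by (simp add: fun_eq_iff algebra_simps)
  qed simp
  show ?thesis
  proof (cases k rule: int_cases2)
    case (nonpos j)
    then show ?thesis using nat[of "n + k * int p" j] by simp
  qed (use nat in simp)
qed

lemma component_mod: "f \<in> F_set \<tau> p \<Longrightarrow> component f (n mod int p) = component f n"
  using component_add_int_mult[of f "n mod int p" "n div int p"] by simp

lemma component_deriv:
  assumes f: "f \<in> F_set \<tau> p"
  shows "(component f n has_vector_derivative component (dir_deriv \<i> f) n t) (at t)"
proof -
  have eq: "component g n = (\<lambda>t. cis (- (pi * (of_int n)\<^sup>2 * (Re \<tau> / real p))) *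
      lcoef 1 g n (- (of_int n * of_real \<rho> * \<i>) + of_real t * \<i>))" for g
    by (simp add: fun_eq_iff component_def algebra_simps)
  show ?thesis
    unfolding eq by (intro has_vector_derivative_mult_right lcoef_deriv F_setD[OF f])
qed

text \<open>Shifting \<open>n\<close> by a multiple of \<open>p\<close> moves \<open>t\<close> into a fundamental interval, so that the decay of the
  Fourier coefficients in \<open>n\<close> becomes decay of a single component in \<open>t\<close>.\<close>

lemma component_bounded:
  assumes f: "f \<in> F_set \<tau> p"
  shows "bounded (range (\<lambda>t. t ^ j *\<^sub>R component f n t))"
proof -
  let ?K = "(\<lambda>y. of_real y * \<i>) ` {0..Im \<tau>}"
  have "compact ?K" by (intro compact_continuous_image continuous_intros) auto
  then obtain B where B: "\<And>z n. z \<in> ?K \<Longrightarrow> norm (lcoef 1 f n z) * (1 + \<bar>real_of_int n\<bar>) ^ j \<le> B"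
    using lcoef_decay[of f 1 ?K j] F_setD[OF f] by blast
  have "norm (t ^ j *\<^sub>R component f n t) \<le> Im \<tau> ^ j * B" for t
  proof -
    define k where "k = \<lfloor>(t - of_int n * \<rho>) / Im \<tau>\<rfloor>"
    define m where "m = n + k * int p"
    define y where "y = t - of_int m * \<rho>"
    have y: "y = t - of_int n * \<rho> - of_int k * Im \<tau>"
      using p_\<rho> by (simp add: y_def m_def algebra_simps)
    have "of_int k \<le> (t - of_int n * \<rho>) / Im \<tau>" "(t - of_int n * \<rho>) / Im \<tau> < of_int k + 1"
      unfolding k_def by linarith+
    then have y_range: "0 \<le> y" "y \<le> Im \<tau>"
      using Im_pos unfolding y by (simp_all add: field_simps)
    have "component f n t = component f m t"
      unfolding m_def component_add_int_mult[OF f] ..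
    then have norm: "norm (component f n t) = norm (lcoef 1 f m (of_real y * \<i>))"
      by (simp add: component_def norm_mult y_def)
    \<comment> \<open>Gives |t| = |y + m \<rho>| <= Im \<tau> (1 + |m|), so powers of t are paid for
      by the weight in the bound \<open>B\<close>.\<close>
    have "\<rho> \<le> Im \<tau>"
      using p_pos Im_pos by (simp add: \<rho>_def field_simps)
    have "\<bar>t\<bar> = \<bar>y + of_int m * \<rho>\<bar>" by (simp add: y_def)
    also have "\<dots> \<le> Im \<tau> + \<bar>of_int m\<bar> * \<rho>"
      using y_range \<rho>_pos abs_mult[of "of_int m" \<rho>] by (intro order.trans[OF abs_triangle_ineq] add_mono) auto
    also have "\<dots> \<le> Im \<tau> + \<bar>of_int m\<bar> * Im \<tau>"
      by (intro add_left_mono mult_left_mono \<open>\<rho> \<le> Im \<tau>\<close>) auto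
    also have "\<dots> = Im \<tau> * (1 + \<bar>of_int m\<bar>)" by (simp add: algebra_simps)
    finally have "\<bar>t\<bar> ^ j \<le> (Im \<tau> * (1 + \<bar>of_int m\<bar>)) ^ j" by (intro power_mono) auto
    then have "norm (t ^ j *\<^sub>R component f n t) \<le> (Im \<tau> * (1 + \<bar>of_int m\<bar>)) ^ j * norm (lcoef 1 f m (of_real y * \<i>))"
      by (simp add: norm norm_power power_abs mult_right_mono)
    also have "\<dots> = Im \<tau> ^ j * (norm (lcoef 1 f m (of_real y * \<i>)) * (1 + \<bar>of_int m\<bar>) ^ j)"
      by (simp add: power_mult_distrib mult_ac)
    also have "\<dots> \<le> Im \<tau> ^ j * B"
      using B[of "of_real y * \<i>" m] y_range Im_pos by (intro mult_left_mono) auto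
    finally show ?thesis .
  qed
  then show ?thesis unfolding bounded_iff by blast
qed

text \<open>The n-th components of all elements of \<open>F_set\<close> form a class closed under
  differentiation, because a derivative of a component is the component of the derivative along
  i.\<close>

lemma component_schwartz:
  assumes "f \<in> F_set \<tau> p"
  shows "component f n \<in> schwartz"
proof (rule schwartz_coinduct[where X = "(\<lambda>f. component f n) ` F_set \<tau> p"])
  fix g assume "g \<in> (\<lambda>f. component f n) ` F_set \<tau> p"
  then obtain f where f: "g = component f n" "f \<in> F_set \<tau> p" by blast
  show "\<exists>f'\<in>(\<lambda>f. component f n) ` F_set \<tau> p. \<forall>t. (g has_vector_derivative f' t) (at t)"
    unfolding f(1) using component_deriv[OF f(2)] F_set_dir_deriv[OF f(2)] by blast
  show "bounded (range (\<lambda>t. t ^ j *\<^sub>R g t))" for j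
    unfolding f(1) by (rule component_bounded[OF f(2)])
qed (use assms in blast)

definition components :: "(complex \<Rightarrow> complex) \<Rightarrow> nat \<Rightarrow> real \<Rightarrow> complex" where
  "components f r = (if r < p then component f (int r) else (\<lambda>_. 0))"

lemma components_H_set: "f \<in> F_set \<tau> p \<Longrightarrow> components f \<in> H_set p"
  by (auto simp: H_set_def components_def component_schwartz)

lemma nat_mod_p: "nat (n mod int p) < p" "int (nat (n mod int p)) = n mod int p"
  using p_pos by (auto simp: nat_less_iff)

lemma components_mod: "f \<in> F_set \<tau> p \<Longrightarrow> components f (nat (n mod int p)) = component f n"
  using nat_mod_p[of n] component_mod[of f n] by (simp add: components_def)

lemma component_at:
  assumes "smooth f" "\<And>z. f (z + 1) = f z"
  shows "cis (2 * pi * of_int n * Re z) * cis (pi * (of_int n)\<^sup>2 * (Re \<tau> / real p)) *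
    component f n (Im z + of_int n * (Im \<tau> / real p)) = lcoef 1 f n z"
proof -
  have "lcoef 1 f n (of_real (Im z) * \<i> + of_real (Re z) * 1) = fchar n (Re z) * lcoef 1 f n (of_real (Im z) * \<i>)"
    by (rule lcoef_translate[OF assms])
  moreover have "of_real (Im z) * \<i> + of_real (Re z) * 1 = z"
    by (simp add: complex_eq_iff)
  ultimately have "lcoef 1 f n z = fchar n (Re z) * lcoef 1 f n (of_real (Im z) * \<i>)" by simp
  moreover have "component f n (Im z + of_int n * (Im \<tau> / real p)) =
      cis (- (pi * (of_int n)\<^sup>2 * (Re \<tau> / real p))) * lcoef 1 f n (of_real (Im z) * \<i>)"
    by (simp add: component_def \<rho>_def)
  moreover have "fchar n (Re z) * cis a * (cis (- a) * w) = fchar n (Re z) * w" for a w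
  proof -
    have "fchar n (Re z) * cis a * (cis (- a) * w) = (cis a * cis (- a)) * (fchar n (Re z) * w)"
      by (simp only: mult_ac)
    then show ?thesis by (simp add: cis_mult)
  qed
  ultimately show ?thesis by (simp add: fchar_def)
qed

lemma expansion_components:
  assumes f: "f \<in> F_set \<tau> p"
  shows "expansion \<tau> p f (components f)"
  unfolding expansion_def components_mod[OF f] component_at[OF F_setD(1)[OF f] F_setD(2)[OF f]]
  using lcoef_inversion[of f 1] F_setD[OF f] by blast

section \<open>Sums of Schwartz functions\<close>

lemma H_set_schwartz: "\<psi> \<in> H_set p \<Longrightarrow> \<psi> r \<in> schwartz"
  by (cases "r < p") (auto simp: H_set_def schwartz_zero)

lemma H_set_decay:
  assumes \<psi>: "\<psi> \<in> H_set p"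
  obtains B where "B \<ge> 0" "\<And>r t. norm (\<psi> r t) * (1 + \<bar>t\<bar>) ^ j \<le> B"
proof -
  have "\<exists>B. B \<ge> 0 \<and> (\<forall>t. norm (\<psi> r t) * (1 + \<bar>t\<bar>) ^ j \<le> B)" for r
    using schwartz_decay[OF H_set_schwartz[OF \<psi>, of r], of j] by metis
  then obtain b where b: "\<And>r. b r \<ge> 0" "\<And>r t. norm (\<psi> r t) * (1 + \<bar>t\<bar>) ^ j \<le> b r" by metis
  define B where "B = (\<Sum>r<p. b r)"
  have "B \<ge> 0" unfolding B_def by (intro sum_nonneg b)
  moreover have "norm (\<psi> r t) * (1 + \<bar>t\<bar>) ^ j \<le> B" for r t
  proof (cases "r < p")
    case True
    then have "b r \<le> B" unfolding B_def using b(1) by (intro member_le_sum) auto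
    then show ?thesis using b(2) order.trans by blast
  next
    case False
    then show ?thesis using \<psi> \<open>B \<ge> 0\<close> by (simp add: H_set_def)
  qed
  ultimately show ?thesis using that by blast
qed

text \<open>For |y| <= R the argument y + n \<rho> grows linearly with |n|, so decay in the argument
  becomes decay in n, uniformly in y. This is the majorant for every series over n.\<close>

lemma H_set_majorant:
  assumes \<psi>: "\<psi> \<in> H_set p"
  obtains M where "M summable_on UNIV"
    "\<And>n y. \<bar>y\<bar> \<le> R \<Longrightarrow> norm (\<psi> (nat (n mod int p)) (y + of_int n * \<rho>)) \<le> M n"
proof -
  obtain B where B: "B \<ge> 0" "\<And>r t. norm (\<psi> r t) * (1 + \<bar>t\<bar>) ^ 2 \<le> B"
    using H_set_decay[OF \<psi>, of 2] by blast
  define C where "C = 1 + (1 + \<bar>R\<bar>) / \<rho>"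
  have C: "1 + \<bar>real_of_int n\<bar> \<le> C * (1 + \<bar>y + of_int n * \<rho>\<bar>)" if "\<bar>y\<bar> \<le> R" for n y
  proof -
    let ?t = "\<bar>y + of_int n * \<rho>\<bar>"
    have "\<bar>real_of_int n\<bar> * \<rho> = \<bar>of_int n * \<rho>\<bar>" using \<rho>_pos by (simp add: abs_mult)
    also have "\<dots> \<le> ?t + \<bar>R\<bar>" using that by linarith
    also have "\<dots> \<le> (1 + \<bar>R\<bar>) * (1 + ?t)" by (simp add: algebra_simps)
    finally have "\<bar>real_of_int n\<bar> \<le> (1 + \<bar>R\<bar>) / \<rho> * (1 + ?t)"
      using \<rho>_pos by (simp add: field_simps)
    moreover have "C * (1 + ?t) = (1 + ?t) + (1 + \<bar>R\<bar>) / \<rho> * (1 + ?t)"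
      by (simp only: C_def distrib_right mult_1)
    ultimately show ?thesis by linarith
  qed
  define M where "M n = (C\<^sup>2 * B) * (1 / (1 + \<bar>real_of_int n\<bar>) ^ 2)" for n :: int
  have "M summable_on UNIV"
    unfolding M_def by (intro summable_on_cmult_right summable_int_inverse_square)
  moreover have "norm (\<psi> (nat (n mod int p)) (y + of_int n * \<rho>)) \<le> M n" if "\<bar>y\<bar> \<le> R" for n y
  proof -
    let ?t = "y + of_int n * \<rho>" and ?r = "nat (n mod int p)"
    have "(1 + \<bar>real_of_int n\<bar>) ^ 2 \<le> (C * (1 + \<bar>?t\<bar>)) ^ 2"
      by (intro power_mono C that) auto
    then have "norm (\<psi> ?r ?t) * (1 + \<bar>real_of_int n\<bar>) ^ 2 \<le> norm (\<psi> ?r ?t) * (C * (1 + \<bar>?t\<bar>)) ^ 2"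
      by (rule mult_left_mono) simp
    also have "\<dots> = C\<^sup>2 * (norm (\<psi> ?r ?t) * (1 + \<bar>?t\<bar>) ^ 2)"
      by (simp add: power_mult_distrib mult_ac)
    also have "\<dots> \<le> C\<^sup>2 * B"
      by (intro mult_left_mono B) auto
    finally show ?thesis by (simp add: M_def pos_le_divide_eq)
  qed
  ultimately show ?thesis using that by blast
qed

definition gsum_term :: "(nat \<Rightarrow> real \<Rightarrow> complex) \<Rightarrow> int \<Rightarrow> complex \<Rightarrow> complex" where
  "gsum_term \<psi> n z = cis (2 * pi * of_int n * Re z) * cis (pi * (of_int n)\<^sup>2 * (Re \<tau> / real p)) *
     \<psi> (nat (n mod int p)) (Im z + of_int n * (Im \<tau> / real p))"

lemma expansion_gsum: "expansion \<tau> p f \<psi> \<longleftrightarrow> (\<forall>z. ((\<lambda>n. gsum_term \<psi> n z) has_sum f z) UNIV)"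
  by (simp add: expansion_def gsum_term_def)

lemma norm_gsum_term: "norm (gsum_term \<psi> n z) = norm (\<psi> (nat (n mod int p)) (Im z + of_int n * \<rho>))"
  by (simp add: gsum_term_def norm_mult \<rho>_def)

text \<open>Integrating the expansion against the character of index -r along the unit segment at
  height t - r \<rho> leaves only the summand n = r, whose argument is exactly t.\<close>

lemma components_unique:
  assumes \<psi>: "\<psi> \<in> H_set p" and exp: "expansion \<tau> p f \<psi>"
  shows "\<psi> = components f"
proof -
  have "\<psi> r t = component f (int r) t" if r: "r < p" for r t
  proof -
    define y where "y = t - real r * \<rho>"
    let ?k = "\<lambda>n. cis (pi * (of_int n)\<^sup>2 * (Re \<tau> / real p)) * \<psi> (nat (n mod int p)) (y + of_int n * (Im \<tau> / real p))"
    obtain M where M: "M summable_on UNIV"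
        "\<And>n y'. \<bar>y'\<bar> \<le> \<bar>y\<bar> \<Longrightarrow> norm (\<psi> (nat (n mod int p)) (y' + of_int n * \<rho>)) \<le> M n"
      using H_set_majorant[OF \<psi>, of "\<bar>y\<bar>"] by blast
    have tm: "gsum_term \<psi> n (of_real y * \<i> + of_real s * 1) = ?k n * fchar n s" for n s
      by (simp add: gsum_term_def fchar_def mult_ac)
    have "((\<lambda>n. fcoef (\<lambda>s. ?k n * fchar n s) (int r)) has_sum lcoef 1 f (int r) (of_real y * \<i>)) UNIV"
      unfolding lcoef_def fcoef_def
    proof (rule has_sum_integral[where M = M])
      show "norm (?k n * fchar n s * fchar (- int r) s) \<le> M n" for n s
        using M(2)[of y n] by (simp add: norm_mult \<rho>_def)
      show "((\<lambda>n. ?k n * fchar n s * fchar (- int r) s) has_sum f (of_real y * \<i> + of_real s * 1) * fchar (- int r) s) UNIV" for s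
        using exp unfolding expansion_gsum tm[symmetric] by (intro has_sum_cmult_left) blast
    qed (auto intro!: continuous_intros M)
    moreover have "fcoef (\<lambda>s. ?k n * fchar n s) (int r) = (if n = int r then ?k n else 0)" for n
      by (simp add: fcoef_cmult fcoef_fchar)
    ultimately have "((\<lambda>n. if n = int r then ?k n else 0) has_sum lcoef 1 f (int r) (of_real y * \<i>)) UNIV"
      by simp
    moreover have "((\<lambda>n. if n = int r then ?k n else 0) has_sum ?k (int r)) UNIV"
      by (rule has_sum_finite_neutralI[of "{int r}"]) auto
    ultimately have "lcoef 1 f (int r) (of_real y * \<i>) = ?k (int r)"
      using has_sum_unique by blast
    then show ?thesis
      using r by (simp add: component_def y_def \<rho>_def cis_mult flip: mult.assoc)
  qed
  moreover have "\<psi> r = (\<lambda>_. 0)" if "\<not> r < p" for r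
    using \<psi> that by (auto simp: H_set_def)
  ultimately show ?thesis
    by (force simp: components_def fun_eq_iff)
qed

lemma phi_eq: "f \<in> F_set \<tau> p \<Longrightarrow> phi \<tau> p f = components f"
  unfolding phi_def
  by (rule the_equality) (use components_H_set expansion_components components_unique in blast)+

end

section \<open>Termwise differentiation of series over the integers\<close>

lemma has_derivative_has_sum_int:
  fixes f :: "int \<Rightarrow> complex \<Rightarrow> complex"
  assumes S: "convex S" "open S" "z \<in> S"
    and der: "\<And>n x. x \<in> S \<Longrightarrow> (f n has_derivative f' n x) (at x)"
    and bound: "\<And>n x v. x \<in> S \<Longrightarrow> norm (f' n x v) \<le> M n * norm v" and M: "M summable_on UNIV"
    and sum: "\<And>x. x \<in> S \<Longrightarrow> ((\<lambda>n. f n x) has_sum F x) UNIV"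
    and sum': "\<And>x v. x \<in> S \<Longrightarrow> ((\<lambda>n. f' n x v) has_sum F' x v) UNIV"
  shows "(F has_derivative F' z) (at z)"
proof -
  have bij: "bij_betw int_decode UNIV UNIV" by (rule bij_int_decode)
  have sums: "(\<lambda>i. g (int_decode i)) sums s" if "(g has_sum s) UNIV" for g :: "int \<Rightarrow> complex" and s
    using has_sum_reindex_bij_betw[OF bij, of g s] that by (intro has_sum_imp_sums) simp
  have M': "(\<lambda>i. M (int_decode i)) summable_on UNIV"
    using summable_on_reindex_bij_betw[OF bij, of M] M by simp
  have "\<exists>g. \<forall>x\<in>S. (\<lambda>i. f (int_decode i) x) sums g x \<and> (g has_derivative F' x) (at x within S)"
  proof (rule has_derivative_series[OF S(1)])
    show "(f (int_decode i) has_derivative f' (int_decode i) x) (at x within S)" if "x \<in> S" for i x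
      using der[OF that] by (rule has_derivative_at_withinI)
    show "(\<lambda>i. f (int_decode i) z) sums F z" using sums[OF sum[OF S(3)]] .
    fix e :: real assume "e > 0"
    have summ: "summable (\<lambda>i. M (int_decode i))" by (rule summable_on_imp_summable[OF M'])
    have M_nonneg: "M n \<ge> 0" for n
      using order.trans[OF norm_ge_zero bound[OF S(3), of n 1]] by simp
    obtain N where N: "\<And>n. n \<ge> N \<Longrightarrow> norm (\<Sum>i. M (int_decode (i + n))) < e"
      using suminf_exist_split[OF \<open>e > 0\<close> summ] by blast
    show "\<forall>\<^sub>F n in sequentially. \<forall>x\<in>S. \<forall>v. norm ((\<Sum>i<n. f' (int_decode i) x v) - F' x v) \<le> e * norm v"
      using eventually_ge_at_top[of N]
    proof eventually_elim
      case (elim n)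
      show ?case
      proof (intro ballI allI)
        fix x v assume x: "x \<in> S"
        let ?g = "\<lambda>i. f' (int_decode i) x v"
        have g: "?g sums F' x v" using sums[OF sum'[OF x]] .
        have tail: "summable (\<lambda>i. M (int_decode (i + n)) * norm v)"
          by (intro summable_mult2 summable_ignore_initial_segment[OF summ, where k = n])
        have "F' x v - (\<Sum>i<n. ?g i) = (\<Sum>i. ?g (i + n))"
          using sums_unique[OF g] suminf_split_initial_segment[OF sums_summable[OF g], of n] by simp
        also have "norm \<dots> \<le> (\<Sum>i. M (int_decode (i + n)) * norm v)"
          by (rule norm_suminf_le[OF bound[OF x] tail])
        also have "\<dots> = (\<Sum>i. M (int_decode (i + n))) * norm v"
          by (rule suminf_mult2[symmetric, OF summable_ignore_initial_segment[OF summ]])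
        also have "\<dots> \<le> e * norm v"
          using N[OF elim] by (intro mult_right_mono) auto
        finally show "norm ((\<Sum>i<n. ?g i) - F' x v) \<le> e * norm v"
          by (simp add: norm_minus_commute)
      qed
    qed
  qed (rule S(3))
  then obtain g where g: "\<And>x. x \<in> S \<Longrightarrow> (\<lambda>i. f (int_decode i) x) sums g x"
      "\<And>x. x \<in> S \<Longrightarrow> (g has_derivative F' x) (at x within S)"
    by blast
  have "g x = F x" if "x \<in> S" for x
    using g(1)[OF that] sums[OF sum[OF that]] sums_unique2 by blast
  moreover have "(g has_derivative F' z) (at z)"
    using g(2)[OF S(3)] at_within_open[OF S(3,2)] by simp
  ultimately show ?thesis
    using has_derivative_transform_within_open[OF _ S(2,3)] by blast
qed

section \<open>The inverse of the component map\<close>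

context quasi_periodic_module
begin

definition gsum :: "(nat \<Rightarrow> real \<Rightarrow> complex) \<Rightarrow> complex \<Rightarrow> complex" where
  "gsum \<psi> z = (\<Sum>\<^sub>\<infinity>n. gsum_term \<psi> n z)"

lemma has_sum_gsum:
  assumes \<psi>: "\<psi> \<in> H_set p"
  shows "((\<lambda>n. gsum_term \<psi> n z) has_sum gsum \<psi> z) UNIV"
proof -
  obtain M where M: "M summable_on UNIV"
      "\<And>n y'. \<bar>y'\<bar> \<le> \<bar>Im z\<bar> \<Longrightarrow> norm (\<psi> (nat (n mod int p)) (y' + of_int n * \<rho>)) \<le> M n"
    using H_set_majorant[OF \<psi>, of "\<bar>Im z\<bar>"] by blast
  have "(\<lambda>n. norm (gsum_term \<psi> n z)) summable_on UNIV"
    by (rule summable_on_comparison_test[OF M(1)]) (auto simp: norm_gsum_term M(2))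
  then show ?thesis
    unfolding gsum_def by (rule has_sum_infsum[OF abs_summable_summable])
qed

definition mult_arg :: "(nat \<Rightarrow> real \<Rightarrow> complex) \<Rightarrow> nat \<Rightarrow> real \<Rightarrow> complex" where
  "mult_arg \<psi> r t = of_real t * \<psi> r t"

lemma mult_arg_H_set: "\<psi> \<in> H_set p \<Longrightarrow> mult_arg \<psi> \<in> H_set p"
  by (auto simp: H_set_def mult_arg_def[abs_def] schwartz_mult_arg)

lemma H_set_deriv:
  assumes "\<psi> \<in> H_set p"
  obtains \<psi>' where "\<psi>' \<in> H_set p" "\<And>r t. (\<psi> r has_vector_derivative \<psi>' r t) (at t)"
proof -
  have "\<exists>g\<in>schwartz. \<forall>t. (\<psi> r has_vector_derivative g t) (at t)" for r
    using schwartz_deriv[OF H_set_schwartz[OF assms]] by metis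
  then obtain d where d: "\<And>r. d r \<in> schwartz" "\<And>r t. (\<psi> r has_vector_derivative d r t) (at t)"
    by metis
  define \<psi>' where "\<psi>' r = (if r < p then d r else (\<lambda>_. 0))" for r
  have "\<psi>' \<in> H_set p" using d by (auto simp: H_set_def \<psi>'_def)
  moreover have "(\<psi> r has_vector_derivative \<psi>' r t) (at t)" for r t
    using assms d by (cases "r < p") (auto simp: \<psi>'_def H_set_def)
  ultimately show ?thesis using that by blast
qed

text \<open>The derivative of the \<open>n\<close>-th term along \<open>1\<close> is its multiple by \<open>2\<pi>in\<close>; writing \<open>n\<rho>\<close> as the argument
  \<open>y + n\<rho>\<close> minus \<open>y\<close> turns the factor \<open>n\<close> into multiplication by the argument, which acts on Schwartz functions.\<close>

lemma gsum_deriv: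
  assumes \<psi>: "\<psi> \<in> H_set p" and \<psi>': "\<psi>' \<in> H_set p" "\<And>r t. (\<psi> r has_vector_derivative \<psi>' r t) (at t)"
  shows "(gsum \<psi> has_derivative (\<lambda>v. of_real (Re v) * (2 * pi * \<i> / \<rho> *
      (gsum (mult_arg \<psi>) z - of_real (Im z) * gsum \<psi> z)) + of_real (Im v) * gsum \<psi>' z)) (at z)"
proof -
  \<comment> \<open>Any radius beyond |z| would do: on the ball |Im x| <= R, so the three majorants
    hold there with a common bound.\<close>
  define R where "R = norm z + 1"
  define f' where "f' n x v = of_real (Re v) * (2 * pi * \<i> / \<rho> *
      (gsum_term (mult_arg \<psi>) n x - of_real (Im x) * gsum_term \<psi> n x)) + of_real (Im v) * gsum_term \<psi>' n x" for n x v
  obtain M0 where M0: "M0 summable_on UNIV"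
      "\<And>n y'. \<bar>y'\<bar> \<le> R \<Longrightarrow> norm (\<psi> (nat (n mod int p)) (y' + of_int n * \<rho>)) \<le> M0 n"
    using H_set_majorant[OF \<psi>, of R] by blast
  obtain M1 where M1: "M1 summable_on UNIV"
      "\<And>n y'. \<bar>y'\<bar> \<le> R \<Longrightarrow> norm (mult_arg \<psi> (nat (n mod int p)) (y' + of_int n * \<rho>)) \<le> M1 n"
    using H_set_majorant[OF mult_arg_H_set[OF \<psi>], of R] by blast
  obtain M2 where M2: "M2 summable_on UNIV"
      "\<And>n y'. \<bar>y'\<bar> \<le> R \<Longrightarrow> norm (\<psi>' (nat (n mod int p)) (y' + of_int n * \<rho>)) \<le> M2 n"
    using H_set_majorant[OF \<psi>'(1), of R] by blast
  define M where "M n = 2 * pi / \<rho> * (M1 n + R * M0 n) + M2 n" for n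
  show ?thesis
  proof (rule has_derivative_has_sum_int[where S = "ball 0 R" and M = M and f = "gsum_term \<psi>" and f' = f'])
    show "M summable_on UNIV"
      unfolding M_def by (intro summable_on_add summable_on_cmult_right M0 M1 M2)
    show "((\<lambda>n. gsum_term \<psi> n x) has_sum gsum \<psi> x) UNIV" for x
      by (rule has_sum_gsum[OF \<psi>])
    show "((\<lambda>n. f' n x v) has_sum of_real (Re v) * (2 * pi * \<i> / \<rho> *
      (gsum (mult_arg \<psi>) x - of_real (Im x) * gsum \<psi> x)) + of_real (Im v) * gsum \<psi>' x) UNIV" for x v
    proof -
      have "((\<lambda>n. gsum_term (mult_arg \<psi>) n x + - (of_real (Im x) * gsum_term \<psi> n x)) has_sum
          gsum (mult_arg \<psi>) x + - (of_real (Im x) * gsum \<psi> x)) UNIV"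
        using has_sum_add[OF has_sum_gsum[OF mult_arg_H_set[OF \<psi>]]
            has_sum_cmult_right[OF has_sum_gsum[OF \<psi>], of "- of_real (Im x)" x], of x] by simp
      from has_sum_add[OF has_sum_cmult_right[OF has_sum_cmult_right[OF this]]
          has_sum_cmult_right[OF has_sum_gsum[OF \<psi>'(1)]]]
      show ?thesis unfolding f'_def diff_conv_add_uminus .
    qed
  next
    fix n and x v :: complex
    assume x: "x \<in> ball 0 R"
    then have Im: "\<bar>Im x\<bar> \<le> R" using abs_Im_le_cmod[of x] by simp
    have R: "R \<ge> 0" by (simp add: R_def)
    let ?a = "2 * pi * \<i> / \<rho> * (gsum_term (mult_arg \<psi>) n x - of_real (Im x) * gsum_term \<psi> n x)"
    have "norm (gsum_term (mult_arg \<psi>) n x - of_real (Im x) * gsum_term \<psi> n x) \<le> M1 n + R * M0 n"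
      by (rule order.trans[OF norm_triangle_ineq4])
        (use Im M0(2)[OF Im] M1(2)[OF Im] R in \<open>auto simp: norm_mult norm_gsum_term intro!: add_mono mult_mono\<close>)
    then have a: "norm ?a \<le> 2 * pi / \<rho> * (M1 n + R * M0 n)"
      unfolding norm_mult by (intro mult_mono) (use \<rho>_pos in \<open>auto simp: norm_divide norm_mult\<close>)
    have "norm (f' n x v) \<le> \<bar>Re v\<bar> * norm ?a + \<bar>Im v\<bar> * norm (gsum_term \<psi>' n x)"
      unfolding f'_def by (rule order.trans[OF norm_triangle_ineq]) (simp only: norm_mult norm_of_real order.refl)
    also have "\<dots> \<le> norm v * (2 * pi / \<rho> * (M1 n + R * M0 n)) + norm v * M2 n"
      using a M2(2)[OF Im] by (intro add_mono mult_mono abs_Re_le_cmod abs_Im_le_cmod) (auto simp: norm_gsum_term)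
    finally show "norm (f' n x v) \<le> M n * norm v"
      by (simp add: M_def algebra_simps)
  next
    fix n and x :: complex
    let ?c = "cis (pi * (of_int n)\<^sup>2 * (Re \<tau> / real p))" and ?r = "nat (n mod int p)" and ?y = "Im x + of_int n * (Im \<tau> / real p)"
    have L: "bounded_linear (\<lambda>x. 2 * pi * of_int n * Re x)"
      by (intro bounded_linear_const_mult bounded_linear_Re)
    have 1: "((\<lambda>x. cis (2 * pi * of_int n * Re x) * ?c) has_derivative
        (\<lambda>v. (2 * pi * of_int n * Re v) *\<^sub>R (\<i> * cis (2 * pi * of_int n * Re x)) * ?c)) (at x)"
      by (intro has_derivative_mult_left has_derivative_cis bounded_linear_imp_has_derivative[OF L])
    have "((\<lambda>x. Im x + of_int n * (Im \<tau> / real p)) has_derivative Im) (at x)"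
      by (auto intro!: derivative_eq_intros bounded_linear_imp_has_derivative bounded_linear_Im)
    from has_derivative_compose[OF this \<psi>'(2)[of ?r ?y, unfolded has_vector_derivative_def]]
    have 2: "((\<lambda>x. \<psi> ?r (Im x + of_int n * (Im \<tau> / real p))) has_derivative (\<lambda>v. Im v *\<^sub>R \<psi>' ?r ?y)) (at x)" .
    have "\<rho> \<noteq> 0" using \<rho>_pos by simp
    then have n: "complex_of_real (2 * pi * of_int n) * w = 2 * pi / \<rho> * (of_real ?y * w - of_real (Im x) * w)" for w :: complex
      by (simp add: \<rho>_def[symmetric] field_simps)
    have "(cis (2 * pi * of_int n * Re x) * ?c) * (Im v *\<^sub>R \<psi>' ?r ?y) +
        (2 * pi * of_int n * Re v) *\<^sub>R (\<i> * cis (2 * pi * of_int n * Re x)) * ?c * \<psi> ?r ?y = f' n x v" for v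
    proof -
      have "(2 * pi * of_int n * Re v) *\<^sub>R (\<i> * cis (2 * pi * of_int n * Re x)) * ?c * \<psi> ?r ?y =
        of_real (Re v) * \<i> * (complex_of_real (2 * pi * of_int n) * gsum_term \<psi> n x)"
        by (simp add: gsum_term_def scaleR_conv_of_real mult_ac)
      also have "\<dots> = of_real (Re v) * (2 * pi * \<i> / \<rho> * (gsum_term (mult_arg \<psi>) n x - of_real (Im x) * gsum_term \<psi> n x))"
      proof -
        have 1: "gsum_term (mult_arg \<psi>) n x = of_real ?y * gsum_term \<psi> n x"
          by (simp only: gsum_term_def mult_arg_def mult_ac)
        have 2: "a * \<i> * (2 * pi / \<rho> * X) = a * (2 * pi * \<i> / \<rho> * X)" for a X :: complex
          by simp
        show ?thesis unfolding n 1 by (rule 2)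
      qed
      finally show ?thesis
        by (simp add: f'_def gsum_term_def scaleR_conv_of_real mult_ac)
    qed
    then show "(gsum_term \<psi> n has_derivative f' n x) (at x)"
      using has_derivative_mult[OF 1 2] unfolding gsum_term_def[abs_def] by simp
  qed (auto simp: R_def)
qed

text \<open>The derivative of a \<open>gsum\<close> is built from Im z and \<open>gsum\<close>s of
  other elements of \<open>H_set\<close>, so the induction on k runs over all elements
  simultaneously.\<close>

lemma smooth_gsum: "\<psi> \<in> H_set p \<Longrightarrow> smooth (gsum \<psi>)"
proof -
  have "C_k k (gsum \<psi>)" if "\<psi> \<in> H_set p" for k \<psi>
    using that
  proof (induction k arbitrary: \<psi>)
    case 0
    then obtain \<psi>' where "\<psi>' \<in> H_set p" "\<And>r t. (\<psi> r has_vector_derivative \<psi>' r t) (at t)"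
      using H_set_deriv by blast
    then have "isCont (gsum \<psi>) z" for z
      using gsum_deriv[OF 0] has_derivative_continuous by blast
    then show ?case by (simp add: continuous_at_imp_continuous_on)
  next
    case (Suc k)
    then obtain \<psi>' where \<psi>': "\<psi>' \<in> H_set p" "\<And>r t. (\<psi> r has_vector_derivative \<psi>' r t) (at t)"
      using H_set_deriv by blast
    have Im: "C_k k (\<lambda>z. complex_of_real (Im z))"
      by (intro C_k_compose_linear[OF bounded_linear_of_real] C_k_bounded_linear bounded_linear_Im)
    have diff: "C_k k (\<lambda>z. gsum (mult_arg \<psi>) z - of_real (Im z) * gsum \<psi> z)"
      using C_k_add[OF Suc.IH[OF mult_arg_H_set[OF Suc.prems]]
          C_k_mult[OF C_k_const[of k "-1"] C_k_mult[OF Im Suc.IH[OF Suc.prems]]]] by simp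
    show ?case
      by (rule C_k_SucI[OF gsum_deriv[OF Suc.prems \<psi>']])
        (intro C_k_add C_k_mult[OF C_k_const] diff Suc.IH \<psi>')
  qed
  then show "\<psi> \<in> H_set p \<Longrightarrow> smooth (gsum \<psi>)" by (simp add: smooth_def)
qed

text \<open>Translation by \<tau> carries the n-th term to a multiple of the (n + p)-th, with the
  same component since the residue is unchanged; reindexing the sum finishes.\<close>

lemma gsum_F_set:
  assumes \<psi>: "\<psi> \<in> H_set p"
  shows "gsum \<psi> \<in> F_set \<tau> p"
proof -
  have "gsum_term \<psi> n (z + 1) = gsum_term \<psi> n z" for n z
    using fchar_1[of n] fchar_add_arg[of n "Re z" 1] by (simp add: gsum_term_def fchar_def)
  then have "gsum \<psi> (z + 1) = gsum \<psi> z" for z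
    by (simp add: gsum_def)
  moreover have "gsum \<psi> (z + \<tau>) = cis (- (pi * real p * (Re \<tau> + 2 * Re z))) * gsum \<psi> z" for z
  proof -
    let ?e = "cis (- (pi * real p * (Re \<tau> + 2 * Re z)))"
    have "gsum_term \<psi> n (z + \<tau>) = ?e * gsum_term \<psi> (n + int p) z" for n
    proof -
      have 1: "Im z + of_int (n + int p) * (Im \<tau> / real p) = Im (z + \<tau>) + of_int n * (Im \<tau> / real p)"
        using p_pos by (simp add: field_simps)
      have 2: "cis (2 * pi * of_int n * Re (z + \<tau>)) * cis (pi * (of_int n)\<^sup>2 * (Re \<tau> / real p)) =
          ?e * (cis (2 * pi * of_int (n + int p) * Re z) * cis (pi * (of_int (n + int p))\<^sup>2 * (Re \<tau> / real p)))"
        unfolding cis_mult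
        by (rule arg_cong[where f = cis]) (use p_pos in \<open>simp add: field_simps power2_eq_square\<close>)
      show ?thesis unfolding gsum_term_def 1 2 by (simp add: mult_ac)
    qed
    moreover have "((\<lambda>n. gsum_term \<psi> (n + int p) z) has_sum gsum \<psi> z) UNIV"
      by (subst has_sum_reindex_bij_betw[where g = "\<lambda>n. n + int p" and B = UNIV, of UNIV "\<lambda>n. gsum_term \<psi> n z"])
        (auto intro: has_sum_gsum[OF \<psi>] bij_betwI[where g = "\<lambda>n. n - int p"])
    ultimately have "((\<lambda>n. gsum_term \<psi> n (z + \<tau>)) has_sum (?e * gsum \<psi> z)) UNIV"
      by (simp add: has_sum_cmult_right)
    then show ?thesis using has_sum_gsum[OF \<psi>] has_sum_unique by blast
  qed
  ultimately show ?thesis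
    using smooth_gsum[OF \<psi>] by (simp add: F_set_def)
qed

lemma components_gsum: "\<psi> \<in> H_set p \<Longrightarrow> components (gsum \<psi>) = \<psi>"
  using components_unique[of \<psi> "gsum \<psi>"] has_sum_gsum by (simp add: expansion_gsum)

lemma gsum_components:
  assumes f: "f \<in> F_set \<tau> p"
  shows "gsum (components f) = f"
proof
  show "gsum (components f) z = f z" for z
    using has_sum_gsum[OF components_H_set[OF f], of z] expansion_components[OF f] has_sum_unique
    unfolding expansion_gsum by blast
qed

lemma bij_components: "bij_betw components (F_set \<tau> p) (H_set p)"
  by (rule bij_betwI[where g = gsum])
    (auto simp: components_H_set gsum_F_set components_gsum gsum_components)

end

section \<open>The module action\<close>

lemma Cinf_torus_const: "(\<lambda>_. c) \<in> Cinf_torus \<tau>"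
  by (simp add: Cinf_torus_iff smooth_const)

lemma Cinf_torus_add: "a \<in> Cinf_torus \<tau> \<Longrightarrow> b \<in> Cinf_torus \<tau> \<Longrightarrow> (\<lambda>z. a z + b z) \<in> Cinf_torus \<tau>"
  by (auto simp: Cinf_torus_iff smooth_add)

lemma Cinf_torus_mult: "a \<in> Cinf_torus \<tau> \<Longrightarrow> b \<in> Cinf_torus \<tau> \<Longrightarrow> (\<lambda>z. a z * b z) \<in> Cinf_torus \<tau>"
  by (auto simp: Cinf_torus_iff smooth_mult)

lemma Cinf_torus_cnj: "a \<in> Cinf_torus \<tau> \<Longrightarrow> (\<lambda>z. cnj (a z)) \<in> Cinf_torus \<tau>"
  by (auto simp: Cinf_torus_iff smooth_compose_linear[OF bounded_linear_cnj])

context quasi_periodic_module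
begin

lemma F_set_add: "f \<in> F_set \<tau> p \<Longrightarrow> g \<in> F_set \<tau> p \<Longrightarrow> (\<lambda>z. f z + g z) \<in> F_set \<tau> p"
  by (auto simp: F_set_def smooth_add distrib_left)

lemma F_set_zero: "(\<lambda>_. 0) \<in> F_set \<tau> p"
  by (simp add: F_set_def smooth_const)

lemma F_set_mult: "f \<in> F_set \<tau> p \<Longrightarrow> a \<in> Cinf_torus \<tau> \<Longrightarrow> (\<lambda>z. f z * a z) \<in> F_set \<tau> p"
  by (auto simp: F_set_def Cinf_torus_iff smooth_mult mult.assoc)

text \<open>The multiplier has modulus 1, so it cancels against its conjugate and leaves a doubly
  periodic function.\<close>

lemma F_set_cnj_mult:
  assumes f: "f \<in> F_set \<tau> p" and g: "g \<in> F_set \<tau> p"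
  shows "(\<lambda>z. cnj (f z) * g z) \<in> Cinf_torus \<tau>"
proof -
  have "cnj (cis a * w) * (cis a * w') = cnj w * w'" for a w w'
  proof -
    have "cnj (cis a * w) * (cis a * w') = (cnj (cis a) * cis a) * (cnj w * w')"
      by simp
    then show ?thesis by (simp add: cis_cnj cis_mult)
  qed
  then show ?thesis
    using F_setD[OF f] F_setD[OF g]
    by (auto simp only: Cinf_torus_iff intro!: smooth_mult smooth_compose_linear[OF bounded_linear_cnj])
qed

lemma components_add:
  assumes f: "f \<in> F_set \<tau> p" and g: "g \<in> F_set \<tau> p"
  shows "components (\<lambda>z. f z + g z) = (\<lambda>r t. components f r t + components g r t)"
proof -
  have "lcoef 1 (\<lambda>z. f z + g z) n z = lcoef 1 f n z + lcoef 1 g n z" for n z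
    unfolding lcoef_def by (intro fcoef_add smooth_continuous_line F_setD(1)[OF f] F_setD(1)[OF g])
  then show ?thesis by (auto simp: fun_eq_iff components_def component_def distrib_left)
qed

lemma components_cmult: "components (\<lambda>z. f z * c) = (\<lambda>r t. c * components f r t)"
proof -
  have "lcoef 1 (\<lambda>z. f z * c) n z = c * lcoef 1 f n z" for n z
    unfolding lcoef_def fcoef_cmult[symmetric] by (simp add: mult.commute)
  then show ?thesis by (auto simp: fun_eq_iff components_def component_def)
qed

lemma components_zero: "components (\<lambda>_. 0) = (\<lambda>_ _. 0)"
  using components_cmult[of "\<lambda>_. 0" 0] by simp

lemma F_set_torus_uv: "f \<in> F_set \<tau> p \<Longrightarrow> (\<lambda>z. f z * torus_uv \<tau> m n z) \<in> F_set \<tau> p"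
  by (intro F_set_mult torus_uv_Cinf Im_neq)

text \<open>The index drops from n to n - m while the base point stays put. Rewriting the result
  through the (n - m)-th component leaves a translation by m \<rho> and the difference of the two
  quadratic phases.\<close>

lemma component_mult_torus_uv:
  "component (\<lambda>z. f z * torus_uv \<tau> m k z) n t =
    cis (pi * ((of_int (n - m))\<^sup>2 - (of_int n)\<^sup>2) * (Re \<tau> / real p)) *
    torus_uv \<tau> m k (of_real (t - of_int n * \<rho>) * \<i>) * component f (n - m) (t - of_int m * \<rho>)"
proof -
  let ?A = "cis (pi * ((of_int (n - m))\<^sup>2 - (of_int n)\<^sup>2) * (Re \<tau> / real p))"
    and ?B = "cis (- (pi * (of_int (n - m))\<^sup>2 * (Re \<tau> / real p)))"
    and ?C = "cis (- (pi * (of_int n)\<^sup>2 * (Re \<tau> / real p)))"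
    and ?u = "torus_uv \<tau> m k (of_real (t - of_int n * \<rho>) * \<i>)"
    and ?L = "lcoef 1 f (n - m) (of_real (t - of_int n * \<rho>) * \<i>)"
  have phase: "?C = ?A * ?B"
    by (simp add: cis_mult algebra_simps)
  have arg: "t - of_int m * \<rho> - of_int (n - m) * \<rho> = t - of_int n * \<rho>"
    by (simp add: algebra_simps)
  have "?C * (?u * ?L) = ?A * ?u * (?B * ?L)"
    unfolding phase by (simp only: mult_ac)
  then show ?thesis unfolding component_def lcoef_mult_torus_uv arg .
qed

lemma components_torus_u:
  assumes f: "f \<in> F_set \<tau> p"
  shows "op_u \<tau> p (components f) = components (\<lambda>z. f z * torus_uv \<tau> 1 0 z)"
proof (rule ext, rule ext)
  fix n t
  show "op_u \<tau> p (components f) n t = components (\<lambda>z. f z * torus_uv \<tau> 1 0 z) n t"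
  proof (cases "n < p")
    case True
    have "op_u \<tau> p (components f) n t =
        weyl \<rho> (- (Re \<tau> / Im \<tau>)) (components f (nat ((int n - 1) mod int p))) t"
      unfolding op_u_def tensor_op_def \<rho>_def
      using shift_apply[OF True, of "\<lambda>k. weyl \<rho> (- (Re \<tau> / Im \<tau>)) (components f k) t"] True
      by (simp add: \<rho>_def)
    also have "\<dots> = cis (pi * \<rho> * (Re \<tau> / Im \<tau>)) * cis (- (2 * pi * (Re \<tau> / Im \<tau>) * t)) * component f (int n - 1) (t - \<rho>)"
      by (simp only: weyl_def components_mod[OF f]) simp
    \<comment> \<open>In (n - 1)^2 - n^2 = 1 - 2n the part -2n cancels against the shift n \<rho>
      inside u; the remaining 1 is the Weyl phase -pi a b with a = \<rho> and b = -Re \<tau> / Im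
      \<tau>.\<close>
    also have "cis (pi * \<rho> * (Re \<tau> / Im \<tau>)) * cis (- (2 * pi * (Re \<tau> / Im \<tau>) * t)) =
       cis (pi * ((of_int (int n - 1))\<^sup>2 - (of_int (int n))\<^sup>2) * (Re \<tau> / real p)) *
       torus_uv \<tau> 1 0 (of_real (t - of_int (int n) * \<rho>) * \<i>)"
    proof -
      have "torus_uv \<tau> 1 0 (of_real X * \<i>) = cis (2 * pi * (- (Re \<tau> / Im \<tau>) * X))" for X
        by (simp add: torus_uv_fchar fchar_def)
      then show ?thesis
        unfolding cis_mult \<rho>_def
        by (simp only: cis_mult, intro arg_cong[where f = cis])
          (use p_pos Im_neq in \<open>simp add: field_simps power2_eq_square\<close>)
    qed
    also have "\<dots> * component f (int n - 1) (t - \<rho>) = component (\<lambda>z. f z * torus_uv \<tau> 1 0 z) (int n) t"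
      by (simp add: component_mult_torus_uv)
    finally show ?thesis
      using True unfolding components_def[of "\<lambda>z. f z * torus_uv \<tau> 1 0 z"] by simp
  qed (simp add: op_u_def tensor_op_def components_def)
qed

lemma components_torus_v:
  assumes f: "f \<in> F_set \<tau> p"
  shows "op_v \<tau> p (components f) = components (\<lambda>z. f z * torus_uv \<tau> 0 1 z)"
proof (rule ext, rule ext)
  fix n t
  show "op_v \<tau> p (components f) n t = components (\<lambda>z. f z * torus_uv \<tau> 0 1 z) n t"
  proof (cases "n < p")
    case True
    let ?w = "\<lambda>k. weyl 0 (1 / Im \<tau>) (components f k) t"
    have "adjoint_mat (clock p) n k * ?w k = (if n = k then cis (- (2 * pi * real n / real p)) * ?w k else 0)" for k
      by (simp add: adjoint_mat_def clock_def cis_cnj)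
    then have "op_v \<tau> p (components f) n t = (\<Sum>k<p. if n = k then cis (- (2 * pi * real n / real p)) * ?w k else 0)"
      using True by (simp only: op_v_def tensor_op_def if_True)
    also have "\<dots> = cis (- (2 * pi * real n / real p)) * ?w n"
      using True by simp
    also have "\<dots> = torus_uv \<tau> 0 1 (of_real (t - of_int (int n) * \<rho>) * \<i>) * component f (int n) t"
    proof -
      \<comment> \<open>The clock phase comes from the base point: v is evaluated at height t - n
        \<rho>, and n \<rho> / Im \<tau> = n / p.\<close>
      have "cis (- (2 * pi * real n / real p)) * cis (2 * pi * (1 / Im \<tau>) * t) = fchar 1 ((t - real n * \<rho>) / Im \<tau>)"
        unfolding fchar_def cis_mult \<rho>_def
        by (rule arg_cong[where f = cis]) (use p_pos Im_neq in \<open>simp add: field_simps\<close>)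
      then show ?thesis
        using True by (simp add: weyl_def components_def torus_uv_fchar flip: mult.assoc)
    qed
    finally show ?thesis
      using True by (simp add: components_def component_mult_torus_uv)
  qed (simp add: op_v_def tensor_op_def components_def)
qed

lemma components_inj: "inj_on components (F_set \<tau> p)"
  using bij_components by (simp add: bij_betw_def)

lemma H_set_eq: "H_set p = components ` F_set \<tau> p"
  using bij_components by (simp add: bij_betw_def)

text \<open>\<open>W\<close> abstracts the powers of u or of v. The identity W 1 * W (-1) = 1 and
  injectivity of \<open>components\<close> make \<open>T\<close> injective on \<open>H_set\<close>,
  so \<open>inv_into\<close> is multiplication by W (-1).\<close>

lemma op_powi_components:
  assumes T: "\<And>f. f \<in> F_set \<tau> p \<Longrightarrow> T (components f) = components (\<lambda>z. f z * W 1 z)"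
    and W: "\<And>m f. f \<in> F_set \<tau> p \<Longrightarrow> (\<lambda>z. f z * W m z) \<in> F_set \<tau> p"
    and W0: "\<And>z. W 0 z = 1" and Wadd: "\<And>m n z. W m z * W n z = W (m + n) z"
    and f: "f \<in> F_set \<tau> p"
  shows "op_powi (H_set p) T m (components f) = components (\<lambda>z. f z * W m z)"
proof -
  have pos: "(T ^^ k) (components f) = components (\<lambda>z. f z * W (int k) z)" for k
  proof (induction k)
    case (Suc k)
    then show ?case
      using T[OF W[OF f, of "int k"]] by (simp add: mult.assoc Wadd add.commute)
  qed (simp add: W0)
  have inv: "inv_into (H_set p) T (components g) = components (\<lambda>z. g z * W (- 1) z)" if g: "g \<in> F_set \<tau> p" for g
  proof (rule inv_into_f_eq)
    show "T (components (\<lambda>z. g z * W (- 1) z)) = components g"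
      using T[OF W[OF g, of "- 1"]] by (simp add: mult.assoc Wadd W0)
    show "components (\<lambda>z. g z * W (- 1) z) \<in> H_set p"
      by (intro components_H_set W g)
    show "inj_on T (H_set p)"
    proof (rule inj_onI)
      fix \<psi> \<eta> assume "\<psi> \<in> H_set p" "\<eta> \<in> H_set p" and eq: "T \<psi> = T \<eta>"
      then obtain h k where h: "h \<in> F_set \<tau> p" "\<psi> = components h" and k: "k \<in> F_set \<tau> p" "\<eta> = components k"
        unfolding H_set_eq by blast
      then have "components (\<lambda>z. h z * W 1 z) = components (\<lambda>z. k z * W 1 z)"
        using eq T by simp
      then have "(\<lambda>z. h z * W 1 z) = (\<lambda>z. k z * W 1 z)"
        by (rule inj_onD[OF components_inj _ W[OF h(1)] W[OF k(1)]])
      then have "h z * W 1 z * W (- 1) z = k z * W 1 z * W (- 1) z" for z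
        by metis
      then have "h = k" by (simp add: mult.assoc Wadd W0 fun_eq_iff)
      then show "\<psi> = \<eta>" using h k by simp
    qed
  qed
  have neg: "(inv_into (H_set p) T ^^ k) (components f) = components (\<lambda>z. f z * W (- int k) z)" for k
  proof (induction k)
    case (Suc k)
    then show ?case
      using inv[OF W[OF f, of "- int k"]] by (simp add: mult.assoc Wadd minus_diff_commute[of 1])
  qed (simp add: W0)
  show ?thesis
    using pos[of "nat m"] neg[of "nat (- m)"] by (simp add: op_powi_def)
qed

lemma act_uv_components:
  assumes f: "f \<in> F_set \<tau> p"
  shows "act_uv \<tau> p (components f) m n = components (\<lambda>z. f z * torus_uv \<tau> m n z)"
proof -
  have "op_powi (H_set p) (op_u \<tau> p) m (components f) = components (\<lambda>z. f z * torus_uv \<tau> m 0 z)"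
    by (rule op_powi_components) (simp_all add: components_torus_u F_set_torus_uv torus_uv_add f)
  moreover have "op_powi (H_set p) (op_v \<tau> p) n (components g) = components (\<lambda>z. g z * torus_uv \<tau> 0 n z)"
    if "g \<in> F_set \<tau> p" for g
    by (rule op_powi_components) (simp_all add: components_torus_v F_set_torus_uv torus_uv_add that)
  ultimately show ?thesis
    by (simp add: act_uv_def F_set_torus_uv f mult.assoc torus_uv_add)
qed

text \<open>A component is a one-dimensional integral over a unit segment, on which f is bounded.
  The absolutely summable torus coefficients then justify integrating the series of \<open>a\<close>
  term by term.\<close>

lemma act_has_sum:
  assumes f: "f \<in> F_set \<tau> p" and a: "a \<in> Cinf_torus \<tau>"
  shows "((\<lambda>(m, n). torus_coeff \<tau> a (m, n) * act_uv \<tau> p (components f) m n r t) has_sum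
    components (\<lambda>z. f z * a z) r t) UNIV"
proof (cases "r < p")
  case False
  then show ?thesis by (simp add: act_uv_components[OF f] components_def case_prod_unfold)
next
  case True
  let ?z = "of_real (t - of_int (int r) * \<rho>) * \<i>" and ?c = "cis (- (pi * (of_int (int r))\<^sup>2 * (Re \<tau> / real p)))"
  let ?G = "\<lambda>x z. tcoef \<tau> a (fst x) (snd x) 0 * (f z * torus_uv \<tau> (fst x) (snd x) z)"
  have summ: "(\<lambda>x. norm (case x of (m, n) \<Rightarrow> tcoef \<tau> a m n 0)) summable_on UNIV"
    by (rule summable_rapidly_decreasing[OF tcoef_rapidly_decreasing[OF a Im_neq]])
  have "compact ((\<lambda>s. f (?z + of_real s * 1)) ` {0..1})"
    by (intro compact_continuous_image smooth_continuous_line F_setD[OF f] compact_Icc)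
  from compact_imp_bounded[OF this] obtain B where "\<forall>y\<in>(\<lambda>s. f (?z + of_real s * 1)) ` {0..1}. norm y \<le> B"
    unfolding bounded_iff ..
  then have B: "norm (f (?z + of_real s * 1)) \<le> B" if "s \<in> {0..1}" for s
    using that by blast
  have "((\<lambda>x. lcoef 1 (?G x) (int r) ?z) has_sum lcoef 1 (\<lambda>z. f z * a z) (int r) ?z) UNIV"
  proof (rule has_sum_lcoef[where M = "\<lambda>x. norm (case x of (m, n) \<Rightarrow> tcoef \<tau> a m n 0) * B"])
    show "smooth (?G x)" for x
      by (intro smooth_mult smooth_const smooth_torus_uv F_setD[OF f])
    show "norm (?G x (?z + of_real s * 1)) \<le> norm (case x of (m, n) \<Rightarrow> tcoef \<tau> a m n 0) * B" if "s \<in> {0..1}" for x s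
      using B[OF that] by (simp add: norm_mult case_prod_unfold mult_left_mono)
    show "(\<lambda>x. norm (case x of (m, n) \<Rightarrow> tcoef \<tau> a m n 0) * B) summable_on UNIV"
      by (rule summable_on_cmult_left[OF summ])
    show "((\<lambda>x. ?G x z) has_sum f z * a z) UNIV" for z
      using has_sum_cmult_right[OF torus_expansion[OF a Im_neq, of z], of "f z"]
      by (simp add: case_prod_unfold mult_ac)
  qed
  moreover have "lcoef 1 (?G x) (int r) ?z =
      tcoef \<tau> a (fst x) (snd x) 0 * lcoef 1 (\<lambda>z. f z * torus_uv \<tau> (fst x) (snd x) z) (int r) ?z" for x
    unfolding lcoef_def by (rule fcoef_cmult)
  ultimately have "((\<lambda>x. ?c * (tcoef \<tau> a (fst x) (snd x) 0 * lcoef 1 (\<lambda>z. f z * torus_uv \<tau> (fst x) (snd x) z) (int r) ?z))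
      has_sum ?c * lcoef 1 (\<lambda>z. f z * a z) (int r) ?z) UNIV"
    by (simp only: has_sum_cmult_right)
  moreover have "?c * (tcoef \<tau> a m n 0 * lcoef 1 (\<lambda>z. f z * torus_uv \<tau> m n z) (int r) ?z) =
      torus_coeff \<tau> a (m, n) * act_uv \<tau> p (components f) m n r t" for m n
    unfolding torus_coeff_eq[OF a Im_neq] act_uv_components[OF f]
    using True by (simp add: components_def component_def)
  ultimately show ?thesis
    using True by (simp add: components_def component_def case_prod_unfold)
qed

lemma act_components:
  assumes "f \<in> F_set \<tau> p" "a \<in> Cinf_torus \<tau>"
  shows "act \<tau> p (components f) a = components (\<lambda>z. f z * a z)"
  unfolding act_def using infsumI[OF act_has_sum[OF assms]] by blast

end

section \<open>The Hermitian structure\<close>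

text \<open>Only h is expanded. Integrating its Fourier series against cnj f termwise turns each
  character into the conjugate coefficient of f.\<close>

lemma parseval:
  assumes f: "smooth f" and h: "smooth h" "\<And>z. h (z + 1) = h z"
  shows "((\<lambda>n. cnj (lcoef 1 f n z) * lcoef 1 h n z) has_sum lcoef 1 (\<lambda>z. cnj (f z) * h z) 0 z) UNIV"
proof -
  have "compact ((\<lambda>s. f (z + of_real s * 1)) ` {0..1})"
    by (intro compact_continuous_image smooth_continuous_line f compact_Icc)
  from compact_imp_bounded[OF this] obtain B where "\<forall>y\<in>(\<lambda>s. f (z + of_real s * 1)) ` {0..1}. norm y \<le> B"
    unfolding bounded_iff ..
  then have B: "norm (f (z + of_real s * 1)) \<le> B" if "s \<in> {0..1}" for s
    using that by blast
  let ?g = "\<lambda>n s. cnj (f (z + of_real s * 1)) * (lcoef 1 h n z * fchar n s) * fchar (- 0) s"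
  have "((\<lambda>n. integral {0..1} (?g n)) has_sum lcoef 1 (\<lambda>z. cnj (f z) * h z) 0 z) UNIV"
    unfolding lcoef_def fcoef_def[of _ 0]
  proof (rule has_sum_integral[where M = "\<lambda>n. B * norm (lcoef 1 h n z)", unfolded lcoef_def])
    show "continuous_on {0..1} (\<lambda>s. cnj (f (z + of_real s * 1)) * (fcoef (\<lambda>s. h (z + of_real s * 1)) n * fchar n s) * fchar (- 0) s)" for n
      by (intro continuous_intros smooth_continuous_line f)
    show "norm (cnj (f (z + of_real s * 1)) * (fcoef (\<lambda>s. h (z + of_real s * 1)) n * fchar n s) * fchar (- 0) s)
      \<le> B * norm (fcoef (\<lambda>s. h (z + of_real s * 1)) n)" if "s \<in> {0..1}" for n s
      using B[OF that] by (simp add: norm_mult mult_right_mono)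
    show "(\<lambda>n. B * norm (fcoef (\<lambda>s. h (z + of_real s * 1)) n)) summable_on UNIV"
      using summable_on_cmult_right[OF lcoef_abs_summable[OF h]] by (simp only: lcoef_def)
    fix s :: real
    have "((\<lambda>n. fchar n s * lcoef 1 h n z) has_sum h (z + of_real s * 1)) UNIV"
      using lcoef_inversion[OF h, of "z + of_real s * 1"] lcoef_translate[OF h] by simp
    then show "((\<lambda>n. cnj (f (z + of_real s * 1)) * (fcoef (\<lambda>s. h (z + of_real s * 1)) n * fchar n s) * fchar (- 0) s)
        has_sum cnj (f (z + of_real s * 1)) * h (z + of_real s * 1) * fchar (- 0) s) UNIV"
      by (intro has_sum_cmult_left has_sum_cmult_right) (simp only: lcoef_def mult.commute)
  qed
  moreover have "integral {0..1} (?g n) = cnj (lcoef 1 f n z) * lcoef 1 h n z" for n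
  proof -
    have "integral {0..1} (?g n) = integral {0..1} (\<lambda>s. cnj (f (z + of_real s * 1) * fchar (- n) s) * lcoef 1 h n z)"
      by (rule integral_cong) (simp add: cnj_fchar mult_ac)
    also have "\<dots> = cnj (lcoef 1 f n z) * lcoef 1 h n z"
      by (simp add: integral_cnj lcoef_def[of _ f] fcoef_def)
    finally show ?thesis .
  qed
  ultimately show ?thesis by simp
qed

text \<open>The intervals tile the line, so symmetric partial sums are integrals over growing
  windows and converge by dominated convergence. Assumed summability turns this limit into the
  unconditional sum.\<close>

lemma integral_unfold:
  fixes k :: "real \<Rightarrow> complex"
  assumes k: "continuous_on UNIV k" "integrable lborel k" and "w > 0"
    and summ: "(\<lambda>j::int. integral {c + of_int j * w..c + of_int j * w + w} k) summable_on UNIV"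
  shows "((\<lambda>j::int. integral {c + of_int j * w..c + of_int j * w + w} k) has_sum (LINT t|lborel. k t)) UNIV"
proof -
  let ?I = "\<lambda>j::int. integral {c + of_int j * w..c + of_int j * w + w} k"
  obtain S where S: "(?I has_sum S) UNIV" using summ summable_on_def by blast
  have int: "k integrable_on {a..b}" for a b
    by (intro integrable_continuous_interval continuous_on_subset[OF k(1)]) auto
  have part: "(\<Sum>j = - int N..int N. ?I j) = integral {c - real N * w..c + real N * w + w} k" for N
  proof (induction N)
    case (Suc N)
    have eq: "{- int (Suc N)..int (Suc N)} = insert (- int (Suc N)) (insert (int (Suc N)) {- int N..int N})"
      by auto
    have "(\<Sum>j = - int (Suc N)..int (Suc N). ?I j) = ?I (- int (Suc N)) + (?I (int (Suc N)) + (\<Sum>j = - int N..int N. ?I j))"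
      by (subst eq, subst sum.insert) (auto simp: sum.insert)
    also have "?I (- int (Suc N)) = integral {c - real (Suc N) * w..c - real N * w} k"
      by (simp add: algebra_simps)
    also have "?I (int (Suc N)) = integral {c + real N * w + w..c + real (Suc N) * w + w} k"
      by (simp add: algebra_simps)
    also have "integral {c + real N * w + w..c + real (Suc N) * w + w} k + (\<Sum>j = - int N..int N. ?I j) =
        integral {c - real N * w..c + real (Suc N) * w + w} k"
      unfolding Suc.IH
      using Henstock_Kurzweil_Integration.integral_combine[of "c - real N * w" "c + real N * w + w" "c + real (Suc N) * w + w" k] int \<open>w > 0\<close>
      by (simp add: algebra_simps)
    also have "integral {c - real (Suc N) * w..c - real N * w} k + \<dots> =
        integral {c - real (Suc N) * w..c + real (Suc N) * w + w} k"
      using Henstock_Kurzweil_Integration.integral_combine[of "c - real (Suc N) * w" "c - real N * w" "c + real (Suc N) * w + w" k] int \<open>w > 0\<close>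
      by (simp add: algebra_simps)
    finally show ?case .
  qed simp
  let ?A = "\<lambda>N. {c - real N * w..c + real N * w + w}"
  have "(\<lambda>N. LINT t|lborel. indicator (?A N) t *\<^sub>R k t) \<longlonglongrightarrow> (LINT t|lborel. k t)"
  proof (rule integral_dominated_convergence[where w = "\<lambda>t. norm (k t)"])
    show "AE t in lborel. (\<lambda>N. indicator (?A N) t *\<^sub>R k t) \<longlonglongrightarrow> k t"
    proof (rule AE_I2)
      fix t :: real
      obtain N0 where N0: "\<bar>t - c\<bar> / w \<le> real N0" using real_arch_simple by blast
      then have t: "\<bar>t - c\<bar> \<le> real N0 * w" using \<open>w > 0\<close> by (simp add: field_simps)
      have "t \<in> ?A N" if "N \<ge> N0" for N
      proof -
        have "real N0 * w \<le> real N * w" using that \<open>w > 0\<close> by simp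
        then have "t - c \<le> real N * w" "c - t \<le> real N * w" using t by linarith+
        then show ?thesis using \<open>w > 0\<close> by simp
      qed
      then have "\<forall>\<^sub>F N in sequentially. indicator (?A N) t *\<^sub>R k t = k t"
        unfolding eventually_sequentially by (intro exI[of _ N0]) auto
      then show "(\<lambda>N. indicator (?A N) t *\<^sub>R k t) \<longlonglongrightarrow> k t"
        by (rule tendsto_eventually)
    qed
    show "AE t in lborel. norm (indicator (?A N) t *\<^sub>R k t) \<le> norm (k t)" for N
      by (auto simp: indicator_def)
  qed (use k in \<open>auto intro: borel_measurable_integrable borel_measurable_continuous_onI\<close>)
  moreover have "(LINT t|lborel. indicator (?A N) t *\<^sub>R k t) = (\<Sum>j = - int N..int N. ?I j)" for N
  proof -
    have "set_integrable lborel (?A N) k"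
      unfolding set_integrable_def using k(2) by (intro integrable_mult_indicator) auto
    from set_borel_integral_eq_integral(2)[OF this] show ?thesis
      by (simp add: part set_lebesgue_integral_def)
  qed
  ultimately have "(\<lambda>N. \<Sum>j = - int N..int N. ?I j) \<longlonglongrightarrow> (LINT t|lborel. k t)" by simp
  with has_sum_int_LIMSEQ[OF S] have "S = (LINT t|lborel. k t)" by (rule LIMSEQ_unique)
  with S show ?thesis by simp
qed

context quasi_periodic_module
begin

text \<open>One factor is bounded, the other decays quadratically; the comparison function is 1 / (1
  + t^2).\<close>

lemma H_set_pair_integrable:
  assumes \<psi>: "\<psi> \<in> H_set p" and \<eta>: "\<eta> \<in> H_set p"
  shows "integrable lborel (\<lambda>t. cnj (\<psi> r t) * \<eta> r t)"
proof -
  obtain A where A: "A \<ge> 0" "\<And>r t. norm (\<psi> r t) * (1 + \<bar>t\<bar>) ^ 0 \<le> A"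
    using H_set_decay[OF \<psi>, of 0] by blast
  obtain B where B: "B \<ge> 0" "\<And>r t. norm (\<eta> r t) * (1 + \<bar>t\<bar>) ^ 2 \<le> B"
    using H_set_decay[OF \<eta>, of 2] by blast
  have "integrable lborel (\<lambda>x::real. inverse (1 + x\<^sup>2))"
    using integrable_inverse_1_plus_square by (simp add: set_integrable_def einterval_def)
  then have "integrable lborel (\<lambda>t. (A * B) * inverse (1 + t\<^sup>2))"
    by (rule integrable_mult_right)
  then show ?thesis
  proof (rule Bochner_Integration.integrable_bound)
    show "(\<lambda>t. cnj (\<psi> r t) * \<eta> r t) \<in> borel_measurable lborel"
      by (simp, intro borel_measurable_continuous_onI continuous_intros schwartz_continuous_on H_set_schwartz \<psi> \<eta>)
    have "norm (cnj (\<psi> r t) * \<eta> r t) \<le> A * B * inverse (1 + t\<^sup>2)" for t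
    proof -
      have "norm (\<eta> r t) * (1 + t\<^sup>2) \<le> norm (\<eta> r t) * (1 + \<bar>t\<bar>) ^ 2"
        by (intro mult_left_mono) (auto simp: power2_eq_square algebra_simps)
      also note B(2)
      finally have "norm (\<eta> r t) \<le> B * inverse (1 + t\<^sup>2)"
        by (simp add: field_simps add_pos_nonneg)
      moreover have "norm (\<psi> r t) \<le> A" using A(2)[of r t] by simp
      ultimately show ?thesis
        using norm_ge_zero[of "\<psi> r t"] by (simp add: norm_mult mult.assoc mult_mono')
    qed
    then show "AE t in lborel. norm (cnj (\<psi> r t) * \<eta> r t) \<le> norm (A * B * inverse (1 + t\<^sup>2))"
      by (intro AE_I2) (metis abs_ge_self order.trans real_norm_def)
  qed
qed

lemma int_residue_bij: "bij_betw (\<lambda>(r, j). int r + j * int p) ({..<p} \<times> UNIV) UNIV"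
proof (rule bij_betwI[where g = "\<lambda>n. (nat (n mod int p), n div int p)"])
  show "(\<lambda>n. (nat (n mod int p), n div int p)) \<in> UNIV \<rightarrow> {..<p} \<times> UNIV"
    using nat_mod_p by auto
qed (use nat_mod_p p_pos in auto)

text \<open>Parseval's identity along the direction \<open>1\<close> leaves a sum over \<open>n\<close> of integrals over intervals of length
  \<open>Im \<tau>\<close>; those with \<open>n\<close> in a fixed residue class modulo \<open>p\<close> tile the real line.\<close>

lemma integral_inner_at:
  assumes f: "f \<in> F_set \<tau> p" and h: "h \<in> F_set \<tau> p"
  shows "(\<integral>t. inner_at p (components f) (components h) t \<partial>lborel) = Im \<tau> * tcoef \<tau> (\<lambda>z. cnj (f z) * h z) 0 0 0"
proof -
  let ?\<psi> = "components f" and ?\<eta> = "components h"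
  define k where "k r t = cnj (?\<psi> r t) * ?\<eta> r t" for r t
  note H = components_H_set[OF f] components_H_set[OF h]
  have k_cont: "continuous_on S (k r)" for S r
    unfolding k_def by (intro continuous_intros schwartz_continuous_on H_set_schwartz H)
  obtain A where A: "A \<ge> 0" "\<And>r t. norm (?\<psi> r t) * (1 + \<bar>t\<bar>) ^ 0 \<le> A"
    using H_set_decay[OF H(1), of 0] by blast
  obtain M where M: "M summable_on UNIV"
    "\<And>n y. \<bar>y\<bar> \<le> Im \<tau> \<Longrightarrow> norm (?\<eta> (nat (n mod int p)) (y + of_int n * \<rho>)) \<le> M n"
    using H_set_majorant[OF H(2), of "Im \<tau>"] by blast
  have slice: "((\<lambda>n. k (nat (n mod int p)) (s * Im \<tau> + of_int n * \<rho>)) has_sum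
      lcoef 1 (\<lambda>z. cnj (f z) * h z) 0 (0 + of_real s * \<tau>)) UNIV" for s
  proof -
    let ?z = "0 + of_real s * \<tau>"
    have "cnj (lcoef 1 f n ?z) * lcoef 1 h n ?z = k (nat (n mod int p)) (s * Im \<tau> + of_int n * \<rho>)" for n
    proof -
      have phase: "cnj (cis a * cis b * w) * (cis a * cis b * w') = cnj w * w'" for a b w w'
      proof -
        have "cnj (cis a * cis b * w) * (cis a * cis b * w') = (cnj (cis a) * cis a) * (cnj (cis b) * cis b) * (cnj w * w')"
          by simp
        then show ?thesis by (simp add: cis_cnj cis_mult)
      qed
      show ?thesis
        unfolding component_at[OF F_setD(1)[OF f] F_setD(2)[OF f], symmetric]
          component_at[OF F_setD(1)[OF h] F_setD(2)[OF h], symmetric] phase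
        by (simp add: k_def components_mod[OF f] components_mod[OF h] \<rho>_def)
    qed
    then show ?thesis
      using parseval[OF F_setD(1)[OF f] F_setD(1)[OF h] F_setD(2)[OF h], of ?z] by simp
  qed
  let ?J = "\<lambda>n. integral {of_int n * \<rho>..of_int n * \<rho> + Im \<tau>} (k (nat (n mod int p)))"
  have "((\<lambda>n. integral {0..1} (\<lambda>s. k (nat (n mod int p)) (s * Im \<tau> + of_int n * \<rho>))) has_sum
      tcoef \<tau> (\<lambda>z. cnj (f z) * h z) 0 0 0) UNIV"
    unfolding tcoef_def fcoef_def[of _ 0] minus_zero fchar_0 mult_1_right
  proof (rule has_sum_integral[where M = "\<lambda>n. A * M n"])
    show "continuous_on {0..1} (\<lambda>s. k (nat (n mod int p)) (s * Im \<tau> + of_int n * \<rho>))" for n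
      by (rule continuous_on_compose2[OF k_cont[of UNIV]]) (auto intro!: continuous_intros)
    show "(\<lambda>n. A * M n) summable_on UNIV" by (rule summable_on_cmult_right[OF M(1)])
    fix n and s :: real assume "s \<in> {0..1}"
    then have "\<bar>s * Im \<tau>\<bar> \<le> Im \<tau>"
      using Im_pos by (simp add: abs_mult mult_left_le_one_le)
    then show "norm (k (nat (n mod int p)) (s * Im \<tau> + of_int n * \<rho>)) \<le> A * M n"
      unfolding k_def norm_mult using A M(2) by (intro mult_mono) auto
  qed (rule slice)
  \<comment> \<open>The substitution t = s Im \<tau> + n \<rho> maps the unit interval onto a tile
    of length Im \<tau>; its Jacobian is the normalisation of the Hermitian structure.\<close>
  moreover have "integral {0..1} (\<lambda>s. k (nat (n mod int p)) (s * Im \<tau> + of_int n * \<rho>)) = ?J n /\<^sub>R Im \<tau>" for n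
  proof -
    have "(k (nat (n mod int p)) has_integral ?J n) (cbox (of_int n * \<rho>) (of_int n * \<rho> + Im \<tau>))"
      by (simp add: integrable_integral integrable_continuous_interval k_cont)
    from has_integral_affinity'[OF this Im_pos, of "of_int n * \<rho>"]
    show ?thesis using Im_pos by (auto simp: mult.commute)
  qed
  ultimately have "((\<lambda>n. ?J n /\<^sub>R Im \<tau>) has_sum tcoef \<tau> (\<lambda>z. cnj (f z) * h z) 0 0 0) UNIV"
    by simp
  from has_sum_cmult_right[OF this, of "of_real (Im \<tau>)"]
  have J: "(?J has_sum Im \<tau> * tcoef \<tau> (\<lambda>z. cnj (f z) * h z) 0 0 0) UNIV"
    using Im_neq by (simp add: scaleR_conv_of_real field_simps)
  let ?K = "\<lambda>r j. integral {real r * \<rho> + of_int j * Im \<tau>..real r * \<rho> + of_int j * Im \<tau> + Im \<tau>} (k r)"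
  \<comment> \<open>As p \<rho> = Im \<tau>, passing from n to n + p moves the tile by exactly its
    own length.\<close>
  have "?J (int r + j * int p) = ?K r j" if "r < p" for r j
    using that p_\<rho> by (simp add: algebra_simps)
  then have J': "((\<lambda>(r, j). ?K r j) has_sum Im \<tau> * tcoef \<tau> (\<lambda>z. cnj (f z) * h z) 0 0 0) ({..<p} \<times> UNIV)"
    using J unfolding has_sum_reindex_bij_betw[OF int_residue_bij, of ?J, symmetric]
    by (rule_tac has_sum_cong[THEN iffD1]) auto
  have "(?K r has_sum (LINT t|lborel. k r t)) UNIV" if "r < p" for r
  proof (rule integral_unfold[OF k_cont _ Im_pos])
    show "integrable lborel (k r)"
      unfolding k_def by (rule H_set_pair_integrable[OF H])
    show "?K r summable_on UNIV"
      using J' that by (intro summable_on_SigmaD1[of ?K "{..<p}" "\<lambda>_. UNIV"]) (auto simp: summable_on_def)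
  qed
  then have "((\<lambda>r. LINT t|lborel. k r t) has_sum Im \<tau> * tcoef \<tau> (\<lambda>z. cnj (f z) * h z) 0 0 0) {..<p}"
    by (intro has_sum_SigmaD[OF J']) auto
  then have "(\<Sum>r<p. LINT t|lborel. k r t) = Im \<tau> * tcoef \<tau> (\<lambda>z. cnj (f z) * h z) 0 0 0"
    by (simp add: has_sum_finite_iff)
  moreover have "(\<integral>t. inner_at p ?\<psi> ?\<eta> t \<partial>lborel) = (\<Sum>r<p. LINT t|lborel. k r t)"
    unfolding inner_at_def k_def
    by (rule Bochner_Integration.integral_sum) (rule H_set_pair_integrable[OF H])
  ultimately show ?thesis by simp
qed

text \<open>Multiplying by u^(-m) v^(-n) brings the coefficient (m, n) to position (0, 0), the only
  one that the integral over the line computes.\<close>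

lemma herm_coeff_components:
  assumes f: "f \<in> F_set \<tau> p" and g: "g \<in> F_set \<tau> p"
  shows "herm_coeff \<tau> p (components f) (components g) m n = Im \<tau> * tcoef \<tau> (\<lambda>z. cnj (f z) * g z) m n 0"
proof -
  let ?a = "\<lambda>z. cnj (f z) * g z"
  let ?h = "\<lambda>z. g z * torus_uv \<tau> (- m) (- n) z"
  have "herm_coeff \<tau> p (components f) (components g) m n = Im \<tau> * tcoef \<tau> (\<lambda>z. cnj (f z) * ?h z) 0 0 0"
    unfolding herm_coeff_def act_components[OF g torus_uv_Cinf[OF Im_neq]]
    by (rule integral_inner_at[OF f F_set_torus_uv[OF g]])
  also have "(\<lambda>z. cnj (f z) * ?h z) = (\<lambda>z. ?a z * torus_uv \<tau> (- m) (- n) z)"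
    by (simp add: mult.assoc)
  also have "tcoef \<tau> (\<lambda>z. ?a z * torus_uv \<tau> (- m) (- n) z) 0 0 0 = tcoef \<tau> ?a m n 0"
  proof -
    have "torus_uv \<tau> (- m) (- n) (0 + of_real t * \<tau>) = fchar (- n) t" for t
      using torus_uv_line[OF Im_neq, of "- m" "- n" 0 t] by simp
    then have "tcoef \<tau> (\<lambda>z. ?a z * torus_uv \<tau> (- m) (- n) z) 0 0 0 =
        fcoef (\<lambda>t. lcoef 1 ?a m (0 + of_real t * \<tau>) * fchar (- n) t) 0"
      unfolding tcoef_def lcoef_mult_torus_uv by (simp add: mult.commute)
    then show ?thesis by (simp only: fcoef_mult_fchar tcoef_def) simp
  qed
  finally show ?thesis .
qed

lemma herm_has_sum:
  assumes f: "f \<in> F_set \<tau> p" and g: "g \<in> F_set \<tau> p"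
  shows "((\<lambda>(m, n). torus_uv \<tau> m n z * herm_coeff \<tau> p (components f) (components g) m n) has_sum
    Im \<tau> * (cnj (f z) * g z)) UNIV"
  using has_sum_cmult_right[OF torus_expansion[OF F_set_cnj_mult[OF f g] Im_neq, of z], of "of_real (Im \<tau>)"]
  by (simp add: herm_coeff_components[OF f g] case_prod_unfold mult_ac)

lemma herm_components:
  assumes f: "f \<in> F_set \<tau> p" and g: "g \<in> F_set \<tau> p"
  shows "herm \<tau> p (components f) (components g) = (\<lambda>z. cnj (f z) * g z)"
  unfolding herm_def using infsumI[OF herm_has_sum[OF f g]] Im_neq by simp

end

section \<open>Ring and module laws, positivity and the isomorphism\<close>

lemma cring_torus_ring: "cring (torus_ring \<tau>)"
proof (rule cringI)
  show "abelian_group (torus_ring \<tau>)"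
  proof (rule abelian_groupI)
    fix a assume a: "a \<in> carrier (torus_ring \<tau>)"
    have "(\<lambda>z. (- 1) * a z) \<in> Cinf_torus \<tau>"
      using a by (intro Cinf_torus_mult Cinf_torus_const) (simp add: torus_ring_def)
    then show "\<exists>b\<in>carrier (torus_ring \<tau>). b \<oplus>\<^bsub>torus_ring \<tau>\<^esub> a = \<zero>\<^bsub>torus_ring \<tau>\<^esub>"
      by (intro bexI[of _ "\<lambda>z. (- 1) * a z"]) (simp_all add: torus_ring_def)
  qed (auto simp: torus_ring_def Cinf_torus_add Cinf_torus_const add_ac)
  show "Group.comm_monoid (torus_ring \<tau>)"
    by (rule comm_monoidI) (auto simp: torus_ring_def Cinf_torus_mult Cinf_torus_const mult_ac)
qed (auto simp: torus_ring_def distrib_right)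

context quasi_periodic_module
begin

lemma module_H_module: "module (torus_ring \<tau>) (H_module \<tau> p)"
proof (rule moduleI)
  show "cring (torus_ring \<tau>)" by (rule cring_torus_ring)
  show "abelian_group (H_module \<tau> p)"
  proof (rule abelian_groupI)
    fix \<psi> \<eta> assume "\<psi> \<in> carrier (H_module \<tau> p)" "\<eta> \<in> carrier (H_module \<tau> p)"
    then obtain f g where fg: "f \<in> F_set \<tau> p" "\<psi> = components f" "g \<in> F_set \<tau> p" "\<eta> = components g"
      by (auto simp: H_module_def H_set_eq)
    then show "\<psi> \<oplus>\<^bsub>H_module \<tau> p\<^esub> \<eta> \<in> carrier (H_module \<tau> p)"
      using components_H_set[OF F_set_add[OF fg(1,3)]] by (simp add: H_module_def components_add)
  next
    show "\<zero>\<^bsub>H_module \<tau> p\<^esub> \<in> carrier (H_module \<tau> p)"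
      using components_H_set[OF F_set_zero] by (simp add: H_module_def components_zero)
  next
    fix \<psi> assume "\<psi> \<in> carrier (H_module \<tau> p)"
    then obtain f where f: "f \<in> F_set \<tau> p" "\<psi> = components f"
      by (auto simp: H_module_def H_set_eq)
    have "(\<lambda>z. f z * (- 1)) \<in> F_set \<tau> p"
      by (intro F_set_mult f Cinf_torus_const)
    then have "(\<lambda>r t. (- 1) * \<psi> r t) \<in> H_set p"
      unfolding f(2) components_cmult[symmetric] by (rule components_H_set)
    then show "\<exists>\<eta>\<in>carrier (H_module \<tau> p). \<eta> \<oplus>\<^bsub>H_module \<tau> p\<^esub> \<psi> = \<zero>\<^bsub>H_module \<tau> p\<^esub>"
      by (intro bexI[of _ "\<lambda>r t. (- 1) * \<psi> r t"]) (simp_all add: H_module_def)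
  qed (auto simp: H_module_def add_ac)
next
  fix a \<psi> assume "a \<in> carrier (torus_ring \<tau>)" "\<psi> \<in> carrier (H_module \<tau> p)"
  then show "a \<odot>\<^bsub>H_module \<tau> p\<^esub> \<psi> \<in> carrier (H_module \<tau> p)"
    by (auto simp: H_module_def torus_ring_def H_set_eq act_components F_set_mult)
next
  fix a b \<psi> assume "a \<in> carrier (torus_ring \<tau>)" "b \<in> carrier (torus_ring \<tau>)" "\<psi> \<in> carrier (H_module \<tau> p)"
  then show "(a \<oplus>\<^bsub>torus_ring \<tau>\<^esub> b) \<odot>\<^bsub>H_module \<tau> p\<^esub> \<psi> =
      a \<odot>\<^bsub>H_module \<tau> p\<^esub> \<psi> \<oplus>\<^bsub>H_module \<tau> p\<^esub> b \<odot>\<^bsub>H_module \<tau> p\<^esub> \<psi>"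
    by (auto simp: H_module_def torus_ring_def H_set_eq act_components F_set_mult Cinf_torus_add
        distrib_left components_add)
next
  fix a \<psi> \<eta> assume a: "a \<in> carrier (torus_ring \<tau>)" and "\<psi> \<in> carrier (H_module \<tau> p)" "\<eta> \<in> carrier (H_module \<tau> p)"
  then obtain f g where fg: "f \<in> F_set \<tau> p" "\<psi> = components f" "g \<in> F_set \<tau> p" "\<eta> = components g"
    by (auto simp: H_module_def H_set_eq)
  have "act \<tau> p (components (\<lambda>z. f z + g z)) a = (\<lambda>r t. act \<tau> p (components f) a r t + act \<tau> p (components g) a r t)"
    using a fg act_components[OF F_set_add[OF fg(1,3)], of a]
    by (simp add: torus_ring_def act_components F_set_mult distrib_right components_add)
  then show "a \<odot>\<^bsub>H_module \<tau> p\<^esub> (\<psi> \<oplus>\<^bsub>H_module \<tau> p\<^esub> \<eta>) =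
      a \<odot>\<^bsub>H_module \<tau> p\<^esub> \<psi> \<oplus>\<^bsub>H_module \<tau> p\<^esub> a \<odot>\<^bsub>H_module \<tau> p\<^esub> \<eta>"
    using fg by (simp add: H_module_def components_add)
next
  fix a b \<psi> assume "a \<in> carrier (torus_ring \<tau>)" "b \<in> carrier (torus_ring \<tau>)" "\<psi> \<in> carrier (H_module \<tau> p)"
  then show "(a \<otimes>\<^bsub>torus_ring \<tau>\<^esub> b) \<odot>\<^bsub>H_module \<tau> p\<^esub> \<psi> =
      a \<odot>\<^bsub>H_module \<tau> p\<^esub> (b \<odot>\<^bsub>H_module \<tau> p\<^esub> \<psi>)"
    by (auto simp: H_module_def torus_ring_def H_set_eq act_components F_set_mult Cinf_torus_mult mult_ac)
next
  fix \<psi> assume "\<psi> \<in> carrier (H_module \<tau> p)"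
  then show "\<one>\<^bsub>torus_ring \<tau>\<^esub> \<odot>\<^bsub>H_module \<tau> p\<^esub> \<psi> = \<psi>"
    by (auto simp: H_module_def torus_ring_def H_set_eq act_components Cinf_torus_const)
qed

lemma pre_hilbert_H_module:
  "right_pre_hilbert_module (torus_ring \<tau>) (H_module \<tau> p) star_fun pos_fun (herm \<tau> p)"
proof -
  interpret module "torus_ring \<tau>" "H_module \<tau> p" by (rule module_H_module)
  have carrier: "carrier (torus_ring \<tau>) = Cinf_torus \<tau>" "carrier (H_module \<tau> p) = components ` F_set \<tau> p"
    by (simp_all add: torus_ring_def H_module_def H_set_eq)
  show ?thesis
  proof unfold_locales
    fix x y assume "x \<in> carrier (H_module \<tau> p)" "y \<in> carrier (H_module \<tau> p)"
    then obtain f g where fg: "f \<in> F_set \<tau> p" "x = components f" "g \<in> F_set \<tau> p" "y = components g"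
      unfolding carrier by blast
    show "herm \<tau> p x y \<in> carrier (torus_ring \<tau>)"
      using fg by (simp add: herm_components F_set_cnj_mult carrier)
    show "herm \<tau> p y x = star_fun (herm \<tau> p x y)"
      using fg by (simp add: herm_components star_fun_def mult.commute)
    show "herm \<tau> p x (y \<oplus>\<^bsub>H_module \<tau> p\<^esub> z) = herm \<tau> p x y \<oplus>\<^bsub>torus_ring \<tau>\<^esub> herm \<tau> p x z"
      if z: "z \<in> carrier (H_module \<tau> p)" for z
    proof -
      obtain h where h: "h \<in> F_set \<tau> p" "z = components h" using z unfolding carrier by blast
      have "y \<oplus>\<^bsub>H_module \<tau> p\<^esub> z = components (\<lambda>z. g z + h z)"
        using fg h by (simp add: H_module_def components_add)
      then show ?thesis
        using fg h by (simp add: herm_components F_set_add distrib_left torus_ring_def)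
    qed
    show "herm \<tau> p x (a \<odot>\<^bsub>H_module \<tau> p\<^esub> y) = herm \<tau> p x y \<otimes>\<^bsub>torus_ring \<tau>\<^esub> a"
      if "a \<in> carrier (torus_ring \<tau>)" for a
      using fg that by (simp add: H_module_def torus_ring_def act_components herm_components F_set_mult mult.assoc)
  next
    fix x assume "x \<in> carrier (H_module \<tau> p)"
    then obtain f where f: "f \<in> F_set \<tau> p" "x = components f"
      unfolding carrier by blast
    have sq: "cnj w * w = of_real ((norm w)\<^sup>2)" for w
      using complex_norm_square[of w] by (simp add: mult.commute)
    show "pos_fun (herm \<tau> p x x)"
      using f by (simp add: pos_fun_def herm_components sq)
    show "x = \<zero>\<^bsub>H_module \<tau> p\<^esub>" if "herm \<tau> p x x = \<zero>\<^bsub>torus_ring \<tau>\<^esub>"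
    proof -
      have "cnj (f z) * f z = 0" for z
        using that f by (simp add: herm_components torus_ring_def fun_eq_iff)
      then have "f = (\<lambda>_. 0)" by (simp add: fun_eq_iff)
      then show ?thesis using f by (simp add: components_zero H_module_def)
    qed
  qed (auto simp: torus_ring_def star_fun_def Cinf_torus_cnj)
qed

lemma phi_module_iso: "phi \<tau> p \<in> module_iso (torus_ring \<tau>) (F_module \<tau> p) (H_module \<tau> p)"
proof -
  have "bij_betw (phi \<tau> p) (F_set \<tau> p) (H_set p)"
    using bij_components bij_betw_cong[of "F_set \<tau> p" "phi \<tau> p" components] phi_eq by blast
  then show ?thesis
    by (auto simp: module_iso_def F_module_def H_module_def torus_ring_def phi_eq
        F_set_add F_set_mult components_add act_components)
qed

lemma torus_u_eq: "torus_u \<tau> = torus_uv \<tau> 1 0" and torus_v_eq: "torus_v \<tau> = torus_uv \<tau> 0 1"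
  by (simp_all add: torus_uv_def fun_eq_iff)

lemma act_generators:
  assumes "\<psi> \<in> H_set p"
  shows "act \<tau> p \<psi> (torus_u \<tau>) = op_u \<tau> p \<psi>" "act \<tau> p \<psi> (torus_v \<tau>) = op_v \<tau> p \<psi>"
    "act \<tau> p \<psi> (\<lambda>_. c) = (\<lambda>r t. c * \<psi> r t)"
  using assms
  by (auto simp: H_set_eq torus_u_eq torus_v_eq act_components torus_uv_Cinf Im_neq
      components_torus_u components_torus_v Cinf_torus_const components_cmult)

end

theorem proposition3p3:
  fixes p :: nat and \<tau> :: complex
  assumes "p \<ge> 1" and "Im \<tau> > 0"
  shows
    \<comment> \<open>the series defining the module structure and the Hermitian structure converge\<close>
    "(\<forall>\<psi>\<in>H_set p. \<forall>a\<in>Cinf_torus \<tau>. \<forall>r t.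
        (\<lambda>(m, n). torus_coeff \<tau> a (m, n) * act_uv \<tau> p \<psi> m n r t) summable_on UNIV) \<and>
     (\<forall>\<psi>\<in>H_set p. \<forall>\<eta>\<in>H_set p. \<forall>z.
        (\<lambda>(m, n). torus_uv \<tau> m n z * herm_coeff \<tau> p \<psi> \<eta> m n) summable_on UNIV) \<and>
     \<comment> \<open>the generators act as prescribed, and constants act as scalars\<close>
     (\<forall>\<psi>\<in>H_set p.
        act \<tau> p \<psi> (torus_u \<tau>) = tensor_op p (weyl (Im \<tau> / real p) (- (Re \<tau> / Im \<tau>))) (shift p) \<psi> \<and>
        act \<tau> p \<psi> (torus_v \<tau>) = tensor_op p (weyl 0 (1 / Im \<tau>)) (adjoint_mat (clock p)) \<psi> \<and>
        (\<forall>c. act \<tau> p \<psi> (\<lambda>_. c) = (\<lambda>r t. c * \<psi> r t))) \<and>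
     right_pre_hilbert_module (torus_ring \<tau>) (H_module \<tau> p) star_fun pos_fun (herm \<tau> p) \<and>
     phi \<tau> p \<in> module_iso (torus_ring \<tau>) (F_module \<tau> p) (H_module \<tau> p) \<and>
     (\<forall>f\<in>F_set \<tau> p. \<forall>g\<in>F_set \<tau> p. herm \<tau> p (phi \<tau> p f) (phi \<tau> p g) = (\<lambda>z. star_fun f z * g z))"
proof -
  interpret quasi_periodic_module p \<tau> by unfold_locales (use assms in auto)
  show ?thesis
  proof (intro conjI ballI allI)
    show "(\<lambda>(m, n). torus_coeff \<tau> a (m, n) * act_uv \<tau> p \<psi> m n r t) summable_on UNIV"
      if "\<psi> \<in> H_set p" "a \<in> Cinf_torus \<tau>" for \<psi> a r t
      using that has_sum_imp_summable[OF act_has_sum] by (auto simp: H_set_eq)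
    show "(\<lambda>(m, n). torus_uv \<tau> m n z * herm_coeff \<tau> p \<psi> \<eta> m n) summable_on UNIV"
      if "\<psi> \<in> H_set p" "\<eta> \<in> H_set p" for \<psi> \<eta> z
      using that has_sum_imp_summable[OF herm_has_sum] by (auto simp: H_set_eq)
    show "herm \<tau> p (phi \<tau> p f) (phi \<tau> p g) = (\<lambda>z. star_fun f z * g z)"
      if "f \<in> F_set \<tau> p" "g \<in> F_set \<tau> p" for f g
      using that by (simp add: phi_eq herm_components star_fun_def)
  qed (simp_all add: act_generators op_u_def[symmetric] op_v_def[symmetric] pre_hilbert_H_module phi_module_iso)
qed

end
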